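(* Let $K$ be a field, $R=K[x_1,\ldots,x_n]$, let $I_{c,\mathcal{F}}\subseteq R$ be the ideal of a linear star configuration of height $c$, and let $s$ be a positive integer. The following are equivalent: (1) $(I_{c,\mathcal{F}})_{\mathfrak{p}}$ is of linear type for every prime $\mathfrak{p}\in\operatorname{Spec}(R)$ with $\operatorname{ht}\mathfrak{p}\le s-1$. (2) $I_{c,\mathcal{F}}$ satisfies the $G_s$ condition.
   Context: For a set $\mathcal{F}=\{F_1,\ldots,F_t\}$ of homogeneous polynomials in $R$ and $1\le c\le\min\{n,t\}$, let $I_{c,\mathcal{F}}=\bigcap_{1\le i_1<\cdots<i_c\le t}(F_{i_1},\ldots,F_{i_c})$. It is called the ideal of the star configuration of height $c$ on $\mathcal{F}$ if every subset of $\mathcal{F}$ of cardinality $c+1$ is a regular sequence (if $c=t$: if $\mathcal{F}$ itself is a regular sequence); it is a linear star configuration if moreover all $F_i$ are homogeneous of degree one. An ideal $I=(g_1,\ldots,g_\mu)$ of a Noetherian ring $A$ is of linear type if the kernel of the $A$-algebra map $A[T_1,\ldots,T_\mu]\to A[I\tau]\subseteq A[\tau]$, $T_i\mapsto g_i\tau$, is generated by elements homogeneous of degree one in the $T_i$. An ideal $I$ of $R$ satisfies $G_s$ if $\mu(I_{\mathfrak{p}})\le\dim R_{\mathfrak{p}}$ for every prime $\mathfrak{p}\supseteq I$ of height at most $s-1$, where $\mu$ denotes the minimal number of generators. *)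

theory Defs
  imports
    "HOL-Library.Poly_Mapping"
    "HOL-Library.Extended_Nat"
    "HOL-Computational_Algebra.Fraction_Field"
    "HOL-Computational_Algebra.Polynomial"
    "HOL-Algebra.Algebraic_Closure_Type"
begin

text \<open>
  Every ring occurring below is a subring of a commutative ring that is a type: it is given by
  its carrier set and inherits its operations from the type.
\<close>

definition ring_on :: "'a::comm_ring_1 set \<Rightarrow> 'a ring" where
  "ring_on S = ring_of_type_algebra\<lparr>carrier := S\<rparr>"

lemma ring_on_simps [simp]:
  "carrier (ring_on S) = S"
  "x \<otimes>\<^bsub>ring_on S\<^esub> y = x * y" "x \<oplus>\<^bsub>ring_on S\<^esub> y = x + y"
  "\<one>\<^bsub>ring_on S\<^esub> = 1" "\<zero>\<^bsub>ring_on S\<^esub> = 0"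
  by (simp_all add: ring_on_def ring_of_type_algebra_def)

lemma cring_ring_on:
  assumes "1 \<in> S" and "\<And>x y. x \<in> S \<Longrightarrow> y \<in> S \<Longrightarrow> x - y \<in> S"
    and "\<And>x y. x \<in> S \<Longrightarrow> y \<in> S \<Longrightarrow> x * y \<in> S"
  shows "cring (ring_on S)"
proof -
  have z: "0 \<in> S" using assms(2)[OF assms(1) assms(1)] by simp
  have m: "- x \<in> S" if "x \<in> S" for x using assms(2)[OF z that] by simp
  have a: "x + y \<in> S" if "x \<in> S" "y \<in> S" for x y
    using assms(2)[OF that(1) m[OF that(2)]] by simp
  show ?thesis
    by (rule cringI; (rule abelian_groupI comm_monoidI)?)
       (auto simp: assms z a algebra_simps intro: m bexI[of _ "- x" for x])
qed


section \<open>Polynomial rings\<close>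

text \<open>
  A polynomial in variables indexed by natural numbers is a finitely supported map from
  exponent vectors to coefficients; multiplication is convolution.
\<close>

type_synonym 'a mpoly = "(nat \<Rightarrow>\<^sub>0 nat) \<Rightarrow>\<^sub>0 'a"

text \<open>\<open>mpolys S n\<close> is the carrier of $S[x_0,\ldots,x_{n-1}]$, for a subring \<open>S\<close> of \<open>'a\<close>.\<close>

definition mpolys :: "'a::comm_ring_1 set \<Rightarrow> nat \<Rightarrow> 'a mpoly set" where
  "mpolys S n = {f. \<forall>m\<in>Poly_Mapping.keys f.
     Poly_Mapping.keys m \<subseteq> {..<n} \<and> Poly_Mapping.lookup f m \<in> S}"

definition homogeneous :: "nat \<Rightarrow> 'a::comm_ring_1 mpoly \<Rightarrow> bool" where
  "homogeneous d f \<longleftrightarrow> (\<forall>m\<in>Poly_Mapping.keys f.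
     (\<Sum>i\<in>Poly_Mapping.keys m. Poly_Mapping.lookup m i) = d)"


section \<open>Height, dimension, number of generators, regular sequences\<close>

definition prime_chains :: "('a, 'b) ring_scheme \<Rightarrow> 'a set list set" where
  "prime_chains R =
     {ps. ps \<noteq> [] \<and> (\<forall>q\<in>set ps. primeideal q R) \<and> sorted_wrt (\<subset>) ps}"

definition height :: "('a, 'b) ring_scheme \<Rightarrow> 'a set \<Rightarrow> enat" where
  "height R p = (SUP ps\<in>{ps \<in> prime_chains R. last ps = p}. enat (length ps - 1))"

definition krull_dim :: "('a, 'b) ring_scheme \<Rightarrow> enat" where
  "krull_dim R = (SUP ps\<in>prime_chains R. enat (length ps - 1))"

text \<open>The infimum of the empty set is \<open>\<infinity>\<close>, the value at an ideal that is not finitely generated.\<close>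

definition min_gens :: "('a, 'b) ring_scheme \<Rightarrow> 'a set \<Rightarrow> enat" where
  "min_gens R I =
     (INF G\<in>{G. finite G \<and> G \<subseteq> carrier R \<and> I = genideal R G}. enat (card G))"

text \<open>
  The first condition says that the class of \<open>as ! i\<close> is a non-zero-divisor modulo the ideal
  generated by the preceding entries.
\<close>

definition regular_sequence :: "('a, 'b) ring_scheme \<Rightarrow> 'a list \<Rightarrow> bool" where
  "regular_sequence R as \<longleftrightarrow> set as \<subseteq> carrier R \<and>
     (\<forall>i<length as. \<forall>r\<in>carrier R.
        as ! i \<otimes>\<^bsub>R\<^esub> r \<in> genideal R (set (take i as)) \<longrightarrow> r \<in> genideal R (set (take i as))) \<and>
     genideal R (set as) \<noteq> carrier R"


section \<open>Localization at a prime of a domain\<close>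

text \<open>
  For a subring \<open>S\<close> of a domain, with prime ideal \<open>p\<close>, and an ideal \<open>I\<close> of \<open>S\<close>,
  \<open>localize S p I\<close> is the extension $I_p$ to the local ring $S_p$, both realized inside the
  fraction field; the carrier of $S_p$ itself is \<open>localize S p S\<close>.
\<close>

definition localize :: "'a::idom set \<Rightarrow> 'a set \<Rightarrow> 'a set \<Rightarrow> 'a fract set" where
  "localize S p I = {Fract a b | a b. a \<in> I \<and> b \<in> S - p}"


section \<open>Ideals of linear type and the condition $G_s$\<close>

text \<open>
  The $S$-algebra map $S[T_0,\ldots,T_{\mu-1}] \to S[\tau]$, $T_i \mapsto g_i \tau$, whose image
  is the Rees algebra $S[I\tau]$ of the ideal generated by the $g_i$.
\<close>

definition rees_map :: "'a::comm_ring_1 list \<Rightarrow> 'a mpoly \<Rightarrow> 'a poly" where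
  "rees_map gs f = (\<Sum>m\<in>Poly_Mapping.keys f. [:Poly_Mapping.lookup f m:] *
     (\<Prod>i<length gs. monom (gs ! i) 1 ^ Poly_Mapping.lookup m i))"

definition rees_kernel :: "'a::comm_ring_1 set \<Rightarrow> 'a list \<Rightarrow> 'a mpoly set" where
  "rees_kernel S gs = a_kernel (ring_on (mpolys S (length gs)))
     (ring_on {q. \<forall>i. poly.coeff q i \<in> S}) (rees_map gs)"

text \<open>The property does not depend on the choice of the finite generating family \<open>gs\<close>.\<close>

definition linear_type :: "'a::comm_ring_1 set \<Rightarrow> 'a set \<Rightarrow> bool" where
  "linear_type S I \<longleftrightarrow> (\<exists>gs. set gs \<subseteq> S \<and> I = genideal (ring_on S) (set gs) \<and>
     (\<exists>L \<subseteq> rees_kernel S gs. (\<forall>f\<in>L. homogeneous 1 f) \<and>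
        rees_kernel S gs = genideal (ring_on (mpolys S (length gs))) L))"

definition G_cond :: "'a::idom set \<Rightarrow> nat \<Rightarrow> 'a set \<Rightarrow> bool" where
  "G_cond S s I \<longleftrightarrow> (\<forall>p. primeideal p (ring_on S) \<and> I \<subseteq> p \<and> height (ring_on S) p \<le> enat (s - 1) \<longrightarrow>
     min_gens (ring_on (localize S p S)) (localize S p I) \<le> krull_dim (ring_on (localize S p S)))"


section \<open>Star configurations\<close>

definition star_ideal :: "nat \<Rightarrow> nat \<Rightarrow> 'k::field mpoly set \<Rightarrow> 'k mpoly set" where
  "star_ideal n c F = (\<Inter>G\<in>{G. G \<subseteq> F \<and> card G = c}. genideal (ring_on (mpolys UNIV n)) G)"

text \<open>
  A set is called a regular sequence if each of its enumerations is one; for homogeneous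
  polynomials of positive degree the order is irrelevant.
\<close>

definition star_configuration :: "nat \<Rightarrow> nat \<Rightarrow> 'k::field mpoly set \<Rightarrow> bool" where
  "star_configuration n c F \<longleftrightarrow>
     finite F \<and> F \<subseteq> mpolys UNIV n \<and> (\<forall>f\<in>F. \<exists>d. homogeneous d f) \<and>
     1 \<le> c \<and> c \<le> min n (card F) \<and>
     (\<forall>as. distinct as \<and> set as \<subseteq> F \<and> length as = (if c = card F then c else c + 1) \<longrightarrow>
        regular_sequence (ring_on (mpolys UNIV n)) as)"

definition linear_star_configuration :: "nat \<Rightarrow> nat \<Rightarrow> 'k::field mpoly set \<Rightarrow> bool" where
  "linear_star_configuration n c F \<longleftrightarrow> star_configuration n c F \<and> (\<forall>f\<in>F. homogeneous 1 f)"

end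

theory Submission
  imports Defs
begin

text \<open>
  The ideal $I$ of the star configuration is generated by the products over the complements
  of the $(c-1)$-subsets of $F$: modulo a $(c-1)$-subset $G$ an element of $I$ is a multiple of the
  product over the complement of $G$, and subtracting these multiples for all $G$ leads to
  height $c-1$. At a prime $p$ only the forms $F_p = F \cap p$ matter, since the others become units.

  If $c = 1$, or $F_p$ has at most $c$ elements, or $c = 2$ and $F_p$ is linearly independent, then
  $I_p$ is principal, or, in suitable coordinates, it is generated by monomials whose Rees kernel is
  visibly generated by linear binomials; the number of generators is at most the length of a chain
  of primes generated by elements of $F_p$.

  Otherwise pass to the prime $q \subseteq p$ generated by $F_p$. The leading forms along $q$, reduced
  modulo a $(c-1)$-subset, are functionals on $I_q$ that separate all the generators. Hence $I_q$ needs
  $\binom{t}{c-1}$ generators with $t = |F_p|$, which is more than the height of $q$. Moreover the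
  generators satisfy a nonlinear relation: a quadric of the form $Y_1 Y_2 - Y_3 Y_4$ if $c \geq 3$, or the
  one coming from a linear dependency of $F_p$ if $c = 2$. Were $I_q$ of linear type, then the values of
  every functional would satisfy this relation, which they do not. So both conditions of the theorem
  say that no prime of height at most $s-1$ is of the second kind.
\<close>

section \<open>Ideals of subrings\<close>

text \<open>The passage from \<open>p\<close> to \<open>q\<close> is forced by the second condition:
  the number of generators depends only on the forms in the prime, while the height of
  \<open>p\<close> can be much larger than that of \<open>q\<close>, so the inequality may hold at
  \<open>p\<close> and fail at \<open>q\<close>, the smallest prime containing the same forms. As
  \<open>q\<close> lies inside \<open>p\<close>, its height stays within the bound. The definition
  of linear type offers some unknown generating family, so its refutation must not depend on the
  family: a relation among arbitrary elements of the ideal is rewritten in it, and evaluation at the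
  values of a functional kills all linear relations, hence also the rewritten one. The functionals
  have values in a field, so a dual basis argument does the work of Nakayama's lemma. Two facts
  about dimension suffice: independent forms generate chains of primes, and localizing at a prime
  generated by \<open>r\<close> linear forms leaves no chain longer than \<open>r\<close>. The
  latter comes from counting monomials.\<close>

definition is_subring :: "'a::comm_ring_1 set \<Rightarrow> bool" where
  "is_subring A \<longleftrightarrow> 1 \<in> A \<and> (\<forall>x\<in>A. \<forall>y\<in>A. x - y \<in> A \<and> x * y \<in> A)"

definition is_ideal :: "'a::comm_ring_1 set \<Rightarrow> 'a set \<Rightarrow> bool" where
  "is_ideal A I \<longleftrightarrow> I \<subseteq> A \<and> 0 \<in> I \<and> (\<forall>x\<in>I. \<forall>y\<in>I. x + y \<in> I) \<and> (\<forall>a\<in>A. \<forall>x\<in>I. a * x \<in> I)"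

definition is_prime :: "'a::comm_ring_1 set \<Rightarrow> 'a set \<Rightarrow> bool" where
  "is_prime A p \<longleftrightarrow> is_ideal A p \<and> 1 \<notin> p \<and> (\<forall>x\<in>A. \<forall>y\<in>A. x * y \<in> p \<longrightarrow> x \<in> p \<or> y \<in> p)"

definition span_ideal :: "'a::comm_ring_1 set \<Rightarrow> 'a set \<Rightarrow> 'a set" where
  "span_ideal A G = \<Inter>{I. is_ideal A I \<and> G \<subseteq> I}"

lemma is_subringD:
  assumes "is_subring A"
  shows "1 \<in> A" "0 \<in> A" "x \<in> A \<Longrightarrow> y \<in> A \<Longrightarrow> x - y \<in> A" "x \<in> A \<Longrightarrow> y \<in> A \<Longrightarrow> x * y \<in> A"
    "x \<in> A \<Longrightarrow> - x \<in> A" "x \<in> A \<Longrightarrow> y \<in> A \<Longrightarrow> x + y \<in> A"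
proof -
  show 1: "1 \<in> A" and d: "x \<in> A \<Longrightarrow> y \<in> A \<Longrightarrow> x - y \<in> A"
    and "x \<in> A \<Longrightarrow> y \<in> A \<Longrightarrow> x * y \<in> A" for x y
    using assms by (auto simp: is_subring_def)
  show 0: "0 \<in> A" using d[OF 1 1] by simp
  show m: "x \<in> A \<Longrightarrow> - x \<in> A" for x using d[OF 0, of x] by simp
  show "x \<in> A \<Longrightarrow> y \<in> A \<Longrightarrow> x + y \<in> A" using d[OF _ m, of x y] by simp
qed

lemma is_subring_sum: "is_subring A \<Longrightarrow> (\<And>i. i \<in> I \<Longrightarrow> f i \<in> A) \<Longrightarrow> sum f I \<in> A"
  by (induction I rule: infinite_finite_induct) (auto intro: is_subringD)

lemma is_subring_prod: "is_subring A \<Longrightarrow> (\<And>i. i \<in> I \<Longrightarrow> f i \<in> A) \<Longrightarrow> prod f I \<in> A"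
  by (induction I rule: infinite_finite_induct) (auto intro: is_subringD)

lemma is_subring_power: "is_subring A \<Longrightarrow> x \<in> A \<Longrightarrow> x ^ k \<in> A"
  by (induction k) (auto intro: is_subringD)

lemma is_subring_UNIV [simp]: "is_subring UNIV"
  by (simp add: is_subring_def)

lemma cring_ring_on': "is_subring A \<Longrightarrow> cring (ring_on A)"
  by (rule cring_ring_on) (auto intro: is_subringD)

lemma is_idealD:
  assumes "is_ideal A I"
  shows "x \<in> I \<Longrightarrow> x \<in> A" "0 \<in> I" "x \<in> I \<Longrightarrow> y \<in> I \<Longrightarrow> x + y \<in> I" "a \<in> A \<Longrightarrow> x \<in> I \<Longrightarrow> a * x \<in> I"
    "a \<in> A \<Longrightarrow> x \<in> I \<Longrightarrow> x * a \<in> I"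
  using assms by (auto simp: is_ideal_def mult.commute)

lemma is_ideal_uminus: "is_subring A \<Longrightarrow> is_ideal A I \<Longrightarrow> x \<in> I \<Longrightarrow> - x \<in> I"
  using is_idealD(4)[of A I "-1" x] by (auto intro: is_subringD)

lemma is_ideal_diff: "is_subring A \<Longrightarrow> is_ideal A I \<Longrightarrow> x \<in> I \<Longrightarrow> y \<in> I \<Longrightarrow> x - y \<in> I"
  using is_idealD(3)[of A I x "-y"] is_ideal_uminus by fastforce

lemma is_ideal_sum: "is_ideal A I \<Longrightarrow> (\<And>i. i \<in> Z \<Longrightarrow> f i \<in> I) \<Longrightarrow> sum f Z \<in> I"
  by (induction Z rule: infinite_finite_induct) (auto intro: is_idealD)

text \<open>With \<open>genideal_ring_on\<close> and \<open>primeideal_ring_on_iff\<close> this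
  moves all statements to plain sets inside a type, so that later arguments compute with the
  operations of the type.\<close>

lemma ideal_ring_on_iff:
  assumes A: "is_subring A"
  shows "ideal I (ring_on A) \<longleftrightarrow> is_ideal A I"
proof
  interpret cring "ring_on A" by (rule cring_ring_on'[OF A])
  assume "ideal I (ring_on A)"
  then interpret ideal I "ring_on A" .
  show "is_ideal A I"
    using a_subset zero_closed a_closed I_l_closed unfolding is_ideal_def
    by (auto simp: subset_eq)
next
  interpret cring "ring_on A" by (rule cring_ring_on'[OF A])
  assume I: "is_ideal A I"
  have inv: "a_inv (ring_on A) x = - x" if "x \<in> A" for x
    using minus_equality[of "-x" x] that A by (auto intro: is_subringD)
  show "ideal I (ring_on A)"
  proof (rule idealI)
    show "ring (ring_on A)" by (rule ring_axioms)
    show "subgroup I (add_monoid (ring_on A))"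
      using is_idealD[OF I]
      by (intro add.subgroupI) (auto simp: inv subset_eq intro: is_ideal_uminus[OF A I])
  qed (use I in \<open>auto intro: is_idealD\<close>)
qed

lemma genideal_ring_on:
  assumes "is_subring A"
  shows "genideal (ring_on A) G = span_ideal A G"
  unfolding genideal_def span_ideal_def ideal_ring_on_iff[OF assms] ..

lemma primeideal_ring_on_iff:
  assumes A: "is_subring A"
  shows "primeideal p (ring_on A) \<longleftrightarrow> is_prime A p"
proof
  assume "primeideal p (ring_on A)"
  then interpret primeideal p "ring_on A" .
  have p: "is_ideal A p" using ideal_ring_on_iff[OF A] is_ideal by blast
  have "1 \<notin> p"
  proof
    assume "1 \<in> p"
    then have "a \<in> p" if "a \<in> A" for a using is_idealD(4)[OF p that] by force
    then show False using I_notcarr p by (auto simp: is_ideal_def)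
  qed
  then show "is_prime A p" using p I_prime by (auto simp: is_prime_def)
next
  assume p: "is_prime A p"
  show "primeideal p (ring_on A)"
  proof (rule primeidealI)
    show "ideal p (ring_on A)" using p ideal_ring_on_iff[OF A] by (auto simp: is_prime_def)
    show "cring (ring_on A)" by (rule cring_ring_on'[OF A])
    show "carrier (ring_on A) \<noteq> p" using p is_subringD(1)[OF A] by (auto simp: is_prime_def)
  qed (use p in \<open>auto simp: is_prime_def\<close>)
qed

lemma is_primeD:
  assumes "is_prime A p"
  shows "is_ideal A p" "1 \<notin> p" "x \<in> A \<Longrightarrow> y \<in> A \<Longrightarrow> x * y \<in> p \<Longrightarrow> x \<in> p \<or> y \<in> p"
  using assms by (auto simp: is_prime_def)

lemma is_prime_prod:
  assumes "is_prime A p" "is_subring A" "\<And>i. i \<in> Z \<Longrightarrow> f i \<in> A" "prod f Z \<in> p"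
  shows "\<exists>i\<in>Z. f i \<in> p"
  using assms(3,4)
proof (induction Z rule: infinite_finite_induct)
  case (insert x F)
  then have "f x * prod f F \<in> p" by simp
  then show ?case
    using is_primeD(3)[OF assms(1), of "f x" "prod f F"] insert is_subring_prod[OF assms(2), of F f]
    by auto
qed (use is_primeD(2)[OF assms(1)] in auto)

lemma is_ideal_Inter: "\<Z> \<noteq> {} \<Longrightarrow> (\<And>I. I \<in> \<Z> \<Longrightarrow> is_ideal A I) \<Longrightarrow> is_ideal A (\<Inter>\<Z>)"
  unfolding is_ideal_def by blast

lemma is_ideal_self: "is_subring A \<Longrightarrow> is_ideal A A"
  by (auto simp: is_ideal_def intro: is_subringD)

lemma is_ideal_zero: "is_subring A \<Longrightarrow> is_ideal A {0}"
  by (auto simp: is_ideal_def intro: is_subringD)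

lemma span_ideal_is_ideal: "is_subring A \<Longrightarrow> G \<subseteq> A \<Longrightarrow> is_ideal A (span_ideal A G)"
  unfolding span_ideal_def by (rule is_ideal_Inter) (use is_ideal_self in auto)

lemma span_ideal_superset: "G \<subseteq> span_ideal A G"
  by (auto simp: span_ideal_def)

lemma span_ideal_least: "is_ideal A I \<Longrightarrow> G \<subseteq> I \<Longrightarrow> span_ideal A G \<subseteq> I"
  by (auto simp: span_ideal_def)

lemma span_ideal_mono: "G \<subseteq> H \<Longrightarrow> span_ideal A G \<subseteq> span_ideal A H"
  by (auto simp: span_ideal_def)

lemma span_ideal_subset: "is_subring A \<Longrightarrow> G \<subseteq> A \<Longrightarrow> span_ideal A G \<subseteq> A"
  using is_ideal_self span_ideal_least by blast

lemma span_ideal_empty: "is_subring A \<Longrightarrow> span_ideal A {} = {0}"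
  using span_ideal_least[OF is_ideal_zero, of A "{}"] is_idealD(2)[OF span_ideal_is_ideal, of A "{}"]
  by auto

text \<open>Indexing by a family covers both uses: the entries of a list, which may repeat, and a
  finite set indexed by itself.\<close>

lemma span_ideal_finite:
  assumes A: "is_subring A" and "finite Z" and f: "\<And>i. i \<in> Z \<Longrightarrow> f i \<in> A"
  shows "span_ideal A (f ` Z) = {\<Sum>i\<in>Z. a i * f i | a. \<forall>i\<in>Z. a i \<in> A}"
    (is "?L = ?R")
proof
  have "is_ideal A ?R"
    unfolding is_ideal_def
  proof (intro conjI ballI)
    show "?R \<subseteq> A" using f by (auto intro!: is_subring_sum[OF A] is_subringD(4)[OF A])
    show "0 \<in> ?R" using is_subringD(2)[OF A] by (auto intro!: exI[of _ "\<lambda>_. 0"])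
    fix x assume "x \<in> ?R"
    then obtain a where a: "x = (\<Sum>i\<in>Z. a i * f i)" "\<forall>i\<in>Z. a i \<in> A" by blast
    {
      fix y assume "y \<in> ?R"
      then obtain b where b: "y = (\<Sum>i\<in>Z. b i * f i)" "\<forall>i\<in>Z. b i \<in> A" by blast
      show "x + y \<in> ?R" using a b is_subringD(6)[OF A]
        by (auto simp: sum.distrib algebra_simps intro!: exI[of _ "\<lambda>i. a i + b i"])
    next
      fix r assume "r \<in> A"
      then show "r * x \<in> ?R" using a is_subringD(4)[OF A]
        by (auto simp: sum_distrib_left algebra_simps intro!: exI[of _ "\<lambda>i. r * a i"])
    }
  qed
  moreover have "f i \<in> ?R" if "i \<in> Z" for i
    using that \<open>finite Z\<close> is_subringD(1,2)[OF A]
    by (intro CollectI exI[of _ "\<lambda>j. if j = i then 1 else 0"])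
       (auto simp: if_distrib[of "\<lambda>z. z * _"] cong: if_cong)
  ultimately show "?L \<subseteq> ?R" by (intro span_ideal_least) auto
  have "is_ideal A ?L" using f by (intro span_ideal_is_ideal A) auto
  moreover have "f i \<in> ?L" if "i \<in> Z" for i using that span_ideal_superset[of "f ` Z" A] by auto
  ultimately show "?R \<subseteq> ?L" by (auto intro!: is_ideal_sum is_idealD(4))
qed

lemma span_ideal_insert:
  assumes A: "is_subring A" and "h \<in> A" "G \<subseteq> A"
  shows "span_ideal A (insert h G) = {r * h + g | r g. r \<in> A \<and> g \<in> span_ideal A G}"
    (is "?L = ?R")
proof
  have I: "is_ideal A (span_ideal A G)" by (rule span_ideal_is_ideal) fact+
  have "is_ideal A ?R"
    unfolding is_ideal_def
  proof (intro conjI ballI)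
    show "?R \<subseteq> A" using assms(2) is_idealD(1)[OF I] is_subringD[OF A] by auto
    show "0 \<in> ?R" using is_subringD(2)[OF A] is_idealD(2)[OF I] by force
    fix x assume "x \<in> ?R"
    then obtain r g where a: "x = r * h + g" "r \<in> A" "g \<in> span_ideal A G" by blast
    {
      fix y assume "y \<in> ?R"
      then obtain r' g' where b: "y = r' * h + g'" "r' \<in> A" "g' \<in> span_ideal A G" by blast
      have "x + y = (r + r') * h + (g + g')" using a b by (simp add: algebra_simps)
      then show "x + y \<in> ?R" using a b is_subringD(6)[OF A] is_idealD(3)[OF I] by blast
    next
      fix s assume s: "s \<in> A"
      have "s * x = (s * r) * h + s * g" using a by (simp add: algebra_simps)
      then show "s * x \<in> ?R" using s a is_subringD(4)[OF A] is_idealD(4)[OF I] by blast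
    }
  qed
  moreover have "h \<in> ?R" using is_subringD(1)[OF A] is_idealD(2)[OF I] by force
  moreover have "G \<subseteq> ?R" using is_subringD(2)[OF A] span_ideal_superset[of G A] by force
  ultimately show "?L \<subseteq> ?R" by (intro span_ideal_least) auto
  have J: "is_ideal A ?L" using assms by (intro span_ideal_is_ideal) auto
  then show "?R \<subseteq> ?L"
    using span_ideal_superset[of "insert h G" A] span_ideal_mono[of G "insert h G" A]
    by (auto intro!: is_idealD(3)[OF J] is_idealD(4)[OF J])
qed

lemma span_ideal_insertI:
  assumes "is_subring A" "h \<in> A" "G \<subseteq> A"
    and "x \<in> span_ideal A (insert h G)"
  obtains r where "r \<in> A" "x - r * h \<in> span_ideal A G"
  using assms span_ideal_insert[OF assms(1-3)] by auto

lemma span_ideal_eqI: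
  assumes "is_subring A" "G \<subseteq> A" "H \<subseteq> A" "G \<subseteq> span_ideal A H" "H \<subseteq> span_ideal A G"
  shows "span_ideal A G = span_ideal A H"
  using assms span_ideal_is_ideal span_ideal_least by (metis subset_antisym)

section \<open>Evaluation homomorphisms of polynomial rings\<close>

abbreviation "keys \<equiv> Poly_Mapping.keys"
abbreviation "lookup \<equiv> Poly_Mapping.lookup"
abbreviation "single \<equiv> Poly_Mapping.single"

definition mvar :: "nat \<Rightarrow> 'a::comm_ring_1 mpoly" where
  "mvar i = single (single i 1) 1"

definition mconst :: "'a::comm_ring_1 \<Rightarrow> 'a mpoly" where
  "mconst c = single 0 c"

definition monom_eval :: "(nat \<Rightarrow> 'b::comm_ring_1) \<Rightarrow> (nat \<Rightarrow>\<^sub>0 nat) \<Rightarrow> 'b" where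
  "monom_eval \<sigma> m = (\<Prod>i\<in>keys m. \<sigma> i ^ lookup m i)"

text \<open>One evaluation serves for substitutions, for the Rees map, and for inserting the values
  of a functional; only the map on coefficients changes.\<close>

definition ev :: "('a::comm_ring_1 \<Rightarrow> 'b) \<Rightarrow> (nat \<Rightarrow> 'b) \<Rightarrow> 'a mpoly \<Rightarrow> 'b::comm_ring_1" where
  "ev \<kappa> \<sigma> f = (\<Sum>m\<in>keys f. \<kappa> (lookup f m) * monom_eval \<sigma> m)"

text \<open>Nothing is said about arguments outside \<open>S\<close>, because the homomorphisms on a
  localization are specified only on that subring of the fraction field.\<close>

definition ring_hom_on :: "'a::comm_ring_1 set \<Rightarrow> ('a \<Rightarrow> 'b::comm_ring_1) \<Rightarrow> bool" where
  "ring_hom_on S \<kappa> \<longleftrightarrow> is_subring S \<and> \<kappa> 1 = 1 \<and>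
     (\<forall>x\<in>S. \<forall>y\<in>S. \<kappa> (x + y) = \<kappa> x + \<kappa> y \<and> \<kappa> (x * y) = \<kappa> x * \<kappa> y)"

lemma ring_hom_onD:
  assumes "ring_hom_on S \<kappa>"
  shows "is_subring S" "\<kappa> 0 = 0" "\<kappa> 1 = 1" "x \<in> S \<Longrightarrow> y \<in> S \<Longrightarrow> \<kappa> (x + y) = \<kappa> x + \<kappa> y"
    "x \<in> S \<Longrightarrow> y \<in> S \<Longrightarrow> \<kappa> (x * y) = \<kappa> x * \<kappa> y" "x \<in> S \<Longrightarrow> \<kappa> (- x) = - \<kappa> x"
    "x \<in> S \<Longrightarrow> y \<in> S \<Longrightarrow> \<kappa> (x - y) = \<kappa> x - \<kappa> y"
proof -
  show S: "is_subring S" and "\<kappa> 1 = 1" and a: "x \<in> S \<Longrightarrow> y \<in> S \<Longrightarrow> \<kappa> (x + y) = \<kappa> x + \<kappa> y"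
    and "x \<in> S \<Longrightarrow> y \<in> S \<Longrightarrow> \<kappa> (x * y) = \<kappa> x * \<kappa> y" for x y
    using assms by (auto simp: ring_hom_on_def)
  show z: "\<kappa> 0 = 0" using a[of 0 0] is_subringD(2)[OF S] by simp
  show m: "\<kappa> (- x) = - \<kappa> x" if "x \<in> S" for x
    using a[OF that is_subringD(5)[OF S that]] z by (simp add: eq_neg_iff_add_eq_0 add.commute)
  show "\<kappa> (x - y) = \<kappa> x - \<kappa> y" if "x \<in> S" "y \<in> S" for x y
    using a[OF that(1) is_subringD(5)[OF S that(2)]] m[OF that(2)] by simp
qed

lemma ring_hom_on_sum:
  "ring_hom_on S \<kappa> \<Longrightarrow> (\<And>i. i \<in> I \<Longrightarrow> f i \<in> S) \<Longrightarrow> \<kappa> (sum f I) = (\<Sum>i\<in>I. \<kappa> (f i))"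
  by (induction I rule: infinite_finite_induct)
     (auto simp: ring_hom_onD is_subring_sum[OF ring_hom_onD(1)])

lemma ring_hom_on_prod:
  "ring_hom_on S \<kappa> \<Longrightarrow> (\<And>i. i \<in> I \<Longrightarrow> f i \<in> S) \<Longrightarrow> \<kappa> (prod f I) = (\<Prod>i\<in>I. \<kappa> (f i))"
  by (induction I rule: infinite_finite_induct)
     (auto simp: ring_hom_onD is_subring_prod[OF ring_hom_onD(1)])

lemma ring_hom_on_power: "ring_hom_on S \<kappa> \<Longrightarrow> x \<in> S \<Longrightarrow> \<kappa> (x ^ k) = \<kappa> x ^ k"
  by (induction k) (auto simp: ring_hom_onD is_subring_power[OF ring_hom_onD(1)])

lemma ring_hom_on_subset: "ring_hom_on S \<kappa> \<Longrightarrow> is_subring T \<Longrightarrow> T \<subseteq> S \<Longrightarrow> ring_hom_on T \<kappa>"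
  by (auto simp: ring_hom_on_def)

lemma ring_hom_mconst: "ring_hom_on UNIV mconst"
  by (auto simp: ring_hom_on_def mconst_def single_add mult_single)

lemma monom_eval_superset:
  "finite Z \<Longrightarrow> keys m \<subseteq> Z \<Longrightarrow> monom_eval \<sigma> m = (\<Prod>i\<in>Z. \<sigma> i ^ lookup m i)"
  unfolding monom_eval_def by (rule prod.mono_neutral_left) (auto simp: in_keys_iff)

lemma keys_add_nat: "keys (m + m' :: 'x \<Rightarrow>\<^sub>0 nat) = keys m \<union> keys m'"
  by (auto simp: in_keys_iff lookup_add)

lemma monom_eval_add: "monom_eval \<sigma> (m + m') = monom_eval \<sigma> m * monom_eval \<sigma> m'"
  using monom_eval_superset[of "keys m \<union> keys m'" _ \<sigma>]
  by (simp add: keys_add_nat lookup_add power_add prod.distrib)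

lemma monom_eval_0 [simp]: "monom_eval \<sigma> 0 = 1"
  by (simp add: monom_eval_def)

lemma monom_eval_single [simp]: "monom_eval \<sigma> (single i k) = \<sigma> i ^ k"
  by (auto simp: monom_eval_def)

lemma monom_eval_cong: "(\<And>i. i \<in> keys m \<Longrightarrow> \<sigma> i = \<tau> i) \<Longrightarrow> monom_eval \<sigma> m = monom_eval \<tau> m"
  by (simp add: monom_eval_def)

lemma mpoly_expand: "f = (\<Sum>m\<in>keys f. single m (lookup f m))"
  by (rule poly_mapping_eqI)
     (auto simp: lookup_sum lookup_single when_def sum.delta in_keys_iff)

lemma mpoly_mult_expand:
  "f * g = (\<Sum>a\<in>keys f. \<Sum>b\<in>keys g. single (a + b) (lookup f a * lookup g b))"
proof -
  have "f * g = (\<Sum>a\<in>keys f. single a (lookup f a)) * (\<Sum>b\<in>keys g. single b (lookup g b))"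
    by (simp flip: mpoly_expand)
  then show ?thesis by (simp only: sum_product mult_single)
qed

text \<open>Evaluation respects sums and products whatever the number of variables; only the
  coefficients must lie where the coefficient map is a homomorphism.\<close>

definition coeffs_in :: "'a::comm_ring_1 set \<Rightarrow> 'a mpoly set" where
  "coeffs_in S = {f. \<forall>m. lookup f m \<in> S}"

lemma coeffs_in_UNIV [simp]: "f \<in> coeffs_in UNIV"
  by (simp add: coeffs_in_def)

lemma mpolys_subset_coeffs_in: "is_subring S \<Longrightarrow> mpolys S n \<subseteq> coeffs_in S"
  unfolding mpolys_def coeffs_in_def using is_subringD(2)[of S] by (force simp: in_keys_iff)

lemma single_in_coeffs_in: "is_subring S \<Longrightarrow> c \<in> S \<Longrightarrow> single m c \<in> coeffs_in S"
  using is_subringD(2)[of S] by (auto simp: coeffs_in_def lookup_single when_def)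

lemma coeffs_in_sum:
  "is_subring S \<Longrightarrow> (\<And>i. i \<in> I \<Longrightarrow> f i \<in> coeffs_in S) \<Longrightarrow> sum f I \<in> coeffs_in S"
  by (auto simp: coeffs_in_def lookup_sum intro: is_subring_sum)

lemma coeffs_in_mult:
  assumes "is_subring S" "f \<in> coeffs_in S" "g \<in> coeffs_in S"
  shows "f * g \<in> coeffs_in S"
proof -
  have "lookup f a * lookup g b \<in> S" for a b
    using assms by (auto simp: coeffs_in_def intro: is_subringD)
  then show ?thesis unfolding mpoly_mult_expand by (intro coeffs_in_sum single_in_coeffs_in assms(1))
qed

lemma mpolysI:
  "(\<And>m. m \<in> keys f \<Longrightarrow> keys m \<subseteq> {..<n}) \<Longrightarrow> f \<in> coeffs_in S \<Longrightarrow> f \<in> mpolys S n"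
  by (auto simp: mpolys_def coeffs_in_def)

lemma mpolysD: "f \<in> mpolys S n \<Longrightarrow> m \<in> keys f \<Longrightarrow> keys m \<subseteq> {..<n}"
  by (auto simp: mpolys_def)

lemma is_subring_mpolys:
  assumes S: "is_subring S"
  shows "is_subring (mpolys S n)"
  unfolding is_subring_def
proof (intro conjI ballI)
  show "1 \<in> mpolys S n" using is_subringD(1)[OF S] by (auto simp: mpolys_def lookup_one)
  fix f g assume fg: "f \<in> mpolys S n" "g \<in> mpolys S n"
  note c = fg[THEN subsetD[OF mpolys_subset_coeffs_in[OF S]]]
  show "f - g \<in> mpolys S n"
  proof (rule mpolysI)
    show "f - g \<in> coeffs_in S" using c is_subringD(3)[OF S]
      by (auto simp: coeffs_in_def lookup_minus)
    show "keys m \<subseteq> {..<n}" if "m \<in> keys (f - g)" for m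
    proof -
      have "m \<in> keys f \<or> m \<in> keys g" using that by (auto simp: in_keys_iff lookup_minus)
      then show ?thesis using fg mpolysD by blast
    qed
  qed
  show "f * g \<in> mpolys S n"
  proof (rule mpolysI)
    show "f * g \<in> coeffs_in S" using c by (intro coeffs_in_mult S)
    show "keys m \<subseteq> {..<n}" if "m \<in> keys (f * g)" for m
      using that keys_mult[of f g] fg mpolysD by (fastforce simp: keys_add_nat)
  qed
qed

lemma single_in_mpolys: "is_subring S \<Longrightarrow> c \<in> S \<Longrightarrow> keys m \<subseteq> {..<n} \<Longrightarrow> single m c \<in> mpolys S n"
  by (rule mpolysI) (auto simp: single_in_coeffs_in split: if_splits)

lemma mconst_in_mpolys: "is_subring S \<Longrightarrow> c \<in> S \<Longrightarrow> mconst c \<in> mpolys S n"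
  by (simp add: mconst_def single_in_mpolys)

lemma mvar_in_mpolys: "is_subring S \<Longrightarrow> i < n \<Longrightarrow> mvar i \<in> mpolys S n"
  by (simp add: mvar_def single_in_mpolys is_subringD)

lemma ev_superset:
  "finite M \<Longrightarrow> keys f \<subseteq> M \<Longrightarrow> \<kappa> 0 = 0 \<Longrightarrow> ev \<kappa> \<sigma> f = (\<Sum>m\<in>M. \<kappa> (lookup f m) * monom_eval \<sigma> m)"
  unfolding ev_def by (rule sum.mono_neutral_left) (auto simp: in_keys_iff)

lemma ev_0 [simp]: "ev \<kappa> \<sigma> 0 = 0"
  by (simp add: ev_def)

context
  fixes S :: "'a::comm_ring_1 set" and \<kappa> :: "'a \<Rightarrow> 'b::comm_ring_1"
  assumes \<kappa>: "ring_hom_on S \<kappa>"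
begin

lemma ev_single: "ev \<kappa> \<sigma> (single m c) = \<kappa> c * monom_eval \<sigma> m"
  using ring_hom_onD(2)[OF \<kappa>] by (auto simp: ev_def)

lemma ev_mconst: "ev \<kappa> \<sigma> (mconst c) = \<kappa> c"
  by (simp add: mconst_def ev_single)

lemma ev_mvar: "ev \<kappa> \<sigma> (mvar i) = \<sigma> i"
  by (simp add: mvar_def ev_single ring_hom_onD(3)[OF \<kappa>])

lemma ev_add:
  assumes "f \<in> coeffs_in S" "g \<in> coeffs_in S"
  shows "ev \<kappa> \<sigma> (f + g) = ev \<kappa> \<sigma> f + ev \<kappa> \<sigma> g"
  using ev_superset[of "keys f \<union> keys g" _ \<kappa> \<sigma>] assms keys_add[of f g] ring_hom_onD[OF \<kappa>]
  by (simp add: lookup_add sum.distrib[symmetric] distrib_right coeffs_in_def)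

lemma ev_sum:
  "(\<And>i. i \<in> I \<Longrightarrow> f i \<in> coeffs_in S) \<Longrightarrow> ev \<kappa> \<sigma> (sum f I) = (\<Sum>i\<in>I. ev \<kappa> \<sigma> (f i))"
  by (induction I rule: infinite_finite_induct)
     (auto simp: ev_add coeffs_in_sum ring_hom_onD[OF \<kappa>])

lemma ev_mult:
  assumes "f \<in> coeffs_in S" "g \<in> coeffs_in S"
  shows "ev \<kappa> \<sigma> (f * g) = ev \<kappa> \<sigma> f * ev \<kappa> \<sigma> g"
proof -
  have S: "is_subring S" by (rule ring_hom_onD(1)[OF \<kappa>])
  have c: "lookup f a \<in> S" "lookup g a \<in> S" for a using assms by (auto simp: coeffs_in_def)
  have "ev \<kappa> \<sigma> (f * g) = (\<Sum>a\<in>keys f. \<Sum>b\<in>keys g. \<kappa> (lookup f a * lookup g b) * monom_eval \<sigma> (a + b))"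
    unfolding mpoly_mult_expand
    by (simp add: ev_sum coeffs_in_sum single_in_coeffs_in S c is_subringD ev_single)
  also have "\<dots> = (\<Sum>a\<in>keys f. \<Sum>b\<in>keys g. (\<kappa> (lookup f a) * monom_eval \<sigma> a) * (\<kappa> (lookup g b) * monom_eval \<sigma> b))"
    by (simp add: ring_hom_onD(5)[OF \<kappa>] c monom_eval_add ac_simps)
  finally show ?thesis by (simp add: ev_def sum_product)
qed

lemma ring_hom_on_ev: "ring_hom_on (mpolys S n) (ev \<kappa> \<sigma>)"
proof -
  have S: "is_subring S" by (rule ring_hom_onD(1)[OF \<kappa>])
  have "ev \<kappa> \<sigma> 1 = 1" using ev_mconst[of \<sigma> 1] ring_hom_onD(3)[OF \<kappa>] by (simp add: mconst_def)
  then show ?thesis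
    using mpolys_subset_coeffs_in[OF S, of n]
    by (auto simp: ring_hom_on_def is_subring_mpolys[OF S] ev_add ev_mult subset_eq)
qed

end

lemma ring_hom_ev: "ring_hom_on UNIV \<kappa> \<Longrightarrow> ring_hom_on UNIV (ev \<kappa> \<sigma>)"
  using ring_hom_onD(3)[OF ring_hom_on_ev[of UNIV \<kappa> 0 \<sigma>]]
  by (auto simp: ring_hom_on_def[of UNIV "ev _ _"] ev_add[of UNIV] ev_mult[of UNIV])

lemma ev_cong:
  assumes "f \<in> mpolys S n" "\<And>i. i < n \<Longrightarrow> \<sigma> i = \<tau> i"
  shows "ev \<kappa> \<sigma> f = ev \<kappa> \<tau> f"
proof -
  have "monom_eval \<sigma> m = monom_eval \<tau> m" if "m \<in> keys f" for m
    using assms mpolysD[OF assms(1) that] by (intro monom_eval_cong) auto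
  then show ?thesis by (simp add: ev_def)
qed

lemma monom_eval_in:
  "is_subring A \<Longrightarrow> (\<And>i. i \<in> keys m \<Longrightarrow> \<sigma> i \<in> A) \<Longrightarrow> monom_eval \<sigma> m \<in> A"
  by (auto simp: monom_eval_def intro!: is_subring_prod is_subring_power)

lemma ev_in:
  assumes "is_subring A" "f \<in> mpolys S n" "\<And>i. i < n \<Longrightarrow> \<sigma> i \<in> A" "\<And>c. c \<in> S \<Longrightarrow> \<kappa> c \<in> A"
  shows "ev \<kappa> \<sigma> f \<in> A"
  unfolding ev_def
  by (intro is_subring_sum is_subringD(4) monom_eval_in assms) (use assms(2) in \<open>auto simp: mpolys_def\<close>)

lemma ring_hom_comp_ev:
  assumes h: "ring_hom_on UNIV h"
  shows "h (ev \<kappa> \<sigma> f) = ev (\<lambda>c. h (\<kappa> c)) (\<lambda>i. h (\<sigma> i)) f"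
  unfolding ev_def monom_eval_def
  by (simp add: ring_hom_on_sum[OF h] ring_hom_on_prod[OF h] ring_hom_on_power[OF h] ring_hom_onD[OF h])

lemma monom_eval_mvar: "monom_eval mvar m = (single m 1 :: 'a::comm_ring_1 mpoly)"
proof -
  have p: "mvar i ^ k = (single (single i k) 1 :: 'a mpoly)" for i k
    by (induction k) (auto simp: mvar_def mult_single single_add[symmetric])
  have q: "(\<Prod>i\<in>Z. single (g i) (1::'a)) = single (\<Sum>i\<in>Z. g i) 1" for Z :: "nat set" and g :: "nat \<Rightarrow> nat \<Rightarrow>\<^sub>0 nat"
    by (induction Z rule: infinite_finite_induct) (auto simp: mult_single)
  show ?thesis
    unfolding monom_eval_def p q
    by (rule arg_cong[of _ _ "\<lambda>z. single z 1"], rule poly_mapping_eqI)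
       (auto simp: lookup_sum lookup_single when_def sum.delta in_keys_iff)
qed

definition msubst :: "(nat \<Rightarrow> 'a mpoly) \<Rightarrow> 'a::comm_ring_1 mpoly \<Rightarrow> 'a mpoly" where
  "msubst = ev mconst"

lemma ring_hom_msubst: "ring_hom_on UNIV (msubst \<sigma>)"
  unfolding msubst_def by (rule ring_hom_ev[OF ring_hom_mconst])

lemma msubst_mvar [simp]: "msubst \<sigma> (mvar i) = \<sigma> i"
  unfolding msubst_def by (rule ev_mvar[OF ring_hom_mconst])

lemma msubst_mconst [simp]: "msubst \<sigma> (mconst c) = mconst c"
  unfolding msubst_def by (rule ev_mconst[OF ring_hom_mconst])

lemma msubst_id: "msubst mvar f = f"
  unfolding msubst_def ev_def monom_eval_mvar
  by (subst (3) mpoly_expand) (simp add: mconst_def mult_single)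

lemma ev_msubst:
  assumes "ring_hom_on UNIV \<kappa>"
  shows "ev \<kappa> \<tau> (msubst \<sigma> f) = ev \<kappa> (\<lambda>i. ev \<kappa> \<tau> (\<sigma> i)) f"
  unfolding msubst_def ring_hom_comp_ev[OF ring_hom_ev[OF assms]] ev_mconst[OF assms] by simp

lemma msubst_msubst: "msubst \<tau> (msubst \<sigma> f) = msubst (\<lambda>i. msubst \<tau> (\<sigma> i)) f"
  using ev_msubst[OF ring_hom_mconst] by (simp add: msubst_def)

lemma msubst_in_mpolys:
  "f \<in> mpolys UNIV n \<Longrightarrow> (\<And>i. i < n \<Longrightarrow> \<sigma> i \<in> mpolys UNIV n) \<Longrightarrow> msubst \<sigma> f \<in> mpolys UNIV n"
  unfolding msubst_def by (rule ev_in[OF is_subring_mpolys[OF is_subring_UNIV]]) (auto intro: mconst_in_mpolys)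

lemma msubst_cong:
  "f \<in> mpolys UNIV n \<Longrightarrow> (\<And>i. i < n \<Longrightarrow> \<sigma> i = \<tau> i) \<Longrightarrow> msubst \<sigma> f = msubst \<tau> f"
  unfolding msubst_def by (rule ev_cong)

section \<open>Linear forms\<close>

abbreviation polys :: "nat \<Rightarrow> 'a::comm_ring_1 mpoly set" where
  "polys n \<equiv> mpolys UNIV n"

lemma is_subring_polys [simp]: "is_subring (polys n)"
  by (rule is_subring_mpolys[OF is_subring_UNIV])

lemma mvar_in_polys: "i < n \<Longrightarrow> mvar i \<in> polys n"
  by (rule mvar_in_mpolys) auto

lemma mconst_in_polys [simp]: "mconst c \<in> polys n"
  by (rule mconst_in_mpolys) auto

definition linear_form :: "nat \<Rightarrow> 'a::comm_ring_1 mpoly \<Rightarrow> bool" where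
  "linear_form n f \<longleftrightarrow> f \<in> polys n \<and> homogeneous 1 f"

lemma linear_formD: "linear_form n f \<Longrightarrow> f \<in> polys n"
  by (simp add: linear_form_def)

lemma mconst_mvar: "mconst c * mvar i = single (single i 1) c"
  by (simp add: mconst_def mvar_def mult_single)

lemma sum_eq_1_nat:
  assumes "finite Z" "(\<Sum>i\<in>Z. f i) = (1::nat)"
  shows "\<exists>i\<in>Z. f i = 1 \<and> (\<forall>j\<in>Z - {i}. f j = 0)"
  using assms by (induction Z rule: finite_induct) (auto simp: add_is_1)

lemma keys_linear_form:
  assumes "linear_form n f" "m \<in> keys f"
  shows "\<exists>i<n. m = single i 1"
proof -
  have "(\<Sum>i\<in>keys m. lookup m i) = 1"
    using assms by (auto simp: linear_form_def homogeneous_def)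
  from sum_eq_1_nat[OF _ this] obtain i where i: "i \<in> keys m" "lookup m i = 1"
    "\<forall>j\<in>keys m - {i}. lookup m j = 0" by auto
  have "m = single i 1"
  proof (rule poly_mapping_eqI)
    fix k show "lookup m k = lookup (single i 1) k"
    proof (cases "k = i")
      case False
      then have "lookup m k = 0" using i(3) by (cases "k \<in> keys m") (auto simp: not_in_keys_iff_lookup_eq_zero)
      with False show ?thesis by (simp add: lookup_single_not_eq)
    qed (simp add: i(2))
  qed
  moreover have "i < n" using i(1) assms by (auto simp: linear_form_def mpolys_def)
  ultimately show ?thesis by blast
qed

lemma linear_form_expand:
  assumes "linear_form n f"
  shows "f = (\<Sum>i<n. mconst (lookup f (single i 1)) * mvar i)"
proof (rule poly_mapping_eqI)
  fix m
  have e: "lookup (\<Sum>i<n. mconst (lookup f (single i 1)) * mvar i) m =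
      (\<Sum>i<n. (if m = single i 1 then lookup f m else 0))"
    by (auto simp: mconst_mvar lookup_sum lookup_single when_def intro!: sum.cong)
  show "lookup f m = lookup (\<Sum>i<n. mconst (lookup f (single i 1)) * mvar i) m"
  proof (cases "m \<in> keys f")
    case True
    with keys_linear_form[OF assms] obtain i where i: "i < n" "m = single i 1" by blast
    have "(single i 1 = single j (1::nat)) = (i = j)" for j
      by (metis lookup_single_eq lookup_single_not_eq zero_neq_one)
    then show ?thesis unfolding e using i by (simp add: sum.delta)
  next
    case False
    then have "lookup f m = 0" by (simp add: in_keys_iff)
    then show ?thesis unfolding e by (subst sum.neutral) auto
  qed
qed

lemma linear_form_0 [simp]: "linear_form n 0"
  by (auto simp: linear_form_def homogeneous_def mpolys_def)

lemma linear_form_add: "linear_form n f \<Longrightarrow> linear_form n g \<Longrightarrow> linear_form n (f + g)"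
  using keys_add[of f g] is_subringD(6)[OF is_subring_polys, of f n g]
  by (auto simp: linear_form_def homogeneous_def subset_eq)

lemma linear_form_sum: "(\<And>i. i \<in> I \<Longrightarrow> linear_form n (f i)) \<Longrightarrow> linear_form n (sum f I)"
  by (induction I rule: infinite_finite_induct) (auto intro: linear_form_add)

lemma linear_form_mvar: "i < n \<Longrightarrow> linear_form n (mvar i)"
  by (auto simp: linear_form_def mvar_in_polys) (auto simp: mvar_def homogeneous_def)

lemma linear_form_scale:
  assumes "linear_form n f"
  shows "linear_form n (mconst c * f)"
proof -
  have "keys (mconst c * f) \<subseteq> keys f"
    using keys_mult[of "mconst c" f] by (auto simp: mconst_def split: if_splits)
  moreover have "mconst c * f \<in> polys n"
    using assms by (auto simp: linear_form_def intro!: is_subringD(4)[OF is_subring_polys])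
  ultimately show ?thesis using assms by (auto simp: linear_form_def homogeneous_def)
qed

lemma linear_form_uminus:
  assumes "linear_form n f" shows "linear_form n (- f)"
  using linear_form_scale[OF assms, of "-1"] by (simp add: mconst_def single_uminus)

lemma linear_form_diff: "linear_form n f \<Longrightarrow> linear_form n g \<Longrightarrow> linear_form n (f - g)"
  using linear_form_add[of n f "-g"] linear_form_uminus[of n g] by simp

lemma ev_linear_form:
  assumes "ring_hom_on UNIV \<kappa>" "linear_form n f"
  shows "ev \<kappa> \<sigma> f = (\<Sum>i<n. \<kappa> (lookup f (single i 1)) * \<sigma> i)"
proof -
  have "ev \<kappa> \<sigma> f = ev \<kappa> \<sigma> (\<Sum>i<n. mconst (lookup f (single i 1)) * mvar i)"
    using linear_form_expand[OF assms(2)] by simp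
  then show ?thesis
    by (simp add: ev_sum[OF assms(1)] ev_mult[OF assms(1)] ev_mconst[OF assms(1)] ev_mvar[OF assms(1)])
qed

lemma msubst_linear_form:
  "linear_form n f \<Longrightarrow> msubst \<sigma> f = (\<Sum>i<n. mconst (lookup f (single i 1)) * \<sigma> i)"
  unfolding msubst_def by (rule ev_linear_form[OF ring_hom_mconst])

lemma linear_form_msubst:
  "linear_form n f \<Longrightarrow> (\<And>i. i < n \<Longrightarrow> linear_form n (\<sigma> i)) \<Longrightarrow> linear_form n (msubst \<sigma> f)"
  by (auto simp: msubst_linear_form intro!: linear_form_sum linear_form_scale)

lemma ring_hom_span_ideal:
  assumes h: "ring_hom_on A h" and hA: "h ` A \<subseteq> B" and B: "is_subring B" and H: "H \<subseteq> A"
    and x: "x \<in> span_ideal A H"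
  shows "h x \<in> span_ideal B (h ` H)"
proof -
  note A = ring_hom_onD(1)[OF h]
  have I: "is_ideal B (span_ideal B (h ` H))" using H hA by (intro span_ideal_is_ideal B) auto
  have "is_ideal A {x \<in> A. h x \<in> span_ideal B (h ` H)}"
    using is_idealD[OF I] hA is_subringD[OF A] ring_hom_onD[OF h]
    by (auto simp: is_ideal_def subset_eq)
  then have "span_ideal A H \<subseteq> {x \<in> A. h x \<in> span_ideal B (h ` H)}"
    using H span_ideal_superset[of "h ` H" B] by (intro span_ideal_least) auto
  then show ?thesis using x by auto
qed

section \<open>Linear changes of coordinates\<close>

definition linear_auto :: "nat \<Rightarrow> (nat \<Rightarrow> 'a::comm_ring_1 mpoly) \<Rightarrow> (nat \<Rightarrow> 'a mpoly) \<Rightarrow> bool" where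
  "linear_auto n \<sigma> \<tau> \<longleftrightarrow> (\<forall>i<n. linear_form n (\<sigma> i) \<and> linear_form n (\<tau> i)) \<and>
     (\<forall>f. msubst \<sigma> (msubst \<tau> f) = f \<and> msubst \<tau> (msubst \<sigma> f) = f)"

lemma linear_autoD:
  assumes "linear_auto n \<sigma> \<tau>"
  shows "i < n \<Longrightarrow> linear_form n (\<sigma> i)" "i < n \<Longrightarrow> linear_form n (\<tau> i)"
    "msubst \<sigma> (msubst \<tau> f) = f" "msubst \<tau> (msubst \<sigma> f) = f"
    "f \<in> polys n \<Longrightarrow> msubst \<sigma> f \<in> polys n" "f \<in> polys n \<Longrightarrow> msubst \<tau> f \<in> polys n"
  using assms msubst_in_mpolys[of f n \<sigma>] msubst_in_mpolys[of f n \<tau>] linear_formD[of n]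
  by (auto simp: linear_auto_def)

text \<open>Write \<open>f\<close> as \<open>a\<close> times the variable \<open>j\<close> plus a
  rest \<open>r\<close> free of that variable. Solving for the variable gives \<open>\<tau>\<close>,
  which turns \<open>f\<close> into a coordinate and leaves the other coordinates alone.\<close>

lemma linear_auto_elementary:
  fixes f :: "'a::field mpoly"
  assumes f: "linear_form n f" and j: "j < n" and a: "lookup f (single j 1) \<noteq> 0"
  obtains \<sigma> \<tau> where "linear_auto n \<sigma> \<tau>" "msubst \<tau> f = mvar j" "\<And>i. i \<noteq> j \<Longrightarrow> \<tau> i = mvar i"
proof -
  define a where "a = lookup f (single j 1)"
  define r where "r = f - mconst a * mvar j"
  define \<sigma> where "\<sigma> = mvar(j := f)"
  define \<tau> where "\<tau> = mvar(j := mconst (1 / a) * (mvar j - r))"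
  have one: "mconst (1 / a) * (mconst a * z) = z" "mconst a * (mconst (1 / a) * z) = z" for z
    using a by (auto simp: a_def mconst_def mult_single simp flip: mult.assoc)
  have r: "linear_form n r"
    unfolding r_def using j by (intro linear_form_diff f linear_form_scale linear_form_mvar)
  have r0: "lookup r (single j 1) = 0"
    by (simp add: r_def a_def mconst_mvar lookup_minus)
  \<comment> \<open>The variable \<open>j\<close> does not occur in \<open>r\<close>, so a
    substitution that moves only this variable fixes \<open>r\<close>.\<close>
  have fix_r: "msubst \<rho> r = r" if "\<And>i. i \<noteq> j \<Longrightarrow> \<rho> i = mvar i" for \<rho>
  proof -
    have "msubst \<rho> r = msubst mvar r"
      unfolding msubst_linear_form[OF r]
    proof (intro sum.cong refl)
      fix i show "mconst (lookup r (single i 1)) * \<rho> i = mconst (lookup r (single i 1)) * mvar i"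
        using that[of i] r0 by (cases "i = j") (simp_all add: mconst_def)
    qed
    then show ?thesis by (simp add: msubst_id)
  qed
  have f_r: "f = r + mconst a * mvar j" by (simp add: r_def)
  note hom = ring_hom_onD(4,5,7)[OF ring_hom_msubst, simplified]
  have \<tau>f: "msubst \<tau> f = mvar j"
  proof -
    have "msubst \<tau> r = r" by (rule fix_r) (simp add: \<tau>_def)
    then have "msubst \<tau> f = r + mconst a * \<tau> j" unfolding f_r by (simp add: hom)
    then show ?thesis by (simp add: \<tau>_def one)
  qed
  have "msubst \<sigma> (\<tau> i) = mvar i" for i
  proof (cases "i = j")
    case True
    have "msubst \<sigma> r = r" by (rule fix_r) (simp add: \<sigma>_def)
    then have "msubst \<sigma> (\<tau> j) = mconst (1 / a) * (f - r)" by (simp add: \<tau>_def hom \<sigma>_def)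
    then show ?thesis using True by (simp add: f_r one)
  qed (simp add: \<tau>_def \<sigma>_def)
  moreover have "msubst \<tau> (\<sigma> i) = mvar i" for i
    by (simp add: \<sigma>_def \<tau>f) (simp add: \<tau>_def)
  ultimately have "linear_auto n \<sigma> \<tau>"
    using f r j by (auto simp: linear_auto_def msubst_msubst msubst_id \<sigma>_def \<tau>_def
        intro!: linear_form_scale linear_form_diff linear_form_mvar)
  then show thesis using \<tau>f by (rule that) (simp add: \<tau>_def)
qed

text \<open>For linear forms, ideal membership of one in the others is the same as linear dependence
  over the field. This form is what regular sequences give and what makes chains of ideals
  strict.\<close>

definition lin_indep :: "nat \<Rightarrow> 'a::comm_ring_1 mpoly set \<Rightarrow> bool" where
  "lin_indep n G \<longleftrightarrow> (\<forall>h\<in>G. h \<notin> span_ideal (polys n) (G - {h}))"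

lemma lin_indep_subset: "lin_indep n G \<Longrightarrow> H \<subseteq> G \<Longrightarrow> lin_indep n H"
  unfolding lin_indep_def using span_ideal_mono[of "H - {_}" "G - {_}"] by blast

lemma lin_indep_not_in_span:
  "lin_indep n G \<Longrightarrow> H \<subseteq> G \<Longrightarrow> h \<in> G \<Longrightarrow> h \<notin> H \<Longrightarrow> h \<notin> span_ideal (polys n) H"
  unfolding lin_indep_def using span_ideal_mono[of H "G - {h}"] by blast

lemma span_ideal_insert_cong:
  assumes A: "is_subring A" and "G \<subseteq> A" "H \<subseteq> A" "x \<in> A" "span_ideal A G = span_ideal A H"
  shows "span_ideal A (insert x G) = span_ideal A (insert x H)"
  using assms span_ideal_insert[OF A] by simp

text \<open>Gaussian elimination, one form at a time: the new form either lies in the ideal of the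
  variables collected in \<open>E\<close>, or it is made a further variable without disturbing them.
  Dependent forms need not become variables, so equality of the generating sets is claimed for
  independent ones only.\<close>

lemma linear_auto_span:
  fixes G :: "'a::field mpoly set"
  assumes "finite G" "\<And>f. f \<in> G \<Longrightarrow> linear_form n f"
  shows "\<exists>\<sigma> \<tau> E. linear_auto n \<sigma> \<tau> \<and> E \<subseteq> {..<n} \<and> card E \<le> card G \<and>
    span_ideal (polys n) (msubst \<tau> ` G) = span_ideal (polys n) (mvar ` E) \<and>
    (lin_indep n G \<longrightarrow> msubst \<tau> ` G = mvar ` E)"
  using assms
proof (induction G rule: finite_induct)
  case empty
  have "linear_auto n mvar (mvar :: nat \<Rightarrow> 'a mpoly)"
    by (auto simp: linear_auto_def linear_form_mvar msubst_id)
  then show ?case by (intro exI[of _ mvar] exI[of _ "{}"]) auto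
next
  case (insert f G)
  from insert.IH[OF insert.prems] obtain \<sigma> \<tau> E where st: "linear_auto n \<sigma> \<tau>"
    and E: "E \<subseteq> {..<n}" "card E \<le> card G"
    and span: "span_ideal (polys n) (msubst \<tau> ` G) = span_ideal (polys n) (mvar ` E)"
    and ind: "lin_indep n G \<longrightarrow> msubst \<tau> ` G = mvar ` E" by auto
  have f: "linear_form n f" and G: "\<And>g. g \<in> G \<Longrightarrow> linear_form n g"
    using insert.prems by auto
  define f' where "f' = msubst \<tau> f"
  have f': "linear_form n f'"
    unfolding f'_def using f by (intro linear_form_msubst linear_autoD(2)[OF st])
  have GR: "msubst \<tau> ` G \<subseteq> polys n" and ER: "mvar ` E \<subseteq> (polys n :: 'a mpoly set)"
    using G linear_autoD(6)[OF st] linear_formD E by (auto intro: mvar_in_polys)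
  show ?case
  proof (cases "f' \<in> span_ideal (polys n) (mvar ` E)")
    case True
    have "span_ideal (polys n) (msubst \<tau> ` insert f G) = span_ideal (polys n) (msubst \<tau> ` G)"
      using True GR linear_formD[OF f'] span span_ideal_superset[of "msubst \<tau> ` G" "polys n"]
        span_ideal_superset[of "insert f' (msubst \<tau> ` G)" "polys n"]
      by (intro span_ideal_eqI) (auto simp: f'_def)
    moreover have "\<not> lin_indep n (insert f G)"
    proof
      assume "lin_indep n (insert f G)"
      then have "f \<notin> span_ideal (polys n) G"
        using insert.hyps by (auto simp: lin_indep_def)
      moreover have "msubst \<sigma> f' \<in> span_ideal (polys n) (msubst \<sigma> ` msubst \<tau> ` G)"
        using True GR linear_autoD(5)[OF st] unfolding span[symmetric]
        by (intro ring_hom_span_ideal[OF ring_hom_on_subset[OF ring_hom_msubst]]) auto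
      ultimately show False by (simp add: f'_def linear_autoD(3)[OF st] image_image)
    qed
    ultimately show ?thesis using st E span insert.hyps
      by (intro exI[of _ \<sigma>] exI[of _ \<tau>] exI[of _ E]) auto
  next
    case False
    \<comment> \<open>Otherwise \<open>f'\<close> would involve only variables from \<open>E\<close>
      and lie in their ideal.\<close>
    have "\<exists>j<n. j \<notin> E \<and> lookup f' (single j 1) \<noteq> 0"
    proof (rule ccontr)
      assume "\<not> ?thesis"
      then have *: "lookup f' (single j 1) = 0 \<or> j \<in> E" if "j < n" for j using that by auto
      have I: "is_ideal (polys n) (span_ideal (polys n) (mvar ` E :: 'a mpoly set))"
        using ER by (intro span_ideal_is_ideal) auto
      have "(\<Sum>i<n. mconst (lookup f' (single i 1)) * mvar i) \<in> span_ideal (polys n) (mvar ` E)"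
      proof (rule is_ideal_sum[OF I])
        fix i assume "i \<in> {..<n}"
        with * consider "lookup f' (single i 1) = 0" | "i \<in> E" by auto
        then show "mconst (lookup f' (single i 1)) * mvar i \<in> span_ideal (polys n) (mvar ` E)"
          using is_idealD(2)[OF I] span_ideal_superset[of "mvar ` E" "polys n"]
          by cases (auto simp: mconst_def[of 0] intro!: is_idealD(4)[OF I])
      qed
      then show False using False linear_form_expand[OF f'] by simp
    qed
    then obtain j where j: "j < n" "j \<notin> E" "lookup f' (single j 1) \<noteq> 0" by blast
    from linear_auto_elementary[OF f' j(1,3)] obtain \<alpha> \<beta> where ab: "linear_auto n \<alpha> \<beta>"
      and \<beta>f: "msubst \<beta> f' = mvar j" and \<beta>v: "\<And>i. i \<noteq> j \<Longrightarrow> \<beta> i = mvar i" by metis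
    define \<sigma>' where "\<sigma>' = (\<lambda>i. msubst \<sigma> (\<alpha> i))"
    define \<tau>' where "\<tau>' = (\<lambda>i. msubst \<beta> (\<tau> i))"
    have \<tau>': "msubst \<tau>' g = msubst \<beta> (msubst \<tau> g)" for g
      by (simp add: \<tau>'_def msubst_msubst)
    have \<sigma>': "msubst \<sigma>' g = msubst \<sigma> (msubst \<alpha> g)" for g
      by (simp add: \<sigma>'_def msubst_msubst)
    have st': "linear_auto n \<sigma>' \<tau>'"
      unfolding linear_auto_def \<sigma>' \<tau>' linear_autoD(3,4)[OF st] linear_autoD(3,4)[OF ab]
      using linear_autoD(1,2)[OF st] linear_autoD(1,2)[OF ab]
      by (auto simp: \<sigma>'_def \<tau>'_def intro!: linear_form_msubst)
    have \<beta>E: "msubst \<beta> ` mvar ` E = mvar ` E"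
      using j(2) \<beta>v by (force simp: image_image)
    have \<beta>h: "msubst \<beta> x \<in> span_ideal (polys n) (msubst \<beta> ` H)"
      if "H \<subseteq> polys n" "x \<in> span_ideal (polys n) H" for x H
      using that linear_autoD(6)[OF ab]
      by (intro ring_hom_span_ideal[OF ring_hom_on_subset[OF ring_hom_msubst]]) auto
    have \<beta>G: "msubst \<beta> ` msubst \<tau> ` G \<subseteq> polys n"
      using GR linear_autoD(6)[OF ab] by auto
    have "span_ideal (polys n) (msubst \<beta> ` msubst \<tau> ` G) = span_ideal (polys n) (msubst \<beta> ` mvar ` E)"
    proof (rule span_ideal_eqI)
      show "msubst \<beta> ` msubst \<tau> ` G \<subseteq> span_ideal (polys n) (msubst \<beta> ` mvar ` E)"
        using \<beta>h[OF ER] span_ideal_superset[of "msubst \<tau> ` G" "polys n"] span by auto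
      show "msubst \<beta> ` mvar ` E \<subseteq> span_ideal (polys n) (msubst \<beta> ` msubst \<tau> ` G)"
        using \<beta>h[OF GR] span_ideal_superset[of "mvar ` E" "polys n"] span by auto
    qed (use \<beta>G ER \<beta>E in auto)
    then have "span_ideal (polys n) (msubst \<tau>' ` insert f G) = span_ideal (polys n) (mvar ` insert j E)"
      using span_ideal_insert_cong[OF is_subring_polys \<beta>G ER mvar_in_polys[OF j(1)]]
      unfolding \<beta>E by (simp add: \<tau>' image_image f'_def[symmetric] \<beta>f)
    moreover have "msubst \<tau>' ` insert f G = mvar ` insert j E" if "lin_indep n (insert f G)"
    proof -
      have "msubst \<tau> ` G = mvar ` E" using ind lin_indep_subset[OF that] by auto
      then have "msubst \<beta> ` msubst \<tau> ` G = mvar ` E" using \<beta>E by simp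
      then show ?thesis by (simp add: \<tau>' image_image f'_def[symmetric] \<beta>f)
    qed
    moreover have "insert j E \<subseteq> {..<n}" "card (insert j E) \<le> card (insert f G)"
      using E j insert.hyps finite_subset[OF E(1)] by auto
    ultimately show ?thesis using st' by blast
  qed
qed

section \<open>Reduction modulo linear forms\<close>

definition kill :: "nat set \<Rightarrow> nat \<Rightarrow> 'a::comm_ring_1 mpoly" where
  "kill E i = (if i \<in> E then 0 else mvar i)"

lemma kill_in_polys: "f \<in> polys n \<Longrightarrow> msubst (kill E) f \<in> polys n"
  by (intro msubst_in_mpolys) (auto simp: kill_def mvar_in_polys is_subringD(2))

lemma msubst_kill:
  fixes f :: "'a::comm_ring_1 mpoly"
  assumes E: "E \<subseteq> {..<n}" and f: "f \<in> polys n"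
  shows "f - msubst (kill E) f \<in> span_ideal (polys n) (mvar ` E)"
proof -
  let ?J = "span_ideal (polys n) (mvar ` E :: 'a mpoly set)"
  have ER: "mvar ` E \<subseteq> (polys n :: 'a mpoly set)" using E by (auto intro: mvar_in_polys)
  have J: "is_ideal (polys n) ?J" by (intro span_ideal_is_ideal ER is_subring_polys)
  note hom = ring_hom_onD[OF ring_hom_msubst, simplified]
  note R = is_subringD[OF is_subring_polys]
  \<comment> \<open>The polynomials congruent to their image form a subring. It contains constants
    and variables, hence every polynomial, since \<open>f\<close> is its own value at the
    variables.\<close>
  have "is_subring {f \<in> polys n. f - msubst (kill E) f \<in> ?J}"
    unfolding is_subring_def
  proof (intro conjI ballI)
    show "1 \<in> {f \<in> polys n. f - msubst (kill E) f \<in> ?J}"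
      using R(1) is_idealD(2)[OF J] by (simp add: hom)
    fix f g assume "f \<in> {f \<in> polys n. f - msubst (kill E) f \<in> ?J}"
      and "g \<in> {f \<in> polys n. f - msubst (kill E) f \<in> ?J}"
    then have fg: "f \<in> polys n" "g \<in> polys n" "f - msubst (kill E) f \<in> ?J" "g - msubst (kill E) g \<in> ?J"
      by auto
    have "(f - msubst (kill E) f) - (g - msubst (kill E) g) \<in> ?J"
      by (intro is_ideal_diff[OF is_subring_polys J] fg)
    then show "f - g \<in> {f \<in> polys n. f - msubst (kill E) f \<in> ?J}"
      using fg R(3) by (simp add: hom algebra_simps)
    have "g * (f - msubst (kill E) f) + msubst (kill E) f * (g - msubst (kill E) g) \<in> ?J"
      using fg by (intro is_idealD(3,4)[OF J] kill_in_polys)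
    moreover have "g * (f - msubst (kill E) f) + msubst (kill E) f * (g - msubst (kill E) g)
        = f * g - msubst (kill E) (f * g)"
      by (simp add: hom algebra_simps)
    ultimately show "f * g \<in> {f \<in> polys n. f - msubst (kill E) f \<in> ?J}" using fg R(4) by simp
  qed
  then have "ev mconst mvar f \<in> {f \<in> polys n. f - msubst (kill E) f \<in> ?J}"
    using f
  proof (rule ev_in)
    fix i assume "i < n"
    then show "mvar i \<in> {f \<in> polys n. f - msubst (kill E) f \<in> ?J}"
      using is_idealD(2)[OF J] span_ideal_superset[of "mvar ` E" "polys n"]
      by (auto simp: kill_def mvar_in_polys)
  qed (use is_idealD(2)[OF J] in auto)
  then show ?thesis using msubst_id[of f] by (simp add: msubst_def)
qed

lemma msubst_kill_eq_0_iff: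
  fixes f :: "'a::comm_ring_1 mpoly"
  assumes E: "E \<subseteq> {..<n}" and f: "f \<in> polys n"
  shows "msubst (kill E) f = 0 \<longleftrightarrow> f \<in> span_ideal (polys n) (mvar ` E)"
proof
  show "f \<in> span_ideal (polys n) (mvar ` E)" if "msubst (kill E) f = 0"
    using msubst_kill[OF assms] that by simp
  assume "f \<in> span_ideal (polys n) (mvar ` E)"
  then have "msubst (kill E) f \<in> span_ideal (polys n) (msubst (kill E) ` mvar ` E)"
    using E by (intro ring_hom_span_ideal[OF ring_hom_on_subset[OF ring_hom_msubst]])
       (auto intro: kill_in_polys mvar_in_polys)
  also have "\<dots> \<subseteq> {0}"
    by (intro span_ideal_least is_ideal_zero is_subring_polys) (auto simp: kill_def)
  finally show "msubst (kill E) f = 0" by simp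
qed

text \<open>The quotient by linear forms is realized inside the polynomial ring itself: change
  coordinates, set the variables in \<open>E\<close> to zero, change back. Having a domain as target
  yields primality, and the projection is again given by linear forms, as the leading form
  construction requires.\<close>

lemma linear_projection:
  fixes G :: "'a::field mpoly set"
  assumes "finite G" "\<And>f. f \<in> G \<Longrightarrow> linear_form n f"
  shows "\<exists>\<pi>. (\<forall>i<n. linear_form n (\<pi> i)) \<and>
    (\<forall>f\<in>polys n. msubst \<pi> f = 0 \<longleftrightarrow> f \<in> span_ideal (polys n) G)"
proof -
  obtain \<sigma> \<tau> E where st: "linear_auto n \<sigma> \<tau>" and E: "E \<subseteq> {..<n}"
    and span: "span_ideal (polys n) (msubst \<tau> ` G) = span_ideal (polys n) (mvar ` E)"
    using linear_auto_span[OF assms] by blast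
  have GR: "G \<subseteq> polys n" using assms linear_formD by blast
  have iff: "f \<in> span_ideal (polys n) G \<longleftrightarrow> msubst \<tau> f \<in> span_ideal (polys n) (mvar ` E)"
    if "f \<in> polys n" for f
  proof
    assume "f \<in> span_ideal (polys n) G"
    then show "msubst \<tau> f \<in> span_ideal (polys n) (mvar ` E)"
      unfolding span[symmetric] using GR linear_autoD(6)[OF st]
      by (intro ring_hom_span_ideal[where A = "polys n"] ring_hom_on_subset[OF ring_hom_msubst]) auto
  next
    assume "msubst \<tau> f \<in> span_ideal (polys n) (mvar ` E)"
    then have "msubst \<sigma> (msubst \<tau> f) \<in> span_ideal (polys n) (msubst \<sigma> ` msubst \<tau> ` G)"
      unfolding span[symmetric] using GR linear_autoD(5,6)[OF st]
      by - (rule ring_hom_span_ideal[where A = "polys n", OF ring_hom_on_subset[OF ring_hom_msubst]], auto)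
    then show "f \<in> span_ideal (polys n) G" by (simp add: linear_autoD(3)[OF st] image_image)
  qed
  define \<pi> where "\<pi> = (\<lambda>i. msubst \<sigma> (msubst (kill E) (\<tau> i)))"
  have \<pi>: "msubst \<pi> f = msubst \<sigma> (msubst (kill E) (msubst \<tau> f))" for f
    by (simp add: \<pi>_def msubst_msubst)
  have "linear_form n (\<pi> i)" if "i < n" for i
    unfolding \<pi>_def using that linear_autoD(1,2)[OF st]
    by (intro linear_form_msubst) (auto simp: kill_def linear_form_mvar)
  moreover have "msubst \<pi> f = 0 \<longleftrightarrow> f \<in> span_ideal (polys n) G" if "f \<in> polys n" for f
  proof -
    have "msubst \<pi> f = 0 \<longleftrightarrow> msubst (kill E) (msubst \<tau> f) = 0"
      unfolding \<pi> using linear_autoD(4)[OF st] ring_hom_onD(2)[OF ring_hom_msubst] by metis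
    then show ?thesis using msubst_kill_eq_0_iff[OF E linear_autoD(6)[OF st that]] iff[OF that] by simp
  qed
  ultimately show ?thesis by blast
qed

lemma span_linear_forms_prime:
  fixes G :: "'a::field mpoly set"
  assumes "finite G" "\<And>f. f \<in> G \<Longrightarrow> linear_form n f"
  shows "is_prime (polys n) (span_ideal (polys n) G)"
proof -
  obtain \<pi> where \<pi>: "\<And>f. f \<in> polys n \<Longrightarrow> msubst \<pi> f = 0 \<longleftrightarrow> f \<in> span_ideal (polys n) G"
    using linear_projection[OF assms] by blast
  note hom = ring_hom_onD[OF ring_hom_msubst, simplified]
  note R = is_subringD[OF is_subring_polys]
  have "G \<subseteq> polys n" using assms linear_formD by blast
  then have "is_ideal (polys n) (span_ideal (polys n) G)" by (rule span_ideal_is_ideal[OF is_subring_polys])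
  moreover have "1 \<notin> span_ideal (polys n) G" using \<pi>[OF R(1)] by (simp add: hom)
  moreover have "x \<in> span_ideal (polys n) G \<or> y \<in> span_ideal (polys n) G"
    if "x \<in> polys n" "y \<in> polys n" "x * y \<in> span_ideal (polys n) G" for x y
    using \<pi>[OF R(4)[OF that(1,2)]] \<pi>[OF that(1)] \<pi>[OF that(2)] that(3) by (simp add: hom)
  ultimately show ?thesis by (simp add: is_prime_def)
qed

section \<open>Generators of the ideal of a star configuration\<close>

text \<open>Enumerate a regular sequence with the dependent form \<open>h\<close> last. Then
  \<open>h * 1\<close> lies in the ideal of the preceding entries, so \<open>1\<close> does,
  contrary to properness.\<close>

lemma star_configuration_lin_indep:
  fixes F :: "'k::field mpoly set"
  assumes star: "star_configuration n c F" and H: "H \<subseteq> F" "card H \<le> c + 1"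
  shows "lin_indep n H"
  unfolding lin_indep_def
proof (intro ballI notI)
  let ?R = "polys n :: 'k mpoly set"
  fix h assume h: "h \<in> H" "h \<in> span_ideal ?R (H - {h})"
  \<comment> \<open>\<open>N\<close> is the length for which the definition of a star configuration
    promises regularity; \<open>H\<close> is enlarged to that size inside \<open>F\<close>.\<close>
  define N where "N = (if c = card F then c else c + 1)"
  have F: "finite F" "F \<subseteq> ?R" "c \<le> card F" using star by (auto simp: star_configuration_def)
  have "card H \<le> N" "N \<le> card F"
    using H card_mono[OF F(1) H(1)] F(3) by (auto simp: N_def)
  then obtain H' where H': "H \<subseteq> H'" "H' \<subseteq> F" "card H' = N"
    using exists_subset_between[of H N F] H(1) F(1) by auto
  have fH: "finite (H' - {h})" using finite_subset[OF H'(2) F(1)] by simp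
  then obtain xs where xs: "set xs = H' - {h}" "distinct xs" using finite_distinct_list by blast
  have N: "length (xs @ [h]) = N"
    using xs h(1) H' fH distinct_card[OF xs(2)] card_Suc_Diff1[of H' h] by fastforce
  have "regular_sequence (ring_on ?R) (xs @ [h])"
    using star xs h(1) H' N unfolding star_configuration_def N_def
    by (elim conjE allE[of _ "xs @ [h]"]) auto
  then have reg: "\<forall>i<length (xs @ [h]). \<forall>r\<in>?R. (xs @ [h]) ! i * r \<in> span_ideal ?R (set (take i (xs @ [h])))
      \<longrightarrow> r \<in> span_ideal ?R (set (take i (xs @ [h])))"
    and ne: "span_ideal ?R (set (xs @ [h])) \<noteq> ?R"
    by (auto simp: regular_sequence_def genideal_ring_on)
  have "h \<in> span_ideal ?R (set xs)"
    using h(2) span_ideal_mono[of "H - {h}" "set xs" ?R] H'(1) xs by auto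
  with reg[rule_format, of "length xs" 1] have "1 \<in> span_ideal ?R (set xs)"
    by (simp add: is_subringD(1))
  then have 1: "1 \<in> span_ideal ?R (set (xs @ [h]))"
    using span_ideal_mono[of "set xs" "set (xs @ [h])" ?R] by auto
  have sub: "set (xs @ [h]) \<subseteq> ?R" using xs H' F(2) h(1) by auto
  have "x \<in> span_ideal ?R (set (xs @ [h]))" if "x \<in> ?R" for x
    using is_idealD(4)[OF span_ideal_is_ideal[OF is_subring_polys sub] that 1] by simp
  then show False using ne span_ideal_subset[OF is_subring_polys sub] by blast
qed

locale linear_star =
  fixes n c :: nat and F :: "'k::field mpoly set"
  assumes lsc: "linear_star_configuration n c F"
begin

abbreviation "R \<equiv> polys n :: 'k mpoly set"

lemma F: "finite F" "\<And>f. f \<in> F \<Longrightarrow> linear_form n f" "F \<subseteq> R" "1 \<le> c" "c \<le> card F" "c \<le> n"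
  using lsc by (auto simp: linear_star_configuration_def star_configuration_def linear_form_def)

lemma indep: "H \<subseteq> F \<Longrightarrow> card H \<le> c + 1 \<Longrightarrow> lin_indep n H"
  using lsc star_configuration_lin_indep by (auto simp: linear_star_configuration_def)

lemma finite_sub: "H \<subseteq> F \<Longrightarrow> finite H"
  using F(1) finite_subset by blast

lemma prod_in_R: "H \<subseteq> F \<Longrightarrow> \<Prod>H \<in> R"
  using F(3) by (intro is_subring_prod) auto

lemma prime_span: "H \<subseteq> F \<Longrightarrow> is_prime R (span_ideal R H)"
  using F finite_sub by (intro span_linear_forms_prime) auto

lemma not_in_span: "H \<subseteq> F \<Longrightarrow> h \<in> F \<Longrightarrow> h \<notin> H \<Longrightarrow> card H \<le> c \<Longrightarrow> h \<notin> span_ideal R H"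
  using lin_indep_not_in_span[OF indep[of "insert h H"], of H h] finite_sub by auto

text \<open>Induction on \<open>Z\<close>. The ideal of \<open>insert h G\<close> is prime and,
  having at most \<open>c\<close> generators, contains no form of \<open>Z\<close>. So membership of
  \<open>r * \<Prod>Z\<close> passes to the cofactor \<open>r\<close>, which is then a multiple of
  \<open>h\<close> modulo \<open>G\<close>.\<close>

lemma mod_prod:
  assumes G: "G \<subseteq> F" "card G < c" and Z: "Z \<subseteq> F - G" and f: "f \<in> R"
    and fz: "\<And>h. h \<in> Z \<Longrightarrow> f \<in> span_ideal R (insert h G)"
  shows "\<exists>r\<in>R. f - r * \<Prod>Z \<in> span_ideal R G"
proof -
  have "finite Z" using Z finite_sub[of Z] by auto
  then show ?thesis using Z fz
  proof (induction Z rule: finite_induct)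
    case empty
    have "is_ideal R (span_ideal R G)" using G F(3) by (intro span_ideal_is_ideal) auto
    then show ?case using f is_idealD(2) by (intro bexI[of _ f]) auto
  next
    case (insert h Z)
    let ?I = "span_ideal R (insert h G)"
    obtain r where r: "r \<in> R" "f - r * \<Prod>Z \<in> span_ideal R G"
      using insert by auto
    have hG: "insert h G \<subseteq> F" using insert.prems G by auto
    have P: "is_prime R ?I" by (rule prime_span[OF hG])
    note I = is_primeD(1)[OF P]
    have IG: "is_ideal R (span_ideal R G)" using G F(3) by (intro span_ideal_is_ideal) auto
    have ZR: "\<Prod>Z \<in> R" using insert.prems by (intro prod_in_R) auto
    have "f - r * \<Prod>Z \<in> ?I" using r(2) span_ideal_mono[of G "insert h G" R] by auto
    then have "f - (f - r * \<Prod>Z) \<in> ?I"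
      by (rule is_ideal_diff[OF is_subring_polys I insert.prems(2)[OF insertI1]])
    then have "r * \<Prod>Z \<in> ?I" by simp
    moreover have "\<Prod>Z \<notin> ?I"
    proof
      assume "\<Prod>Z \<in> ?I"
      then obtain h' where h': "h' \<in> Z" "h' \<in> ?I"
        using is_prime_prod[OF P is_subring_polys, of Z "\<lambda>x. x"] insert.prems F(3) by auto
      have "card (insert h G) \<le> c" using G(2) finite_sub[OF G(1)] by (simp add: card_insert_if)
      then show False
        using not_in_span[OF hG, of h'] h' insert.prems insert.hyps by auto
    qed
    ultimately have rI: "r \<in> ?I" using is_primeD(3)[OF P r(1) ZR] by blast
    have hR: "h \<in> R" and GR: "G \<subseteq> R" using hG F(3) by auto
    obtain r' where r': "r' \<in> R" "r - r' * h \<in> span_ideal R G"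
      by (rule span_ideal_insertI[OF is_subring_polys hR GR rI])
    have "(f - r * \<Prod>Z) + (r - r' * h) * \<Prod>Z \<in> span_ideal R G"
      using r r' ZR by (intro is_idealD(3,5)[OF IG])
    also have "(f - r * \<Prod>Z) + (r - r' * h) * \<Prod>Z = f - r' * \<Prod>(insert h Z)"
      using insert.hyps by (simp add: algebra_simps)
    finally show ?case using r'(1) by blast
  qed
qed

text \<open>The generators in height \<open>j\<close> omit \<open>j - 1\<close> forms. With
  \<open>Suc (card H) = j\<close> instead of a subtraction there are none for \<open>j = 0\<close>,
  where the ideal is zero and the induction on the height starts.\<close>

definition star_gens :: "nat \<Rightarrow> 'k mpoly set" where
  "star_gens j = (\<lambda>H. \<Prod>(F - H)) ` {H. H \<subseteq> F \<and> Suc (card H) = j}"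

lemma star_gens_R: "star_gens j \<subseteq> R"
  unfolding star_gens_def using prod_in_R by auto

lemma Inter_span_subset:
  "j \<le> c \<Longrightarrow> (\<Inter>G\<in>{G. G \<subseteq> F \<and> card G = j}. span_ideal R G) \<subseteq> span_ideal R (star_gens j)"
proof (induction j)
  case 0
  have "{G. G \<subseteq> F \<and> card G = 0} = {{}}" using finite_sub by auto
  then show ?case
    using is_idealD(2)[OF span_ideal_is_ideal[OF is_subring_polys star_gens_R]]
    by (simp add: span_ideal_empty)
next
  case (Suc j)
  let ?\<G> = "{G. G \<subseteq> F \<and> card G = j}"
  show ?case
  proof
    fix f assume "f \<in> (\<Inter>G\<in>{G. G \<subseteq> F \<and> card G = Suc j}. span_ideal R G)"
    then have f: "f \<in> span_ideal R G" if "G \<subseteq> F" "card G = Suc j" for G using that by auto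
    obtain G0 where "G0 \<subseteq> F" "card G0 = Suc j"
      using exists_subset_between[of "{}" "Suc j" F] F Suc.prems by auto
    then have fR: "f \<in> R" using f span_ideal_subset[OF is_subring_polys, of G0 n] F(3) by blast
    have "\<exists>r\<in>R. f - r * \<Prod>(F - G) \<in> span_ideal R G" if G: "G \<in> ?\<G>" for G
      using G Suc.prems finite_sub by (intro mod_prod fR f) (auto simp: card_insert_if)
    then have "\<forall>G\<in>?\<G>. \<exists>r. r \<in> R \<and> f - r * \<Prod>(F - G) \<in> span_ideal R G" by blast
    from bchoice[OF this] obtain r where r: "\<And>G. G \<in> ?\<G> \<Longrightarrow> r G \<in> R"
      "\<And>G. G \<in> ?\<G> \<Longrightarrow> f - r G * \<Prod>(F - G) \<in> span_ideal R G" by blast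
    define s where "s = (\<Sum>G\<in>?\<G>. r G * \<Prod>(F - G))"
    have fin: "finite ?\<G>" using F(1) by (auto intro: finite_subset[of _ "Pow F"])
    have "f - s \<in> span_ideal R G" if G: "G \<in> ?\<G>" for G
    proof -
      have I: "is_ideal R (span_ideal R G)" using G F(3) by (intro span_ideal_is_ideal) auto
      have "r H * \<Prod>(F - H) \<in> span_ideal R G" if "H \<in> ?\<G> - {G}" for H
      proof -
        \<comment> \<open>Two different sets of equal size do not contain each other. A form in
          \<open>G\<close> outside \<open>H\<close> divides the product over \<open>F - H\<close>,
          so modulo \<open>G\<close> only the term belonging to \<open>G\<close> itself
          survives.\<close>
        have "\<not> G \<subseteq> H" using that G card_subset_eq[OF finite_sub[of H], of G] by auto
        then obtain x where x: "x \<in> G" "x \<notin> H" by auto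
        then have xF: "x \<in> F - H" using G by auto
        have "r H * \<Prod>(F - H - {x}) \<in> R"
          using that r(1) prod_in_R[of "F - H - {x}"] by (auto intro!: is_subringD(4))
        then have "(r H * \<Prod>(F - H - {x})) * x \<in> span_ideal R G"
          using x span_ideal_superset[of G R] by (intro is_idealD(4)[OF I]) auto
        then show ?thesis using prod.remove[OF _ xF, of "\<lambda>x. x"] F(1) by (simp add: ac_simps)
      qed
      then have "(f - r G * \<Prod>(F - G)) - (\<Sum>H\<in>?\<G> - {G}. r H * \<Prod>(F - H)) \<in> span_ideal R G"
        by (rule is_ideal_diff[OF is_subring_polys I r(2)[OF G] is_ideal_sum[OF I]])
      then show ?thesis unfolding s_def using sum.remove[OF fin G, of "\<lambda>G. r G * \<Prod>(F - G)"]
        by (simp add: algebra_simps)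
    qed
    then have "f - s \<in> span_ideal R (star_gens j)" using Suc by auto
    moreover have "star_gens j \<subseteq> span_ideal R (star_gens (Suc j))"
    proof
      fix g assume "g \<in> star_gens j"
      then obtain H where H: "H \<subseteq> F" "Suc (card H) = j" "g = \<Prod>(F - H)" by (auto simp: star_gens_def)
      \<comment> \<open>\<open>H\<close> has fewer than \<open>c \<le> card F\<close> elements, so
        one more form can be omitted; the old generator is a multiple of the new one.\<close>
      have "\<exists>x. x \<in> F - H"
      proof -
        have "H \<noteq> F" using H(2) Suc.prems F(5) by auto
        then show ?thesis using H(1) by auto
      qed
      then obtain x where x: "x \<in> F - H" by blast
      have "\<Prod>(F - insert x H) \<in> star_gens (Suc j)"
        using x H finite_sub[of H] by (auto simp: star_gens_def intro!: image_eqI[of _ _ "insert x H"])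
      then have "x * \<Prod>(F - insert x H) \<in> span_ideal R (star_gens (Suc j))"
        using x F(3) span_ideal_superset[of "star_gens (Suc j)" R]
        by (intro is_idealD(4)[OF span_ideal_is_ideal[OF is_subring_polys star_gens_R]]) auto
      moreover have "F - insert x H = F - H - {x}" by auto
      ultimately show "g \<in> span_ideal R (star_gens (Suc j))"
        using prod.remove[OF _ x, of "\<lambda>x. x"] F(1) H(3) by simp
    qed
    ultimately have "f - s \<in> span_ideal R (star_gens (Suc j))"
      using span_ideal_least[OF span_ideal_is_ideal[OF is_subring_polys star_gens_R]] by blast
    moreover have "s \<in> span_ideal R (star_gens (Suc j))"
      unfolding s_def using r(1) span_ideal_superset[of "star_gens (Suc j)" R]
      by (intro is_ideal_sum[OF span_ideal_is_ideal[OF is_subring_polys star_gens_R]]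
          is_idealD(4)[OF span_ideal_is_ideal[OF is_subring_polys star_gens_R]])
         (auto simp: star_gens_def)
    ultimately have "(f - s) + s \<in> span_ideal R (star_gens (Suc j))"
      by (rule is_idealD(3)[OF span_ideal_is_ideal[OF is_subring_polys star_gens_R]])
    then show "f \<in> span_ideal R (star_gens (Suc j))" by simp
  qed
qed

lemma star_ideal_eq: "star_ideal n c F = span_ideal R (star_gens c)"
proof
  have e: "star_ideal n c F = (\<Inter>G\<in>{G. G \<subseteq> F \<and> card G = c}. span_ideal R G)"
    by (simp add: star_ideal_def genideal_ring_on)
  show "star_ideal n c F \<subseteq> span_ideal R (star_gens c)"
    unfolding e by (rule Inter_span_subset) simp
  show "span_ideal R (star_gens c) \<subseteq> star_ideal n c F"
    unfolding e
  proof (intro INT_greatest span_ideal_least subsetI)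
    fix G assume G: "G \<in> {G. G \<subseteq> F \<and> card G = c}"
    show I: "is_ideal R (span_ideal R G)" using G F(3) by (intro span_ideal_is_ideal) auto
    fix g assume "g \<in> star_gens c"
    then obtain H where H: "H \<subseteq> F" "Suc (card H) = c" "g = \<Prod>(F - H)" by (auto simp: star_gens_def)
    have "\<not> G \<subseteq> H" using G H card_mono[OF finite_sub[of H], of G] by auto
    then obtain x where x: "x \<in> G" "x \<in> F - H" using G by auto
    have "\<Prod>(F - H - {x}) * x \<in> span_ideal R G"
      using x span_ideal_superset[of G R] prod_in_R[of "F - H - {x}"] by (intro is_idealD(4)[OF I]) auto
    then show "g \<in> span_ideal R G" using prod.remove[OF _ x(2), of "\<lambda>x. x"] F(1) H(3) by (simp add: ac_simps)
  qed
qed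

end

section \<open>Localization of a domain at a prime\<close>

abbreviation emb :: "'a::idom \<Rightarrow> 'a fract" where
  "emb a \<equiv> Fract a 1"

lemma ring_hom_emb: "ring_hom_on UNIV emb"
  by (auto simp: ring_hom_on_def One_fract_def)

lemma emb_eq_0_iff [simp]: "emb a = 0 \<longleftrightarrow> a = 0"
  by (simp add: Zero_fract_def eq_fract)

locale localization =
  fixes A p :: "'a::idom set"
  assumes A: "is_subring A" and p: "is_prime A p"
begin

abbreviation "S \<equiv> localize A p A"

lemma denom_nonzero: "b \<in> A - p \<Longrightarrow> b \<noteq> 0"
  using is_idealD(2)[OF is_primeD(1)[OF p]] by auto

lemma denom_mult: "a \<in> A - p \<Longrightarrow> b \<in> A - p \<Longrightarrow> a * b \<in> A - p"
  using is_primeD(3)[OF p] is_subringD(4)[OF A] by blast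

lemma one_denom: "1 \<in> A - p"
  using is_subringD(1)[OF A] is_primeD(2)[OF p] by blast

lemma localizeI: "a \<in> I \<Longrightarrow> b \<in> A - p \<Longrightarrow> Fract a b \<in> localize A p I"
  by (auto simp: localize_def)

lemma localizeE:
  assumes "x \<in> localize A p I"
  obtains a b where "x = Fract a b" "a \<in> I" "b \<in> A - p"
  using assms by (auto simp: localize_def)

lemma localize_mono: "I \<subseteq> J \<Longrightarrow> localize A p I \<subseteq> localize A p J"
  by (auto simp: localize_def)

lemma is_subring_S: "is_subring S"
  unfolding is_subring_def
proof (intro conjI ballI)
  show "1 \<in> S" unfolding One_fract_def using one_denom by (intro localizeI) auto
  fix x y assume "x \<in> S" "y \<in> S"
  then obtain a b c d where x: "x = Fract a b" "a \<in> A" "b \<in> A - p" and y: "y = Fract c d" "c \<in> A" "d \<in> A - p"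
    by (metis localizeE)
  have "x - y = Fract (a * d - c * b) (b * d)" "x * y = Fract (a * c) (b * d)"
    using x y denom_nonzero by auto
  then show "x - y \<in> S" "x * y \<in> S"
    using x y denom_mult[OF x(3) y(3)] is_subringD[OF A] by (auto intro!: localizeI)
qed

lemma is_ideal_localize:
  assumes I: "is_ideal A I"
  shows "is_ideal S (localize A p I)"
  unfolding is_ideal_def
proof (intro conjI ballI)
  show "localize A p I \<subseteq> S" using is_idealD(1)[OF I] by (intro localize_mono) auto
  show "0 \<in> localize A p I" unfolding Zero_fract_def using one_denom is_idealD(2)[OF I] by (intro localizeI)
  fix x assume "x \<in> localize A p I"
  then obtain a b where x: "x = Fract a b" "a \<in> I" "b \<in> A - p" by (rule localizeE)
  {
    fix y assume "y \<in> localize A p I"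
    then obtain c d where y: "y = Fract c d" "c \<in> I" "d \<in> A - p" by (rule localizeE)
    have "x + y = Fract (a * d + c * b) (b * d)" using x y denom_nonzero by auto
    then show "x + y \<in> localize A p I"
      using x y denom_mult[OF x(3) y(3)] is_idealD[OF I] by (auto intro!: localizeI)
  next
    fix y assume "y \<in> S"
    then obtain c d where y: "y = Fract c d" "c \<in> A" "d \<in> A - p" by (rule localizeE)
    have "y * x = Fract (c * a) (d * b)" using x y by auto
    then show "y * x \<in> localize A p I"
      using x y denom_mult[OF y(3) x(3)] is_idealD[OF I] by (auto intro!: localizeI)
  }
qed

lemma emb_in_localize: "a \<in> I \<Longrightarrow> emb a \<in> localize A p I"
  by (rule localizeI[OF _ one_denom])

lemma inverse_in_S: "b \<in> A - p \<Longrightarrow> Fract 1 b \<in> S"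
  by (rule localizeI[OF is_subringD(1)[OF A]])

lemma localize_span:
  assumes G: "G \<subseteq> A"
  shows "localize A p (span_ideal A G) = span_ideal S (emb ` G)"
proof
  have GS: "emb ` G \<subseteq> S" using G emb_in_localize by auto
  show "localize A p (span_ideal A G) \<subseteq> span_ideal S (emb ` G)"
  proof
    fix x assume "x \<in> localize A p (span_ideal A G)"
    then obtain a b where x: "x = Fract a b" "a \<in> span_ideal A G" "b \<in> A - p" by (rule localizeE)
    have "emb a \<in> span_ideal S (emb ` G)"
      by (rule ring_hom_span_ideal[OF ring_hom_on_subset[OF ring_hom_emb A] _ is_subring_S G x(2)])
         (auto intro: emb_in_localize)
    then have "Fract 1 b * emb a \<in> span_ideal S (emb ` G)"
      using inverse_in_S[OF x(3)] by (intro is_idealD(4)[OF span_ideal_is_ideal[OF is_subring_S GS]])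
    then show "x \<in> span_ideal S (emb ` G)" using x(1) by simp
  qed
  show "span_ideal S (emb ` G) \<subseteq> localize A p (span_ideal A G)"
    using span_ideal_superset[of G A] emb_in_localize
    by (intro span_ideal_least is_ideal_localize span_ideal_is_ideal A G) blast
qed

lemma localize_eq_S:
  assumes I: "is_ideal A I" and u: "u \<in> I" "u \<notin> p"
  shows "localize A p I = S"
proof
  have IL: "is_ideal S (localize A p I)" by (rule is_ideal_localize[OF I])
  then show "localize A p I \<subseteq> S" by (auto simp: is_ideal_def)
  have uA: "u \<in> A - p" using u is_idealD(1)[OF I] by auto
  have "Fract u u \<in> localize A p I" using u uA by (intro localizeI)
  moreover have "Fract u u = 1" using denom_nonzero[OF uA] by (simp add: One_fract_def eq_fract)
  ultimately have 1: "1 \<in> localize A p I" by simp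
  show "S \<subseteq> localize A p I" using is_idealD(4)[OF IL _ 1] by auto
qed

lemma emb_in_localize_iff:
  assumes P: "is_prime A P" "P \<subseteq> p" and a: "a \<in> A"
  shows "emb a \<in> localize A p P \<longleftrightarrow> a \<in> P"
proof
  assume "emb a \<in> localize A p P"
  then obtain c d where cd: "emb a = Fract c d" "c \<in> P" "d \<in> A - p" by (rule localizeE)
  then have "a * d = c" using denom_nonzero[OF cd(3)] by (simp add: eq_fract)
  then have "a * d \<in> P" "d \<notin> P" using cd P(2) by auto
  then show "a \<in> P" using is_primeD(3)[OF P(1) a, of d] cd(3) by auto
qed (rule emb_in_localize)

lemma Fract_in_localize_iff:
  assumes P: "is_prime A P" "P \<subseteq> p" and a: "a \<in> A" "b \<in> A - p"
  shows "Fract a b \<in> localize A p P \<longleftrightarrow> a \<in> P"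
proof
  assume "Fract a b \<in> localize A p P"
  then have "emb b * Fract a b \<in> localize A p P"
    using a by (intro is_idealD(4)[OF is_ideal_localize[OF is_primeD(1)[OF P(1)]]] emb_in_localize) auto
  moreover have "emb b * Fract a b = emb a" using denom_nonzero[OF a(2)] by (simp add: eq_fract)
  ultimately show "a \<in> P" using emb_in_localize_iff[OF P a(1)] by simp
qed (use a localizeI in auto)

lemma is_prime_localize:
  assumes P: "is_prime A P" "P \<subseteq> p"
  shows "is_prime S (localize A p P)"
  unfolding is_prime_def
proof (intro conjI ballI impI)
  show "is_ideal S (localize A p P)" by (rule is_ideal_localize[OF is_primeD(1)[OF P(1)]])
  show "1 \<notin> localize A p P"
    unfolding One_fract_def using emb_in_localize_iff[OF P is_subringD(1)[OF A]] is_primeD(2)[OF P(1)] by simp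
  fix x y assume "x \<in> S" "y \<in> S" and xy: "x * y \<in> localize A p P"
  then obtain a b c d where x: "x = Fract a b" "a \<in> A" "b \<in> A - p" and y: "y = Fract c d" "c \<in> A" "d \<in> A - p"
    by (metis localizeE)
  have "a * c \<in> P"
    using xy x y Fract_in_localize_iff[OF P, of "a * c" "b * d"] denom_mult[OF x(3) y(3)] is_subringD(4)[OF A]
    by auto
  then have "a \<in> P \<or> c \<in> P" using is_primeD(3)[OF P(1)] x y by auto
  then show "x \<in> localize A p P \<or> y \<in> localize A p P"
    using x y by (auto intro: localizeI)
qed

lemma localize_strict_mono:
  assumes "is_prime A P" "P \<subseteq> p" "is_prime A Q" "Q \<subseteq> p" "P \<subset> Q"
  shows "localize A p P \<subset> localize A p Q"
proof -
  obtain a where a: "a \<in> Q" "a \<notin> P" using assms(5) by auto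
  then have "a \<in> A" using is_idealD(1)[OF is_primeD(1)[OF assms(3)]] by auto
  then have "emb a \<in> localize A p Q" "emb a \<notin> localize A p P"
    using a emb_in_localize_iff assms by auto
  then show ?thesis using localize_mono[of P Q] assms(5) by auto
qed

definition contract :: "'a fract set \<Rightarrow> 'a set" where
  "contract q = {a \<in> A. emb a \<in> q}"

lemma Fract_in_iff:
  assumes q: "is_ideal S q" and a: "a \<in> A" "b \<in> A - p"
  shows "Fract a b \<in> q \<longleftrightarrow> emb a \<in> q"
proof
  assume "Fract a b \<in> q"
  then have "emb b * Fract a b \<in> q" using a by (intro is_idealD(4)[OF q] emb_in_localize) auto
  moreover have "emb b * Fract a b = emb a" using denom_nonzero[OF a(2)] by (simp add: eq_fract)
  ultimately show "emb a \<in> q" by simp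
next
  assume "emb a \<in> q"
  then have "Fract 1 b * emb a \<in> q" using a by (intro is_idealD(4)[OF q] inverse_in_S)
  then show "Fract a b \<in> q" by simp
qed

lemma is_prime_contract:
  assumes q: "is_prime S q"
  shows "is_prime A (contract q)" "contract q \<subseteq> p"
proof -
  note I = is_primeD(1)[OF q]
  have "is_ideal A (contract q)"
    unfolding is_ideal_def
  proof (intro conjI ballI)
    show "contract q \<subseteq> A" by (auto simp: contract_def)
    show "0 \<in> contract q"
      using is_idealD(2)[OF I] is_subringD(2)[OF A] by (simp add: contract_def Zero_fract_def)
    fix x assume x: "x \<in> contract q"
    show "x + y \<in> contract q" if "y \<in> contract q" for y
      using x that is_idealD(3)[OF I, of "emb x" "emb y"] is_subringD(6)[OF A] by (simp add: contract_def)
    show "a * x \<in> contract q" if "a \<in> A" for a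
      using x that is_idealD(4)[OF I, of "emb a" "emb x"] is_subringD(4)[OF A] emb_in_localize[of a A]
      by (simp add: contract_def)
  qed
  moreover have "1 \<notin> contract q" using is_primeD(2)[OF q] by (simp add: contract_def One_fract_def)
  moreover have "x \<in> contract q \<or> y \<in> contract q" if "x \<in> A" "y \<in> A" "x * y \<in> contract q" for x y
    using that is_primeD(3)[OF q, of "emb x" "emb y"] emb_in_localize[of _ A]
    by (auto simp: contract_def)
  ultimately show "is_prime A (contract q)" by (simp add: is_prime_def)
  show "contract q \<subseteq> p"
  proof
    fix a assume a: "a \<in> contract q"
    show "a \<in> p"
    proof (rule ccontr)
      assume "a \<notin> p"
      with a have "a \<in> A - p" "emb a \<in> q" by (auto simp: contract_def)
      then have "Fract a a \<in> q" using Fract_in_iff[OF I] by auto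
      moreover have "Fract a a = 1"
        using denom_nonzero[OF \<open>a \<in> A - p\<close>] by (simp add: One_fract_def eq_fract)
      ultimately show False using is_primeD(2)[OF q] by simp
    qed
  qed
qed

lemma contract_strict_mono:
  assumes "is_prime S q" "is_prime S q'" "q \<subset> q'"
  shows "contract q \<subset> contract q'"
proof -
  obtain x where x: "x \<in> q'" "x \<notin> q" using assms(3) by auto
  then have "x \<in> S" using is_idealD(1)[OF is_primeD(1)[OF assms(2)]] by auto
  then obtain a b where ab: "x = Fract a b" "a \<in> A" "b \<in> A - p" by (rule localizeE)
  then have "a \<in> contract q'" "a \<notin> contract q"
    using x Fract_in_iff[OF is_primeD(1)[OF assms(1)] ab(2,3)] Fract_in_iff[OF is_primeD(1)[OF assms(2)] ab(2,3)]
    by (auto simp: contract_def)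
  then show ?thesis using assms(3) by (auto simp: contract_def)
qed

lemma krull_dim_ge:
  assumes "\<And>i. i \<le> r \<Longrightarrow> is_prime A (P i) \<and> P i \<subseteq> p" "\<And>i. i < r \<Longrightarrow> P i \<subset> P (Suc i)"
  shows "enat r \<le> krull_dim (ring_on S)"
proof -
  have mono: "i < j \<Longrightarrow> j \<le> r \<Longrightarrow> P i \<subset> P j" for i j
  proof (induction j)
    case (Suc j)
    then show ?case using assms(2)[of j] by (cases "i = j") auto
  qed simp
  have "map (\<lambda>i. localize A p (P i)) [0..<Suc r] \<in> prime_chains (ring_on S)"
    unfolding prime_chains_def primeideal_ring_on_iff[OF is_subring_S]
  proof (intro CollectI conjI)
    show "\<forall>q\<in>set (map (\<lambda>i. localize A p (P i)) [0..<Suc r]). is_prime S q"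
      using assms(1) is_prime_localize by (auto simp: less_Suc_eq_le)
    show "sorted_wrt (\<subset>) (map (\<lambda>i. localize A p (P i)) [0..<Suc r])"
      unfolding sorted_wrt_iff_nth_less
    proof (intro allI impI)
      fix i j assume "i < j" "j < length (map (\<lambda>i. localize A p (P i)) [0..<Suc r])"
      then have ij: "i < j" "j \<le> r" by auto
      then show "map (\<lambda>i. localize A p (P i)) [0..<Suc r] ! i \<subset> map (\<lambda>i. localize A p (P i)) [0..<Suc r] ! j"
        using localize_strict_mono[of "P i" "P j"] assms(1)[of i] assms(1)[of j] mono[OF ij]
        by (simp del: upt_Suc)
    qed
  qed simp
  then show ?thesis unfolding krull_dim_def
    by (rule SUP_upper2) simp
qed

text \<open>Chains in the localization contract to chains of primes below \<open>p\<close> in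
  \<open>A\<close>. Contraction stays strict because every fraction generates the same ideal as its
  numerator.\<close>

lemma krull_dim_le:
  assumes "\<And>r P. (\<And>i. i \<le> r \<Longrightarrow> is_prime A (P i) \<and> P i \<subseteq> p) \<Longrightarrow> (\<And>i. i < r \<Longrightarrow> P i \<subset> P (Suc i)) \<Longrightarrow> r \<le> h"
  shows "krull_dim (ring_on S) \<le> enat h"
  unfolding krull_dim_def
proof (rule SUP_least)
  fix qs assume "qs \<in> prime_chains (ring_on S)"
  then have qs: "qs \<noteq> []" "\<And>q. q \<in> set qs \<Longrightarrow> is_prime S q" "sorted_wrt (\<subset>) qs"
    by (auto simp: prime_chains_def primeideal_ring_on_iff[OF is_subring_S])
  have "length qs - 1 \<le> h"
  proof (rule assms[of _ "\<lambda>i. contract (qs ! i)"])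
    fix i assume "i \<le> length qs - 1"
    then have "i < length qs" using qs(1) by (cases qs) auto
    then show "is_prime A (contract (qs ! i)) \<and> contract (qs ! i) \<subseteq> p"
      using is_prime_contract qs(2) by auto
  next
    fix i assume "i < length qs - 1"
    then show "contract (qs ! i) \<subset> contract (qs ! Suc i)"
      using qs(2,3) by (intro contract_strict_mono) (auto simp: sorted_wrt_iff_nth_less)
  qed
  then show "enat (length qs - 1) \<le> enat h" by simp
qed

lemma common_denominator:
  assumes "finite M" "\<And>m. m \<in> M \<Longrightarrow> x m \<in> S"
  shows "\<exists>d\<in>A - p. \<exists>c. \<forall>m\<in>M. c m \<in> A \<and> x m = Fract (c m) d"
  using assms
proof (induction M rule: finite_induct)
  case empty
  then show ?case using one_denom by auto
next
  case (insert k M)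
  then obtain d c where d: "d \<in> A - p" and c: "\<And>m. m \<in> M \<Longrightarrow> c m \<in> A \<and> x m = Fract (c m) d"
    by auto
  obtain a b where ab: "x k = Fract a b" "a \<in> A" "b \<in> A - p"
    using insert.prems[of k] by (auto elim: localizeE)
  have "\<forall>m\<in>insert k M. (if m = k then a * d else c m * b) \<in> A \<and>
      x m = Fract (if m = k then a * d else c m * b) (d * b)"
    using d ab c denom_nonzero is_subringD(4)[OF A] by (auto simp: eq_fract)
  then show ?case
    by (intro bexI[OF _ denom_mult[OF d ab(3)]] exI[of _ "\<lambda>m. if m = k then a * d else c m * b"])
qed

text \<open>Equality of two fractions is a cross product identity in \<open>I\<close>, and
  \<open>\<phi>\<close> turns it into the identity for the images, so the choice of a representative
  does not matter. With \<open>I = A\<close> the lemma extends the ring homomorphism, with the star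
  ideal it extends the functionals.\<close>

lemma localize_extend:
  fixes \<pi> \<phi> :: "'a \<Rightarrow> 'd::idom"
  assumes I: "is_ideal A I" and nz: "\<And>b. b \<in> A - p \<Longrightarrow> \<pi> b \<noteq> 0"
    and \<phi>: "\<And>r x. r \<in> A \<Longrightarrow> x \<in> I \<Longrightarrow> \<phi> (r * x) = \<pi> r * \<phi> x"
  obtains \<Phi> where "\<And>a b. a \<in> I \<Longrightarrow> b \<in> A - p \<Longrightarrow> \<Phi> (Fract a b) = Fract (\<phi> a) (\<pi> b)"
proof -
  define ok where "ok x ab \<longleftrightarrow> x = Fract (fst ab) (snd ab) \<and> fst ab \<in> I \<and> snd ab \<in> A - p" for x ab
  define \<Phi> where "\<Phi> x = (let ab = SOME ab. ok x ab in Fract (\<phi> (fst ab)) (\<pi> (snd ab)))" for x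
  show thesis
  proof (rule that)
    fix a b assume ab: "a \<in> I" "b \<in> A - p"
    obtain c d where cd: "(SOME ab. ok (Fract a b) ab) = (c, d)" by fastforce
    have some: "ok (Fract a b) (SOME ab. ok (Fract a b) ab)"
      by (rule someI[of _ "(a, b)"]) (use ab in \<open>simp add: ok_def\<close>)
    have ok: "Fract a b = Fract c d" "c \<in> I" "d \<in> A - p"
      using some[unfolded cd] by (auto simp: ok_def)
    then have "d * a = b * c" using ab denom_nonzero by (simp add: eq_fract ac_simps)
    then have "\<pi> d * \<phi> a = \<pi> b * \<phi> c" using \<phi>[of d a] \<phi>[of b c] ab ok by auto
    then show "\<Phi> (Fract a b) = Fract (\<phi> a) (\<pi> b)"
      using nz[OF ab(2)] nz[OF ok(3)] by (simp add: \<Phi>_def cd eq_fract ac_simps)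
  qed
qed

end

section \<open>The Rees kernel\<close>

definition total_deg :: "(nat \<Rightarrow>\<^sub>0 nat) \<Rightarrow> nat" where
  "total_deg m = (\<Sum>i\<in>keys m. lookup m i)"

lemma total_deg_superset: "finite Z \<Longrightarrow> keys m \<subseteq> Z \<Longrightarrow> total_deg m = (\<Sum>i\<in>Z. lookup m i)"
  unfolding total_deg_def by (rule sum.mono_neutral_left) (auto simp: in_keys_iff)

lemma total_deg_add: "total_deg (m + m') = total_deg m + total_deg m'"
  using total_deg_superset[of "keys m \<union> keys m'"]
  by (simp add: keys_add_nat lookup_add sum.distrib)

lemma total_deg_single [simp]: "total_deg (single i k) = k"
  by (auto simp: total_deg_def)

lemma ring_hom_const_poly: "ring_hom_on UNIV (\<lambda>c. [:c:])"
  by (auto simp: ring_hom_on_def one_pCons)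

lemma rees_map_eq_ev:
  assumes "f \<in> mpolys S (length gs)"
  shows "rees_map gs f = ev (\<lambda>c. [:c:]) (\<lambda>i. monom (gs ! i) 1) f"
proof -
  have "(\<Prod>i<length gs. monom (gs ! i) 1 ^ lookup m i) = monom_eval (\<lambda>i. monom (gs ! i) 1) m"
    if "m \<in> keys f" for m
    using mpolysD[OF assms that] by (intro monom_eval_superset[symmetric]) auto
  then show ?thesis unfolding rees_map_def ev_def by (intro sum.cong) auto
qed

lemma monom_eval_monom: "monom_eval (\<lambda>i. monom (g i) 1) m = monom (monom_eval g m) (total_deg m)"
proof -
  have "(\<Prod>i\<in>Z. monom (g i) 1 ^ k i) = monom (\<Prod>i\<in>Z. g i ^ k i) (\<Sum>i\<in>Z. k i)" for Z :: "nat set" and k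
    by (induction Z rule: infinite_finite_induct) (auto simp: monom_power mult_monom)
  then show ?thesis by (simp add: monom_eval_def total_deg_def)
qed

text \<open>The Rees map is graded by total degree, so the kernel is described degree by degree by
  relations among products of the generators.\<close>

lemma coeff_rees_map:
  assumes "f \<in> mpolys S (length gs)"
  shows "poly.coeff (rees_map gs f) N =
    (\<Sum>m\<in>{m\<in>keys f. total_deg m = N}. lookup f m * monom_eval ((!) gs) m)"
proof -
  have "poly.coeff (rees_map gs f) N =
      (\<Sum>m\<in>keys f. if total_deg m = N then lookup f m * monom_eval ((!) gs) m else 0)"
    unfolding rees_map_eq_ev[OF assms] ev_def monom_eval_monom coeff_sum
    by (intro sum.cong) (auto simp: coeff_monom)
  then show ?thesis by (simp add: sum.inter_filter)
qed

lemma rees_kernel_eq: "rees_kernel S gs = {f \<in> mpolys S (length gs). rees_map gs f = 0}"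
  by (simp add: rees_kernel_def a_kernel_def')

lemma is_ideal_rees_kernel:
  assumes S: "is_subring S"
  shows "is_ideal (mpolys S (length gs)) (rees_kernel S gs)"
proof -
  have R: "is_subring (mpolys S (length gs))" by (rule is_subring_mpolys[OF S])
  note hom = ring_hom_onD[OF ring_hom_ev[OF ring_hom_const_poly], simplified]
  show ?thesis
    using is_subringD[OF R] unfolding is_ideal_def rees_kernel_eq
    by (auto simp: rees_map_eq_ev[of _ S] hom)
qed

lemma linear_typeI:
  assumes S: "is_subring S" and gs: "set gs \<subseteq> S" and I: "I = span_ideal S (set gs)"
    and L: "L \<subseteq> rees_kernel S gs" "\<And>f. f \<in> L \<Longrightarrow> homogeneous 1 f"
    and K: "rees_kernel S gs \<subseteq> span_ideal (mpolys S (length gs)) L"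
  shows "linear_type S I"
  unfolding linear_type_def genideal_ring_on[OF S] genideal_ring_on[OF is_subring_mpolys[OF S]]
proof (intro exI conjI ballI)
  show "rees_kernel S gs = span_ideal (mpolys S (length gs)) L"
    using K span_ideal_least[OF is_ideal_rees_kernel[OF S] L(1)] by blast
qed (use assms in auto)

text \<open>With one generator there is one monomial in each degree. In a domain its coefficient
  must vanish, so the kernel is zero and the empty set of relations generates it.\<close>

lemma linear_type_principal:
  fixes S :: "'a::idom set"
  assumes S: "is_subring S" and g: "g \<in> S" "g \<noteq> 0"
  shows "linear_type S (span_ideal S {g})"
proof (rule linear_typeI[OF S, of "[g]" _ "{}"])
  show "rees_kernel S [g] \<subseteq> span_ideal (mpolys S (length [g])) {}"
  proof
    fix f assume "f \<in> rees_kernel S [g]"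
    then have f: "f \<in> mpolys S (length [g])" "rees_map [g] f = 0" by (auto simp: rees_kernel_eq)
    have "lookup f m = 0" for m
    proof (cases "m \<in> keys f")
      case True
      have m: "m' = single 0 (total_deg m')" if "m' \<in> keys f" for m'
      proof (rule poly_mapping_eqI)
        fix k show "lookup m' k = lookup (single 0 (total_deg m')) k"
        proof (cases "k = 0")
          case True
          have "total_deg m' = (\<Sum>i\<in>{0}. lookup m' i)"
            using mpolysD[OF f(1) that] by (intro total_deg_superset) auto
          then show ?thesis using True by (simp del: One_nat_def)
        next
          case False
          then have "k \<notin> keys m'" using mpolysD[OF f(1) that] by auto
          with False show ?thesis by (simp add: lookup_single_not_eq in_keys_iff)
        qed
      qed
      have "{m' \<in> keys f. total_deg m' = total_deg m} = {m}"
      proof -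
        have "m' = m" if "m' \<in> keys f" "total_deg m' = total_deg m" for m'
          using m[OF that(1)] m[OF True] that(2) by simp
        then show ?thesis using True by auto
      qed
      then have "lookup f m * monom_eval ((!) [g]) m = 0"
        using coeff_rees_map[OF f(1), of "total_deg m"] f(2) by simp
      moreover have "monom_eval ((!) [g]) m = g ^ total_deg m"
        by (subst m[OF True]) simp
      ultimately show ?thesis using g by simp
    qed (simp add: in_keys_iff)
    then have "f = 0" by (intro poly_mapping_eqI) simp
    then show "f \<in> span_ideal (mpolys S (length [g])) {}"
      using span_ideal_empty[OF is_subring_mpolys[OF S]] by simp
  qed
qed (use g in auto)

text \<open>Modulo \<open>J\<close> all \<open>w x\<close> of a fibre of \<open>\<theta>\<close> may
  be replaced by a single one, whose coefficient is the sum of the \<open>k x\<close> and vanishes.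
  Membership in \<open>J\<close> is thereby reduced to congruences between single terms.\<close>

lemma fibre_sum_in_ideal:
  assumes R: "is_subring R" and J: "is_ideal R J" and \<kappa>: "ring_hom_on UNIV \<kappa>" "range \<kappa> \<subseteq> R"
    and P: "finite P" and w: "\<And>x. x \<in> P \<Longrightarrow> w x \<in> R"
    and k: "\<And>t. t \<in> \<theta> ` P \<Longrightarrow> (\<Sum>x\<in>{x \<in> P. \<theta> x = t}. k x) = 0"
    and c: "\<And>x y. x \<in> P \<Longrightarrow> y \<in> P \<Longrightarrow> \<theta> x = \<theta> y \<Longrightarrow> w x - w y \<in> J"
  shows "(\<Sum>x\<in>P. \<kappa> (k x) * w x) \<in> J"
proof -
  have "(\<Sum>x\<in>{x \<in> P. \<theta> x = t}. \<kappa> (k x) * w x) \<in> J" if "t \<in> \<theta> ` P" for t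
  proof -
    from that obtain y where y: "y \<in> P" "\<theta> y = t" by auto
    have "(\<Sum>x\<in>{x \<in> P. \<theta> x = t}. \<kappa> (k x) * (w x - w y)) \<in> J"
      using c[OF _ y(1)] y \<kappa>(2) by (intro is_ideal_sum[OF J] is_idealD(4)[OF J]) auto
    moreover have "(\<Sum>x\<in>{x \<in> P. \<theta> x = t}. \<kappa> (k x) * w y) = \<kappa> (\<Sum>x\<in>{x \<in> P. \<theta> x = t}. k x) * w y"
      by (simp add: ring_hom_on_sum[OF \<kappa>(1)] sum_distrib_right)
    ultimately show ?thesis
      using k[OF that] ring_hom_onD(2)[OF \<kappa>(1)] by (simp add: right_diff_distrib sum_subtractf)
  qed
  then have "(\<Sum>t\<in>\<theta> ` P. \<Sum>x\<in>{x \<in> P. \<theta> x = t}. \<kappa> (k x) * w x) \<in> J"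
    by (rule is_ideal_sum[OF J])
  then show ?thesis by (simp add: sum.image_gen[OF P, of _ \<theta>, symmetric])
qed

lemma keys_diff_nat: "keys (m - m' :: nat \<Rightarrow>\<^sub>0 nat) \<subseteq> keys m"
  by (auto simp: in_keys_iff lookup_minus)

lemma diff_single_add: "0 < lookup m i \<Longrightarrow> (m - single i 1) + single i 1 = (m :: nat \<Rightarrow>\<^sub>0 nat)"
  by (rule poly_mapping_eqI) (auto simp: lookup_add lookup_minus lookup_single when_def)

text \<open>The step hypothesis moves \<open>m\<close> one unit closer to \<open>k\<close>.\<close>

lemma monomial_congruence:
  fixes W :: "(nat \<Rightarrow>\<^sub>0 nat) \<Rightarrow> (nat \<Rightarrow>\<^sub>0 nat) \<Rightarrow> 'r::comm_ring_1"
  assumes J: "is_ideal R J"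
    and step: "\<And>a b m k i j. \<lbrakk>keys a \<subseteq> {..<n}; keys m \<subseteq> {..<t}; keys k \<subseteq> {..<t}; a + \<Gamma> m = b + \<Gamma> k;
      total_deg m = total_deg k; i < t; j < t; lookup m i > lookup k i; lookup m j < lookup k j\<rbrakk> \<Longrightarrow>
      \<exists>a'. keys a' \<subseteq> {..<n} \<and> a' + \<Gamma> (m - single i 1 + single j 1) = a + \<Gamma> m \<and>
        W a m - W a' (m - single i 1 + single j 1) \<in> J"
    and "keys a \<subseteq> {..<n}" "keys m \<subseteq> {..<t}" "keys k \<subseteq> {..<t}" "a + \<Gamma> m = b + \<Gamma> k"
      "total_deg m = total_deg k"
  shows "W a m - W b k \<in> J"
  using assms(3-7)
\<comment> \<open>The measure is the total excess of \<open>m\<close> over \<open>k\<close>, with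
  truncated subtraction. When it vanishes, equality of degrees forces \<open>m = k\<close>, and then
  \<open>a = b\<close> by cancellation.\<close>
proof (induction "\<Sum>l<t. lookup m l - lookup k l" arbitrary: a m)
  case 0
  then have le: "lookup m l \<le> lookup k l" if "l < t" for l using that by auto
  have "(\<Sum>l<t. lookup m l) = (\<Sum>l<t. lookup k l)"
    using 0 total_deg_superset[of "{..<t}"] by simp
  then have "lookup m l = lookup k l" if "l < t" for l
    using sum_mono_inv[of "lookup m" "{..<t}" "lookup k" l] le that by auto
  moreover have "lookup m l = 0" "lookup k l = 0" if "\<not> l < t" for l
    using 0 that by (auto simp: in_keys_iff subset_eq)
  ultimately have mk: "m = k" by (intro poly_mapping_eqI) metis
  then have "a = b" using 0 by simp
  then show ?case using mk is_idealD(2)[OF J] by simp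
next
  case (Suc d)
  have s: "(\<Sum>l<t. lookup m l) = (\<Sum>l<t. lookup k l)"
    using Suc.prems total_deg_superset[of "{..<t}"] by simp
  have "\<exists>i<t. lookup m i - lookup k i \<noteq> 0"
  proof (rule ccontr)
    assume "\<not> ?thesis"
    then have "(\<Sum>l<t. lookup m l - lookup k l) = 0" by auto
    then show False using Suc.hyps(2) by simp
  qed
  then obtain i where i: "i < t" "lookup m i > lookup k i" by force
  \<comment> \<open>The degrees agree, so an excess at \<open>i\<close> is compensated by a deficit
    at some \<open>j\<close>.\<close>
  have "\<exists>j<t. lookup m j < lookup k j"
  proof (rule ccontr)
    assume "\<not> ?thesis"
    then have "\<And>l. l < t \<Longrightarrow> lookup k l \<le> lookup m l" by force
    then have "(\<Sum>l<t. lookup k l) < (\<Sum>l<t. lookup m l)"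
      using i by (intro sum_strict_mono_ex1) auto
    then show False using s by simp
  qed
  then obtain j where j: "j < t" "lookup m j < lookup k j" by blast
  define m' where "m' = m - single i 1 + single j 1"
  obtain a' where a': "keys a' \<subseteq> {..<n}" "a' + \<Gamma> m' = a + \<Gamma> m" "W a m - W a' m' \<in> J"
    using step[OF Suc.prems i(1) j(1) i(2) j(2)] unfolding m'_def by blast
  have ij: "i \<noteq> j" using i j by auto
  have lm': "lookup m' l = (if l = i then lookup m i - 1 else if l = j then lookup m j + 1 else lookup m l)" for l
    using ij by (auto simp: m'_def lookup_add lookup_minus lookup_single when_def)
  have m: "m - single i 1 + single i 1 = m" using i by (intro diff_single_add) simp
  have "total_deg (m - single i 1 + single i 1) = total_deg m'"
    by (simp add: m'_def total_deg_add)
  then have td: "total_deg m' = total_deg m" by (simp only: m)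
  have "keys m' \<subseteq> {..<t}"
    using Suc.prems(2) j(1) keys_diff_nat[of m "single i 1"] by (auto simp: m'_def keys_add_nat split: if_splits)
  moreover have "d = (\<Sum>l<t. lookup m' l - lookup k l)"
  proof -
    have "(\<Sum>l<t. lookup m l - lookup k l) = Suc (\<Sum>l<t. lookup m' l - lookup k l)"
    proof -
      have "(\<Sum>l\<in>{..<t} - {i}. lookup m l - lookup k l) = (\<Sum>l\<in>{..<t} - {i}. lookup m' l - lookup k l)"
        using j by (intro sum.cong) (auto simp: lm')
      moreover have "lookup m i - lookup k i = Suc (lookup m' i - lookup k i)"
        using i by (simp add: lm')
      ultimately show ?thesis
        using i(1) sum.remove[of "{..<t}" i "\<lambda>l. lookup m l - lookup k l"]
          sum.remove[of "{..<t}" i "\<lambda>l. lookup m' l - lookup k l"] by simp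
    qed
    then show ?thesis using Suc.hyps(2) by simp
  qed
  ultimately have "W a' m' - W b k \<in> J"
    using Suc.hyps(1)[of m' a'] a' td Suc.prems by auto
  then have "(W a m - W a' m') + (W a' m' - W b k) \<in> J" by (intro is_idealD(3)[OF J] a')
  then show ?case by simp
qed

section \<open>Monomial generators\<close>

lemma single_eq_mconst_mult: "single m c = mconst c * single m 1"
  by (simp add: mconst_def mult_single)

lemma prod_mvar_power:
  "(\<Prod>j\<in>Z. mvar (g j) ^ k j) = (single (\<Sum>j\<in>Z. single (g j) (k j)) 1 :: 'a::comm_ring_1 mpoly)"
proof -
  have p: "mvar i ^ k = (single (single i k) 1 :: 'a mpoly)" for i k
    using monom_eval_mvar[of "single i k"] by simp
  show ?thesis
    by (induction Z rule: infinite_finite_induct) (auto simp: p mult_single)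
qed

lemma lookup_mult_single:
  "lookup (q * single g 1) b = (\<Sum>a\<in>keys q. if a + g = b then lookup q a else 0)"
  for q :: "'a::comm_ring_1 mpoly"
  using mpoly_mult_expand[of q "single g 1"]
  by (auto simp: lookup_sum lookup_single when_def intro!: sum.cong)

lemma monom_eval_hom:
  "ring_hom_on UNIV h \<Longrightarrow> h (monom_eval \<sigma> m) = monom_eval (\<lambda>i. h (\<sigma> i)) m"
  by (simp add: monom_eval_def ring_hom_on_prod ring_hom_on_power)

lemma ring_hom_comp:
  "ring_hom_on UNIV g \<Longrightarrow> ring_hom_on UNIV f \<Longrightarrow> ring_hom_on UNIV (\<lambda>x. g (f x))"
  by (simp add: ring_hom_on_def)

text \<open>\<open>W \<sigma> a m\<close> is the monomial of exponent \<open>a\<close> in the new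
  coordinates times the monomial \<open>m\<close> in the Rees variables. As the generators are
  monomials in these coordinates, the Rees map sends such terms to monomials, and a kernel element
  has vanishing coefficient sum over all terms with the same image. So the kernel is spanned by
  differences of terms with equal images.\<close>

lemma rees_kernel_monomial:
  fixes p :: "'k::field mpoly set" and es :: "'k mpoly list" and n :: nat
  defines "S \<equiv> localize (polys n) p (polys n)" and "\<mu> \<equiv> length es"
  defines "W \<equiv> \<lambda>\<sigma> a m. single m (emb (msubst \<sigma> (single a 1)))"
  assumes p: "is_prime (polys n) p" and auto: "linear_auto n \<sigma> \<tau>" and es: "set es \<subseteq> polys n"
    and \<Gamma>: "\<And>m. keys m \<subseteq> {..<\<mu>} \<Longrightarrow> msubst \<tau> (monom_eval ((!) es) m) = single (\<Gamma> m) 1"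
    and J: "is_ideal (mpolys S \<mu>) J"
    and cong: "\<And>a m b k. \<lbrakk>keys a \<subseteq> {..<n}; keys b \<subseteq> {..<n}; keys m \<subseteq> {..<\<mu>}; keys k \<subseteq> {..<\<mu>};
      a + \<Gamma> m = b + \<Gamma> k; total_deg m = total_deg k\<rbrakk> \<Longrightarrow> W \<sigma> a m - W \<sigma> b k \<in> J"
  shows "rees_kernel S (map emb es) \<subseteq> J"
proof
  interpret localization "polys n" p
    by unfold_locales (use p in auto)
  note S = is_subring_S[folded S_def]
  have SX: "is_subring (mpolys S \<mu>)" by (rule is_subring_mpolys[OF S])
  fix f assume "f \<in> rees_kernel S (map emb es)"
  then have f: "f \<in> mpolys S \<mu>" "rees_map (map emb es) f = 0" by (auto simp: rees_kernel_eq \<mu>_def)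
  define M where "M = keys f"
  have M: "finite M" "\<And>m. m \<in> M \<Longrightarrow> keys m \<subseteq> {..<\<mu>}" "\<And>m. m \<in> M \<Longrightarrow> lookup f m \<in> S"
    using f(1) by (auto simp: mpolys_def M_def)
  \<comment> \<open>Clearing denominators reduces to coefficients in the polynomial ring, where the
    coordinate change can be applied.\<close>
  obtain d c where d: "d \<in> polys n - p" and c: "\<And>m. m \<in> M \<Longrightarrow> c m \<in> polys n \<and> lookup f m = Fract (c m) d"
    using common_denominator[of M "lookup f"] M(1,3) unfolding S_def by blast
  define h where "h = (\<Sum>m\<in>M. single m (emb (c m)))"
  have "single m (lookup f m) = mconst (Fract 1 d) * single m (emb (c m))" if "m \<in> M" for m
    using c[OF that] by (simp add: mconst_def mult_single)
  then have fh: "f = mconst (Fract 1 d) * h"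
    by (subst mpoly_expand[of f]) (simp add: h_def sum_distrib_left M_def)
  have rel: "(\<Sum>m\<in>{m\<in>M. total_deg m = N}. c m * monom_eval ((!) es) m) = 0" for N
  proof -
    have e: "monom_eval ((!) (map emb es)) m = emb (monom_eval ((!) es) m)" if "m \<in> M" for m
    proof -
      have "monom_eval ((!) (map emb es)) m = monom_eval (\<lambda>i. emb (es ! i)) m"
        using M(2)[OF that] by (intro monom_eval_cong) (auto simp: \<mu>_def)
      then show ?thesis by (simp only: monom_eval_hom[OF ring_hom_emb])
    qed
    have "0 = (\<Sum>m\<in>{m\<in>M. total_deg m = N}. lookup f m * monom_eval ((!) (map emb es)) m)"
      using coeff_rees_map[of f S "map emb es" N] f by (simp add: \<mu>_def M_def)
    also have "\<dots> = (\<Sum>m\<in>{m\<in>M. total_deg m = N}. Fract 1 d * emb (c m * monom_eval ((!) es) m))"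
    proof (intro sum.cong refl)
      fix m assume "m \<in> {m\<in>M. total_deg m = N}"
      then have m: "m \<in> M" by simp
      show "lookup f m * monom_eval ((!) (map emb es)) m = Fract 1 d * emb (c m * monom_eval ((!) es) m)"
        unfolding e[OF m] using c[OF m] by simp
    qed
    also have "\<dots> = Fract 1 d * emb (\<Sum>m\<in>{m\<in>M. total_deg m = N}. c m * monom_eval ((!) es) m)"
      by (simp only: ring_hom_on_sum[OF ring_hom_emb] sum_distrib_left UNIV_I)
    also have "\<dots> = Fract (\<Sum>m\<in>{m\<in>M. total_deg m = N}. c m * monom_eval ((!) es) m) d" by simp
    finally show ?thesis using denom_nonzero[OF d] by (simp add: Zero_fract_def eq_fract)
  qed
  note hom\<tau> = ring_hom_msubst[of \<tau>]
  define q where "q m = msubst \<tau> (c m)" for m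
  have q: "q m \<in> polys n" if "m \<in> M" for m
    unfolding q_def using c[OF that] linear_autoD(6)[OF auto] by blast
  have rel\<tau>: "(\<Sum>m\<in>{m\<in>M. total_deg m = N}. q m * single (\<Gamma> m) 1) = 0" for N
  proof -
    have "(\<Sum>m\<in>{m\<in>M. total_deg m = N}. q m * single (\<Gamma> m) 1) =
        msubst \<tau> (\<Sum>m\<in>{m\<in>M. total_deg m = N}. c m * monom_eval ((!) es) m)"
      using M(2) by (simp add: ring_hom_on_sum[OF hom\<tau>] ring_hom_onD(5)[OF hom\<tau>] q_def \<Gamma>)
    then show ?thesis unfolding rel by (simp add: ring_hom_onD(2)[OF hom\<tau>])
  qed
  \<comment> \<open>\<open>P\<close> lists the terms after expanding each coefficient in the new
    coordinates, \<open>k\<close> gives their scalars, and \<open>\<theta>\<close> records the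
    image: its exponent and its degree in the Rees algebra.\<close>
  define P where "P = Sigma M (\<lambda>m. keys (q m))"
  define k where "k = (\<lambda>(m, a). lookup (q m) a)"
  define \<theta> where "\<theta> = (\<lambda>(m, a). (a + \<Gamma> m, total_deg m))"
  define w where "w = (\<lambda>(m, a). W \<sigma> a m)"
  \<comment> \<open>Scalars of the ground field, seen as constants over the localization; they are
    the only coefficients left after the expansion.\<close>
  define \<kappa> where "\<kappa> c = mconst (emb (mconst c))" for c :: 'k
  have hom\<kappa>: "ring_hom_on UNIV \<kappa>"
    unfolding \<kappa>_def by (intro ring_hom_comp[OF ring_hom_mconst] ring_hom_comp[OF ring_hom_emb] ring_hom_mconst)
  have emb_S: "emb a \<in> S" if "a \<in> polys n" for a
    using that emb_in_localize[of a "polys n"] by (simp add: S_def)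
  have h: "h = (\<Sum>x\<in>P. \<kappa> (k x) * w x)"
  proof -
    have "single m (emb (c m)) = (\<Sum>a\<in>keys (q m). \<kappa> (lookup (q m) a) * W \<sigma> a m)" if "m \<in> M" for m
    proof -
      have "c m = msubst \<sigma> (q m)" by (simp add: q_def linear_autoD(3)[OF auto])
      also have "\<dots> = msubst \<sigma> (\<Sum>a\<in>keys (q m). mconst (lookup (q m) a) * single a 1)"
        by (subst mpoly_expand[of "q m"]) (simp flip: single_eq_mconst_mult)
      also have "\<dots> = (\<Sum>a\<in>keys (q m). mconst (lookup (q m) a) * msubst \<sigma> (single a 1))"
        by (simp add: ring_hom_on_sum[OF ring_hom_msubst] ring_hom_onD(5)[OF ring_hom_msubst])
      finally have "emb (c m) = (\<Sum>a\<in>keys (q m). emb (mconst (lookup (q m) a)) * emb (msubst \<sigma> (single a 1)))"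
        by (simp add: ring_hom_on_sum[OF ring_hom_emb])
      then have "mconst (emb (c m)) =
          (\<Sum>a\<in>keys (q m). \<kappa> (lookup (q m) a) * mconst (emb (msubst \<sigma> (single a 1))))"
        by (simp only: ring_hom_on_sum[OF ring_hom_mconst] ring_hom_onD(5)[OF ring_hom_mconst] \<kappa>_def UNIV_I)
      then have "mconst (emb (c m)) * single m 1 = (\<Sum>a\<in>keys (q m). \<kappa> (lookup (q m) a) * W \<sigma> a m)"
        by (simp only: sum_distrib_right W_def mult.assoc single_eq_mconst_mult[of m, symmetric])
      then show ?thesis by (simp only: single_eq_mconst_mult[of m, symmetric])
    qed
    then have "h = (\<Sum>m\<in>M. \<Sum>a\<in>keys (q m). \<kappa> (lookup (q m) a) * W \<sigma> a m)"
      unfolding h_def by (intro sum.cong) auto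
    also have "\<dots> = (\<Sum>x\<in>P. \<kappa> (k x) * w x)"
      unfolding P_def by (subst sum.Sigma) (auto simp: M(1) k_def w_def intro!: sum.cong)
    finally show ?thesis .
  qed
  have keysq: "keys a \<subseteq> {..<n}" if "m \<in> M" "a \<in> keys (q m)" for m a
    using mpolysD[OF q[OF that(1)] that(2)] .
  have "(\<Sum>x\<in>P. \<kappa> (k x) * w x) \<in> J"
  proof (rule fibre_sum_in_ideal[OF SX J hom\<kappa>, where \<theta> = \<theta>])
    show "range \<kappa> \<subseteq> mpolys S \<mu>" by (auto simp: \<kappa>_def intro!: mconst_in_mpolys[OF S] emb_S)
    show "finite P" by (simp add: P_def M(1))
    show "w x \<in> mpolys S \<mu>" if "x \<in> P" for x
    proof -
      have "single a 1 \<in> polys n" if "m \<in> M" "a \<in> keys (q m)" for m a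
        using keysq[OF that] by (intro single_in_mpolys) auto
      then show ?thesis using that M(2)
        by (auto simp: w_def W_def P_def intro!: single_in_mpolys[OF S] emb_S linear_autoD(5)[OF auto])
    qed
    show "w x - w y \<in> J" if "x \<in> P" "y \<in> P" "\<theta> x = \<theta> y" for x y
    proof -
      obtain m a m' a' where xy: "x = (m, a)" "y = (m', a')" by fastforce
      have m: "m \<in> M" "a \<in> keys (q m)" and m': "m' \<in> M" "a' \<in> keys (q m')"
        using that by (auto simp: xy P_def)
      show ?thesis
        using that(3) cong[OF keysq[OF m] keysq[OF m'] M(2)[OF m(1)] M(2)[OF m'(1)]]
        by (simp add: xy w_def \<theta>_def)
    qed
    fix t assume "t \<in> \<theta> ` P"
    obtain b N where t: "t = (b, N)" by fastforce
    \<comment> \<open>The sum over the fibre of \<open>(b, N)\<close> is the coefficient at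
      \<open>b\<close> in the degree \<open>N\<close> relation.\<close>
    have "(\<Sum>x\<in>{x \<in> P. \<theta> x = t}. k x) = (\<Sum>x\<in>P. if \<theta> x = t then k x else 0)"
      by (simp add: sum.inter_filter P_def M(1))
    also have "\<dots> = (\<Sum>m\<in>M. \<Sum>a\<in>keys (q m). if a + \<Gamma> m = b \<and> total_deg m = N then lookup (q m) a else 0)"
      unfolding P_def by (subst sum.Sigma) (auto simp: M(1) \<theta>_def t k_def intro!: sum.cong)
    also have "\<dots> = (\<Sum>m\<in>M. if total_deg m = N then lookup (q m * single (\<Gamma> m) 1) b else 0)"
      by (intro sum.cong) (auto simp: lookup_mult_single)
    also have "\<dots> = lookup (\<Sum>m\<in>{m\<in>M. total_deg m = N}. q m * single (\<Gamma> m) 1) b"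
      unfolding sum.inter_filter[OF M(1)] lookup_sum by (intro sum.cong) auto
    finally show "(\<Sum>x\<in>{x \<in> P. \<theta> x = t}. k x) = 0" by (simp add: rel\<tau>)
  qed
  then have "h \<in> J" by (simp add: h)
  then show "f \<in> J" unfolding fh
    using inverse_in_S[OF d] by (intro is_idealD(4)[OF J] mconst_in_mpolys[OF S]) (simp add: S_def)
qed

section \<open>Localizations of star configurations of linear type\<close>

lemma binomial_in_rees_kernel:
  assumes S: "is_subring S" and ij: "i < length gs" "j < length gs" and xy: "x \<in> S" "y \<in> S"
    and eq: "x * gs ! i = y * gs ! j"
  shows "mconst x * mvar i - mconst y * mvar j \<in> rees_kernel S gs"
proof -
  have "is_subring (mpolys S (length gs))" by (rule is_subring_mpolys[OF S])
  then have f: "mconst x * mvar i - mconst y * mvar j \<in> mpolys S (length gs)"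
    using ij xy by (intro is_subringD mconst_in_mpolys mvar_in_mpolys S)
  note hom = ring_hom_onD[OF ring_hom_ev[OF ring_hom_const_poly], simplified]
  have "rees_map gs (mconst x * mvar i - mconst y * mvar j) = monom (x * gs ! i) 1 - monom (y * gs ! j) 1"
    unfolding rees_map_eq_ev[OF f]
    by (simp add: hom ev_mconst[OF ring_hom_const_poly] ev_mvar[OF ring_hom_const_poly] smult_monom)
  then show ?thesis using f eq by (simp add: rees_kernel_eq)
qed

lemma homogeneous_binomial:
  "i < n \<Longrightarrow> j < n \<Longrightarrow> homogeneous 1 (mconst x * mvar i - mconst y * mvar j)"
  using linear_form_diff[OF linear_form_scale[OF linear_form_mvar] linear_form_scale[OF linear_form_mvar], of i n j x y]
  by (simp add: linear_form_def)

locale star_prime = linear_star n c F for n c :: nat and F :: "'k::field mpoly set" +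
  fixes p :: "'k mpoly set"
  assumes prime_p: "is_prime (polys n) p"
begin

sublocale localization "polys n" p
  by unfold_locales (simp_all add: prime_p)

definition Fp :: "'k mpoly set" where "Fp = F \<inter> p"

definition loc_gens :: "'k mpoly set" where
  "loc_gens = (\<lambda>H. \<Prod>(Fp - H)) ` {H. H \<subseteq> Fp \<and> Suc (card H) = c}"

lemma Fp_subset: "Fp \<subseteq> F" "Fp \<subseteq> R" "finite Fp" "Fp \<subseteq> p"
  using F by (auto simp: Fp_def)

lemma loc_gens_R: "loc_gens \<subseteq> R"
  unfolding loc_gens_def using prod_in_R[of "Fp - _"] Fp_subset by auto

lemma unit_prod: "H \<subseteq> F \<Longrightarrow> H \<inter> p = {} \<Longrightarrow> \<Prod>H \<in> R - p"
  using prod_in_R[of H] is_prime_prod[OF prime_p is_subring_polys, of H "\<lambda>x. x"] F(3) by auto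

lemma star_ideal_is_ideal: "is_ideal R (star_ideal n c F)"
  unfolding star_ideal_eq by (rule span_ideal_is_ideal[OF is_subring_polys star_gens_R])

text \<open>A set \<open>H\<close> of \<open>c - 1\<close> forms can contain all of
  \<open>Fp\<close>; the generator omitting it is a product of forms outside \<open>p\<close> and
  becomes a unit.\<close>

lemma localize_star_small:
  assumes "card Fp < c"
  shows "localize R p (star_ideal n c F) = S" "\<not> star_ideal n c F \<subseteq> p"
proof -
  have "card Fp \<le> c - 1" "c - 1 \<le> card F" using assms F(5) by auto
  then obtain H where H: "Fp \<subseteq> H" "H \<subseteq> F" "card H = c - 1"
    using exists_subset_between[OF _ _ Fp_subset(1) F(1)] by blast
  have "\<Prod>(F - H) \<in> star_gens c"
    using H F(4) by (auto simp: star_gens_def)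
  then have u: "\<Prod>(F - H) \<in> star_ideal n c F"
    unfolding star_ideal_eq using span_ideal_superset by blast
  moreover have "\<Prod>(F - H) \<in> R - p" using H by (intro unit_prod) (auto simp: Fp_def)
  ultimately show "localize R p (star_ideal n c F) = S" "\<not> star_ideal n c F \<subseteq> p"
    using localize_eq_S[OF star_ideal_is_ideal] by auto
qed

text \<open>The hypothesis leaves room for a set of \<open>c - 1\<close> forms inside
  \<open>Fp\<close>. For an omitted set \<open>H\<close>, extending \<open>H \<inter> Fp\<close> to
  such an \<open>H'\<close> gives a divisor of the generator belonging to \<open>H\<close>.
  Conversely, if \<open>H\<close> lies in \<open>Fp\<close>, the local and the global generator
  differ by the unit \<open>\<Prod>(F - Fp)\<close>.\<close>

lemma localize_star:
  assumes t: "c \<le> Suc (card Fp)"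
  shows "localize R p (star_ideal n c F) = span_ideal S (emb ` loc_gens)"
proof -
  have GS: "emb ` star_gens c \<subseteq> S" "emb ` loc_gens \<subseteq> S"
    using star_gens_R loc_gens_R emb_in_localize by blast+
  have "span_ideal S (emb ` star_gens c) = span_ideal S (emb ` loc_gens)"
  proof (rule span_ideal_eqI[OF is_subring_S GS])
    show "emb ` star_gens c \<subseteq> span_ideal S (emb ` loc_gens)"
    proof
      fix z assume "z \<in> emb ` star_gens c"
      then obtain H where H: "H \<subseteq> F" "Suc (card H) = c" "z = emb (\<Prod>(F - H))" by (auto simp: star_gens_def)
      have "card (H \<inter> Fp) \<le> card H" using finite_sub[OF H(1)] by (intro card_mono) auto
      then obtain H' where H': "H \<inter> Fp \<subseteq> H'" "H' \<subseteq> Fp" "card H' = c - 1"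
        using exists_subset_between[of "H \<inter> Fp" "c - 1" Fp] t H(2) Fp_subset(3) by auto
      have g: "\<Prod>(Fp - H') \<in> loc_gens" using H' F(4) by (auto simp: loc_gens_def)
      have "\<Prod>(F - H) = \<Prod>((F - H) - (Fp - H')) * \<Prod>(Fp - H')"
        using H' F(1) Fp_subset(1) by (intro prod.subset_diff) auto
      then have z: "z = emb (\<Prod>((F - H) - (Fp - H'))) * emb (\<Prod>(Fp - H'))" using H(3) by simp
      have "emb (\<Prod>((F - H) - (Fp - H'))) \<in> S"
        by (intro emb_in_localize prod_in_R) auto
      then show "z \<in> span_ideal S (emb ` loc_gens)"
        unfolding z using g span_ideal_superset[of "emb ` loc_gens" S]
        by (intro is_idealD(4)[OF span_ideal_is_ideal[OF is_subring_S GS(2)]]) auto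
    qed
    show "emb ` loc_gens \<subseteq> span_ideal S (emb ` star_gens c)"
    proof
      fix z assume "z \<in> emb ` loc_gens"
      then obtain H where H: "H \<subseteq> Fp" "Suc (card H) = c" "z = emb (\<Prod>(Fp - H))" by (auto simp: loc_gens_def)
      have g: "\<Prod>(F - H) \<in> star_gens c" using H Fp_subset(1) by (auto simp: star_gens_def)
      have u: "\<Prod>(F - Fp) \<in> R - p" by (rule unit_prod) (auto simp: Fp_def)
      have "\<Prod>(F - H) = \<Prod>((F - H) - (Fp - H)) * \<Prod>(Fp - H)"
        using F(1) Fp_subset(1) by (intro prod.subset_diff) auto
      also have "(F - H) - (Fp - H) = F - Fp" using H(1) by auto
      finally have z: "z = Fract 1 (\<Prod>(F - Fp)) * emb (\<Prod>(F - H))"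
        using H(3) denom_nonzero[OF u] by (simp add: eq_fract)
      show "z \<in> span_ideal S (emb ` star_gens c)"
        unfolding z using g span_ideal_superset[of "emb ` star_gens c" S] inverse_in_S[OF u]
        by (intro is_idealD(4)[OF span_ideal_is_ideal[OF is_subring_S GS(1)]]) auto
    qed
  qed
  then show ?thesis by (simp add: star_ideal_eq localize_span[OF star_gens_R])
qed

lemma linear_type_small:
  assumes "card Fp < c"
  shows "linear_type S (localize R p (star_ideal n c F))"
proof -
  have "S = span_ideal S {1}"
    using is_idealD(4)[OF span_ideal_is_ideal[OF is_subring_S, of "{1}"], of _ 1]
      span_ideal_superset[of "{1}" S] is_subringD(1)[OF is_subring_S]
      span_ideal_subset[OF is_subring_S, of "{1}"] by auto
  then show ?thesis
    using linear_type_principal[OF is_subring_S is_subringD(1)[OF is_subring_S]] localize_star_small(1)[OF assms]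
    by simp
qed

lemma nonzero: "f \<in> F \<Longrightarrow> f \<noteq> 0"
  using not_in_span[of "{}" f] span_ideal_empty[OF is_subring_polys, of n] by auto

lemma loc_gens_1: "c = 1 \<Longrightarrow> loc_gens = {\<Prod>Fp}"
proof -
  assume "c = 1"
  then have "{H. H \<subseteq> Fp \<and> Suc (card H) = c} = {{}}"
    using finite_subset[OF _ Fp_subset(3)] by auto
  then show ?thesis by (simp add: loc_gens_def)
qed

lemma linear_type_1:
  assumes "c = 1"
  shows "linear_type S (localize R p (star_ideal n c F))"
proof -
  have "\<Prod>Fp \<noteq> 0" using nonzero Fp_subset by auto
  moreover have "emb (\<Prod>Fp) \<in> S" using Fp_subset by (intro emb_in_localize prod_in_R)
  ultimately show ?thesis
    using linear_type_principal[OF is_subring_S, of "emb (\<Prod>Fp)"] localize_star loc_gens_1[OF assms] assms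
    by simp
qed

lemma loc_gens_2: "c = 2 \<Longrightarrow> loc_gens = (\<lambda>f. \<Prod>(Fp - {f})) ` Fp"
  unfolding loc_gens_def by (auto simp: card_1_singleton_iff numeral_2_eq_2)

text \<open>Omitting \<open>c - 1\<close> of exactly \<open>c\<close> forms leaves a single one:
  locally the ideal is a complete intersection of independent forms.\<close>

lemma loc_gens_ci:
  assumes "c = card Fp"
  shows "loc_gens = Fp"
proof -
  have "{H. H \<subseteq> Fp \<and> Suc (card H) = c} = (\<lambda>f. Fp - {f}) ` Fp"
  proof (intro subset_antisym subsetI)
    fix H assume "H \<in> {H. H \<subseteq> Fp \<and> Suc (card H) = c}"
    then have H: "H \<subseteq> Fp" "Suc (card H) = card Fp" using assms by auto
    then have "card (Fp - H) = 1" using card_Diff_subset[of H Fp] finite_subset[OF H(1) Fp_subset(3)] by simp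
    then obtain f where "Fp - H = {f}" by (auto simp: card_1_singleton_iff)
    then have "H = Fp - {f}" "f \<in> Fp" using H(1) by auto
    then show "H \<in> (\<lambda>f. Fp - {f}) ` Fp" by blast
  next
    fix H assume "H \<in> (\<lambda>f. Fp - {f}) ` Fp"
    then obtain f where "f \<in> Fp" "H = Fp - {f}" by blast
    then show "H \<in> {H. H \<subseteq> Fp \<and> Suc (card H) = c}"
      using assms card_Suc_Diff1[OF Fp_subset(3), of f] by auto
  qed
  moreover have "\<Prod>(Fp - (Fp - {f})) = f" if "f \<in> Fp" for f
  proof -
    have "Fp - (Fp - {f}) = {f}" using that by auto
    then show ?thesis by simp
  qed
  ultimately show ?thesis by (simp add: loc_gens_def image_image)
qed

section \<open>Generators that are monomials in suitable coordinates\<close>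

lemma independent_coordinates:
  assumes ind: "lin_indep n Fp"
  obtains fs \<sigma> \<tau> v where "distinct fs" "set fs = Fp" "linear_auto n \<sigma> \<tau>"
    "\<And>i. i < length fs \<Longrightarrow> msubst \<tau> (fs ! i) = mvar (v i)" "\<And>i. i < length fs \<Longrightarrow> v i < n"
    "\<And>i. i < length fs \<Longrightarrow> msubst \<sigma> (mvar (v i)) = fs ! i" "inj_on v {..<length fs}"
proof -
  obtain fs where fs: "distinct fs" "set fs = Fp" using finite_distinct_list[OF Fp_subset(3)] by blast
  obtain \<sigma> \<tau> E where st: "linear_auto n \<sigma> \<tau>" "E \<subseteq> {..<n}" "msubst \<tau> ` Fp = mvar ` E"
    using linear_auto_span[of Fp n] Fp_subset F ind by blast
  have "\<forall>i\<in>{..<length fs}. \<exists>e. e \<in> E \<and> msubst \<tau> (fs ! i) = mvar e"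
    using st(3) fs(2) nth_mem by blast
  from bchoice[OF this] obtain v where v: "\<And>i. i < length fs \<Longrightarrow> v i \<in> E"
    "\<And>i. i < length fs \<Longrightarrow> msubst \<tau> (fs ! i) = mvar (v i)" by blast
  have \<sigma>: "msubst \<sigma> (mvar (v i)) = fs ! i" if "i < length fs" for i
    using linear_autoD(3)[OF st(1), of "fs ! i"] v(2)[OF that] by simp
  have "inj_on v {..<length fs}"
  proof (rule inj_onI)
    fix i j assume ij: "i \<in> {..<length fs}" "j \<in> {..<length fs}" "v i = v j"
    then have "fs ! i = fs ! j" using \<sigma>[of i] \<sigma>[of j] by simp
    then show "i = j" using ij fs(1) by (simp add: nth_eq_iff_index_eq)
  qed
  then show thesis using that[OF fs st(1) v(2) _ \<sigma>] v(1) st(2) by blast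
qed

text \<open>Splitting off one coordinate together with one Rees variable exhibits a term of a linear
  binomial; two terms with the same remaining factor then differ by a multiple of that
  binomial.\<close>

lemma monomial_shift:
  assumes v: "lookup a w \<ge> 1" "lookup m i \<ge> 1" and \<sigma>: "msubst \<sigma> (mvar w) = f"
  shows "single m (emb (msubst \<sigma> (single a 1))) =
    single (m - single i 1) (emb (msubst \<sigma> (single (a - single w 1) 1))) * (mconst (emb f) * mvar i)"
proof -
  have a: "single a 1 = mvar w * single (a - single w 1) 1"
    using diff_single_add[of a w] v by (simp add: mvar_def mult_single add.commute)
  have "msubst \<sigma> (single a 1) = f * msubst \<sigma> (single (a - single w 1) 1)"
    unfolding a ring_hom_onD(5)[OF ring_hom_msubst UNIV_I UNIV_I] \<sigma> ..
  then show ?thesis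
    using diff_single_add[of m i] v by (simp add: mconst_def mvar_def mult_single add.commute mult.commute)
qed

text \<open>The generators become monomials in the coordinates given by \<open>fs\<close>. The choice \<open>s i j\<close> tells
  which of the two coordinates is traded when \<open>T\<^sub>i\<close> is replaced by \<open>T\<^sub>j\<close>: it is \<open>j\<close> for the
  generators \<open>fs\<close> themselves, and \<open>i\<close> for the products that omit one of them.\<close>

lemma linear_type_binomial:
  fixes s :: "nat \<Rightarrow> nat \<Rightarrow> nat" and fs es :: "'k mpoly list"
  defines "\<mu> \<equiv> length fs"
  assumes fs: "set fs = Fp" and auto: "linear_auto n \<sigma> \<tau>"
    and v: "\<And>i. i < \<mu> \<Longrightarrow> v i < n" "\<And>i. i < \<mu> \<Longrightarrow> msubst \<sigma> (mvar (v i)) = fs ! i"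
    and es: "length es = \<mu>" "set es \<subseteq> R" "localize R p (star_ideal n c F) = span_ideal S (emb ` set es)"
    and s: "\<And>i j. i < \<mu> \<Longrightarrow> j < \<mu> \<Longrightarrow> s i j < \<mu>"
    and rel: "\<And>i j. i < \<mu> \<Longrightarrow> j < \<mu> \<Longrightarrow> fs ! s i j * es ! i = fs ! s j i * es ! j"
    and \<Gamma>: "\<And>m. keys m \<subseteq> {..<\<mu>} \<Longrightarrow> msubst \<tau> (monom_eval ((!) es) m) = single (\<Gamma> m) 1"
    and pos: "\<And>a b m k i j. \<lbrakk>keys m \<subseteq> {..<\<mu>}; keys k \<subseteq> {..<\<mu>}; a + \<Gamma> m = b + \<Gamma> k;
      total_deg m = total_deg k; i < \<mu>; j < \<mu>; lookup m i > lookup k i; lookup m j < lookup k j\<rbrakk> \<Longrightarrow>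
      lookup a (v (s i j)) \<ge> 1"
    and move: "\<And>m i j. \<lbrakk>keys m \<subseteq> {..<\<mu>}; i < \<mu>; j < \<mu>; i \<noteq> j; lookup m i \<ge> 1\<rbrakk> \<Longrightarrow>
      single (v (s j i)) 1 + \<Gamma> (m - single i 1 + single j 1) = single (v (s i j)) 1 + \<Gamma> m"
  shows "linear_type S (localize R p (star_ideal n c F))"
proof -
  \<comment> \<open>One linear relation for each pair of generators, read off from the hypothesis
    \<open>rel\<close>.\<close>
  define L where "L = {mconst (emb (fs ! s i j)) * mvar i - mconst (emb (fs ! s j i)) * mvar j | i j. i < \<mu> \<and> j < \<mu>}"
  define W where "W a m = single m (emb (msubst \<sigma> (single a 1)))" for a m :: "nat \<Rightarrow>\<^sub>0 nat"
  have fsS: "emb (fs ! i) \<in> S" if "i < \<mu>" for i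
    using that fs Fp_subset(2) nth_mem[of i fs] by (intro emb_in_localize) (auto simp: \<mu>_def)
  have LK: "L \<subseteq> rees_kernel S (map emb es)"
  proof
    fix f assume "f \<in> L"
    then obtain i j where ij: "i < \<mu>" "j < \<mu>"
      and f: "f = mconst (emb (fs ! s i j)) * mvar i - mconst (emb (fs ! s j i)) * mvar j"
      by (auto simp: L_def)
    show "f \<in> rees_kernel S (map emb es)"
      unfolding f using ij es(1) rel[OF ij] fsS s
      by (intro binomial_in_rees_kernel[OF is_subring_S]) auto
  qed
  have SX: "is_subring (mpolys S \<mu>)" by (rule is_subring_mpolys[OF is_subring_S])
  have LR: "L \<subseteq> mpolys S \<mu>" using LK es(1) by (auto simp: rees_kernel_eq)
  note J = span_ideal_is_ideal[OF SX LR]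
  have "rees_kernel S (map emb es) \<subseteq> span_ideal (mpolys S (length es)) L"
  proof (rule rees_kernel_monomial[OF prime_p auto es(2) _ J[folded es(1)], where \<Gamma> = \<Gamma>])
    show "msubst \<tau> (monom_eval ((!) es) m) = single (\<Gamma> m) 1" if "keys m \<subseteq> {..<length es}" for m
      using that es(1) by (intro \<Gamma>) simp
    fix a m b k :: "nat \<Rightarrow>\<^sub>0 nat"
    assume am: "keys a \<subseteq> {..<n}" "keys b \<subseteq> {..<n}" "keys m \<subseteq> {..<length es}" "keys k \<subseteq> {..<length es}"
      "a + \<Gamma> m = b + \<Gamma> k" "total_deg m = total_deg k"
    have "W a m - W b k \<in> span_ideal (mpolys S \<mu>) L"
    proof (rule monomial_congruence[OF J, where n = n and t = \<mu> and \<Gamma> = \<Gamma>])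
      fix a b m k :: "nat \<Rightarrow>\<^sub>0 nat" and i j
      assume a: "keys a \<subseteq> {..<n}" and m: "keys m \<subseteq> {..<\<mu>}" and k: "keys k \<subseteq> {..<\<mu>}"
        and eq: "a + \<Gamma> m = b + \<Gamma> k" "total_deg m = total_deg k"
        and ij: "i < \<mu>" "j < \<mu>" "lookup k i < lookup m i" "lookup m j < lookup k j"
      define g where "g = v (s i j)"
      define g' where "g' = v (s j i)"
      have ag: "lookup a g \<ge> 1" unfolding g_def by (rule pos[OF m k eq ij])
      \<comment> \<open>By \<open>pos\<close> the coordinate \<open>g\<close> divides the monomial
        of \<open>a\<close>. Trading it for \<open>g'\<close> compensates the replacement of
        variable \<open>i\<close> by \<open>j\<close>, so that the image in the Rees algebra is
        unchanged.\<close>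
      define a' where "a' = a - single g 1 + single g' 1"
      define m' where "m' = m - single i 1 + single j 1"
      have sh: "a - single g 1 + single g 1 = a"
        using ag by (intro diff_single_add) simp
      have sh': "a' - single g' 1 = a - single g 1" "m' - single j 1 = m - single i 1"
        by (simp_all add: a'_def m'_def)
      have "single g' 1 + \<Gamma> m' = single g 1 + \<Gamma> m"
        unfolding m'_def g_def g'_def using m ij by (intro move) auto
      then have "(a - single g 1) + (single g' 1 + \<Gamma> m') = (a - single g 1 + single g 1) + \<Gamma> m"
        by (simp only: add.assoc)
      then have G: "a' + \<Gamma> m' = a + \<Gamma> m"
        unfolding sh a'_def by (simp only: add.assoc)
      have "keys a' \<subseteq> {..<n}"
        using a v(1)[OF s[OF ij(2,1)]] keys_diff_nat[of a "single g 1"]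
        by (auto simp: a'_def g'_def keys_add_nat split: if_splits)
      moreover have "W a m - W a' m' \<in> span_ideal (mpolys S \<mu>) L"
      proof -
        \<comment> \<open>Both terms have the cofactor
          \<open>W (a - single g 1) (m - single i 1)\<close>, so their difference is a multiple of a
          binomial from \<open>L\<close>.\<close>
        have "W a m = W (a - single g 1) (m - single i 1) * (mconst (emb (fs ! s i j)) * mvar i)"
          unfolding W_def using ag ij v(2)[OF s[OF ij(1,2)]] by (intro monomial_shift) (auto simp: g_def)
        moreover have "W a' m' = W (a' - single g' 1) (m' - single j 1) * (mconst (emb (fs ! s j i)) * mvar j)"
          unfolding W_def using v(2)[OF s[OF ij(2,1)]]
          by (intro monomial_shift) (auto simp: a'_def g'_def m'_def lookup_add)
        ultimately have "W a m - W a' m' = W (a - single g 1) (m - single i 1) *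
            (mconst (emb (fs ! s i j)) * mvar i - mconst (emb (fs ! s j i)) * mvar j)"
          unfolding sh' by (simp only: right_diff_distrib)
        moreover have "W (a - single g 1) (m - single i 1) \<in> mpolys S \<mu>"
        proof -
          have "msubst \<sigma> (single (a - single g 1) 1) \<in> R"
            using a keys_diff_nat[of a "single g 1"] by (intro linear_autoD(5)[OF auto] single_in_mpolys) auto
          then show ?thesis unfolding W_def
            using m keys_diff_nat[of m "single i 1"] by (intro single_in_mpolys is_subring_S emb_in_localize) auto
        qed
        moreover have "mconst (emb (fs ! s i j)) * mvar i - mconst (emb (fs ! s j i)) * mvar j \<in> span_ideal (mpolys S \<mu>) L"
          using ij by (intro subsetD[OF span_ideal_superset]) (auto simp: L_def)
        ultimately show ?thesis by (simp only: is_idealD(4)[OF J])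
      qed
      ultimately show "\<exists>a'. keys a' \<subseteq> {..<n} \<and> a' + \<Gamma> (m - single i 1 + single j 1) = a + \<Gamma> m \<and>
        W a m - W a' (m - single i 1 + single j 1) \<in> span_ideal (mpolys S \<mu>) L"
        using G unfolding m'_def by blast
    qed (use am es(1) in auto)
    then show "single m (emb (msubst \<sigma> (single a 1))) - single k (emb (msubst \<sigma> (single b 1)))
        \<in> span_ideal (mpolys S (length es)) L" by (simp add: W_def es(1))
  qed
  then show ?thesis
  proof (intro linear_typeI[OF is_subring_S, of "map emb es" _ L])
    show "localize R p (star_ideal n c F) = span_ideal S (set (map emb es))"
      using es(3) by simp
    show "set (map emb es) \<subseteq> S" using es(2) emb_in_localize by auto
    show "homogeneous 1 f" if "f \<in> L" for f
      using that by (auto simp: L_def simp del: One_nat_def intro!: homogeneous_binomial[of _ \<mu>])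
  qed (use LK in auto)
qed

lemma lookup_sum_single_inj:
  assumes "inj_on v {..<t}" "i < (t::nat)"
  shows "lookup (\<Sum>l<t. single (v l) (x l)) (v i) = (x i :: nat)"
proof -
  have "lookup (\<Sum>l<t. single (v l) (x l)) (v i) = (\<Sum>l<t. if l = i then x l else 0)"
    unfolding lookup_sum using assms
    by (intro sum.cong) (auto simp: lookup_single when_def inj_on_def)
  then show ?thesis using assms(2) by simp
qed

text \<open>The generators are coordinates and the Koszul relations suffice: replacing variable
  \<open>i\<close> by \<open>j\<close> costs the coordinate of \<open>j\<close> and returns that of
  \<open>i\<close>.\<close>

lemma linear_type_ci:
  assumes t: "card Fp = c"
  shows "linear_type S (localize R p (star_ideal n c F))"
proof -
  have "lin_indep n Fp" using indep[OF Fp_subset(1)] t by simp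
  then obtain fs \<sigma> \<tau> v where fs: "distinct fs" "set fs = Fp" and auto: "linear_auto n \<sigma> \<tau>"
    and v: "\<And>i. i < length fs \<Longrightarrow> msubst \<tau> (fs ! i) = mvar (v i)" "\<And>i. i < length fs \<Longrightarrow> v i < n"
      "\<And>i. i < length fs \<Longrightarrow> msubst \<sigma> (mvar (v i)) = fs ! i" "inj_on v {..<length fs}"
    by (rule independent_coordinates) (blast intro: that)
  define \<Gamma> where "\<Gamma> m = (\<Sum>i<length fs. single (v i) (lookup m i))" for m :: "nat \<Rightarrow>\<^sub>0 nat"
  have \<Gamma>_add: "\<Gamma> (m + m') = \<Gamma> m + \<Gamma> m'" for m m'
    by (simp add: \<Gamma>_def lookup_add single_add sum.distrib)
  have \<Gamma>_single: "\<Gamma> (single i 1) = single (v i) 1" if "i < length fs" for i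
  proof -
    have "\<Gamma> (single i 1) = (\<Sum>l<length fs. if l = i then single (v l) 1 else 0)"
      unfolding \<Gamma>_def by (intro sum.cong) (auto simp: lookup_single when_def)
    then show ?thesis using that by simp
  qed
  show ?thesis
  proof (rule linear_type_binomial[OF fs(2) auto v(2,3), where es = fs and s = "\<lambda>i j. j" and \<Gamma> = \<Gamma>])
    show "localize R p (star_ideal n c F) = span_ideal S (emb ` set fs)"
      using localize_star loc_gens_ci fs(2) t by simp
    show "msubst \<tau> (monom_eval ((!) fs) m) = single (\<Gamma> m) 1" if "keys m \<subseteq> {..<length fs}" for m
    proof -
      have "msubst \<tau> (monom_eval ((!) fs) m) = monom_eval (\<lambda>i. mvar (v i)) m"
        unfolding monom_eval_hom[OF ring_hom_msubst] using that v(1) by (intro monom_eval_cong) auto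
      then show ?thesis
        using monom_eval_superset[of "{..<length fs}" m "\<lambda>i. mvar (v i)"] that
        by (simp add: \<Gamma>_def prod_mvar_power)
    qed
    show "1 \<le> lookup a (v j)"
      if "a + \<Gamma> m = b + \<Gamma> k" "j < length fs" "lookup m j < lookup k j" for a b m k j
    proof -
      \<comment> \<open>At the coordinate of \<open>j\<close> the monomial of \<open>k\<close>
        contributes more than that of \<open>m\<close>, so \<open>a\<close> must supply the
        difference.\<close>
      have "lookup (a + \<Gamma> m) (v j) = lookup (b + \<Gamma> k) (v j)" using that by simp
      then show ?thesis
        using that lookup_sum_single_inj[OF v(4) that(2)] by (simp add: lookup_add \<Gamma>_def)
    qed
    show "single (v i) 1 + \<Gamma> (m - single i 1 + single j 1) = single (v j) 1 + \<Gamma> m"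
      if "i < length fs" "j < length fs" "1 \<le> lookup m i" for m i j
    proof -
      have "\<Gamma> m = \<Gamma> (m - single i 1 + single i 1)" using that by (simp add: diff_single_add del: One_nat_def)
      then show ?thesis
        unfolding \<Gamma>_add \<Gamma>_single[OF that(1)] \<Gamma>_single[OF that(2)] by (simp only: ac_simps)
    qed
  qed (use fs Fp_subset in \<open>auto simp: mult.commute\<close>)
qed

text \<open>Each generator omits one coordinate, and each form times the generator that omits it
  equals \<open>\<Prod>Fp\<close>. Comparing two of these products gives the linear relations; in
  contrast to the complete intersection case, variable \<open>i\<close> now carries its own
  coordinate.\<close>

lemma linear_type_2:
  assumes c: "c = 2" and ind: "lin_indep n Fp" and t: "Fp \<noteq> {}"
  shows "linear_type S (localize R p (star_ideal n c F))"
proof -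
  obtain fs \<sigma> \<tau> v where fs: "distinct fs" "set fs = Fp" and auto: "linear_auto n \<sigma> \<tau>"
    and v: "\<And>i. i < length fs \<Longrightarrow> msubst \<tau> (fs ! i) = mvar (v i)" "\<And>i. i < length fs \<Longrightarrow> v i < n"
      "\<And>i. i < length fs \<Longrightarrow> msubst \<sigma> (mvar (v i)) = fs ! i" "inj_on v {..<length fs}"
    by (rule independent_coordinates[OF ind]) (blast intro: that)
  define es where "es = map (\<lambda>f. \<Prod>(Fp - {f})) fs"
  \<comment> \<open>The coordinate of \<open>j\<close> divides every generator except the one with
    index \<open>j\<close>, so its exponent is the degree minus the exponent of that
    generator.\<close>
  define \<Gamma> where "\<Gamma> m = (\<Sum>j<length fs. single (v j) (total_deg m - lookup m j))" for m :: "nat \<Rightarrow>\<^sub>0 nat"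
  have prod_nth: "\<Prod>(Fp - {fs ! i}) = (\<Prod>j\<in>{..<length fs} - {i}. fs ! j)" if "i < length fs" for i
  proof -
    have inj: "inj_on ((!) fs) {..<length fs}" by (rule inj_on_nth[OF fs(1)]) simp
    have "set fs = (!) fs ` {..<length fs}" by (auto simp: set_conv_nth)
    then have "Fp - {fs ! i} = (!) fs ` {..<length fs} - (!) fs ` {i}" using fs(2) by simp
    also have "\<dots> = (!) fs ` ({..<length fs} - {i})"
      using that by (intro inj_on_image_set_diff[OF inj, symmetric]) auto
    finally show ?thesis
      using prod.reindex[OF inj_on_subset[OF inj], of "{..<length fs} - {i}" "\<lambda>x. x"] by simp
  qed
  \<comment> \<open>This keeps the subtractions in \<open>\<Gamma>\<close> from being
    truncated.\<close>
  have le: "lookup m i \<le> total_deg m" for m i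
    using member_le_sum[of i "keys m" "lookup m"] by (cases "i \<in> keys m") (auto simp: total_deg_def in_keys_iff)
  show ?thesis
  proof (rule linear_type_binomial[OF fs(2) auto v(2,3), where es = es and s = "\<lambda>i j. i" and \<Gamma> = \<Gamma>])
    have "card Fp \<ge> 1" using t Fp_subset(3) by (simp add: Suc_le_eq card_gt_0_iff)
    then show "localize R p (star_ideal n c F) = span_ideal S (emb ` set es)"
      using localize_star loc_gens_2[OF c] fs(2) c by (simp add: es_def image_image)
    show "set es \<subseteq> R" using prod_in_R[of "Fp - _"] Fp_subset(1) fs(2) by (auto simp: es_def)
    show "fs ! i * es ! i = fs ! j * es ! j" if "i < length fs" "j < length fs" for i j
    proof -
      have "f * \<Prod>(Fp - {f}) = \<Prod>Fp" if "f \<in> Fp" for f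
        using prod.remove[OF Fp_subset(3) that, of "\<lambda>x. x"] by simp
      then show ?thesis using that fs(2) nth_mem[of i fs] nth_mem[of j fs] by (simp add: es_def)
    qed
    show "msubst \<tau> (monom_eval ((!) es) m) = single (\<Gamma> m) 1" if m: "keys m \<subseteq> {..<length fs}" for m
    proof -
      let ?t = "length fs"
      have td: "total_deg m = (\<Sum>i<?t. lookup m i)" using m by (intro total_deg_superset) auto
      have "msubst \<tau> (monom_eval ((!) es) m) = monom_eval (\<lambda>i. msubst \<tau> (es ! i)) m"
        by (rule monom_eval_hom[OF ring_hom_msubst])
      also have "\<dots> = monom_eval (\<lambda>i. \<Prod>j\<in>{..<?t} - {i}. mvar (v j)) m"
      proof (rule monom_eval_cong)
        fix i assume "i \<in> keys m"
        then have i: "i < ?t" using m by auto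
        then have "msubst \<tau> (es ! i) = (\<Prod>j\<in>{..<?t} - {i}. msubst \<tau> (fs ! j))"
          using prod_nth by (simp add: es_def ring_hom_on_prod[OF ring_hom_msubst])
        then show "msubst \<tau> (es ! i) = (\<Prod>j\<in>{..<?t} - {i}. mvar (v j))" using v(1) by simp
      qed
      also have "\<dots> = (\<Prod>i<?t. (\<Prod>j\<in>{..<?t} - {i}. mvar (v j)) ^ lookup m i)"
        using m by (intro monom_eval_superset) auto
      \<comment> \<open>Filling up with ones gives both products the full range, after which they
        can be exchanged and collected by coordinates.\<close>
      also have "\<dots> = (\<Prod>i<?t. \<Prod>j<?t. if j = i then 1 else mvar (v j) ^ lookup m i)"
        by (intro prod.cong refl) (auto simp: prod_power_distrib prod.If_cases Diff_eq intro!: prod.mono_neutral_cong)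
      also have "\<dots> = (\<Prod>j<?t. \<Prod>i<?t. if j = i then 1 else mvar (v j) ^ lookup m i)"
        by (rule prod.swap)
      also have "\<dots> = (\<Prod>j<?t. mvar (v j) ^ (total_deg m - lookup m j))"
      proof (intro prod.cong refl)
        fix j assume j: "j \<in> {..<?t}"
        have "(\<Prod>i<?t. if j = i then 1 else mvar (v j) ^ lookup m i) = (\<Prod>i\<in>{..<?t} - {j}. mvar (v j) ^ lookup m i)"
          by (rule prod.mono_neutral_cong_right) auto
        also have "\<dots> = mvar (v j) ^ (\<Sum>i\<in>{..<?t} - {j}. lookup m i)" by (simp add: power_sum)
        also have "(\<Sum>i\<in>{..<?t} - {j}. lookup m i) = total_deg m - lookup m j"
          using sum.remove[OF _ j, of "lookup m"] by (simp add: td)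
        finally show "(\<Prod>i<?t. if j = i then 1 else mvar (v j) ^ lookup m i) =
          (mvar (v j) ^ (total_deg m - lookup m j) :: 'k mpoly)" .
      qed
      finally show ?thesis by (simp add: \<Gamma>_def prod_mvar_power)
    qed
    show "1 \<le> lookup a (v i)"
      if "a + \<Gamma> m = b + \<Gamma> k" "total_deg m = total_deg k" "i < length fs" "lookup k i < lookup m i" for a b m k i
    proof -
      have "lookup (a + \<Gamma> m) (v i) = lookup (b + \<Gamma> k) (v i)" using that by simp
      then show ?thesis
        using that lookup_sum_single_inj[OF v(4) that(3)] le[of m i] by (simp add: lookup_add \<Gamma>_def)
    qed
    show "single (v j) 1 + \<Gamma> (m - single i 1 + single j 1) = single (v i) 1 + \<Gamma> m"
      if ij: "i < length fs" "j < length fs" "i \<noteq> j" "1 \<le> lookup m i" for m i j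
    proof -
      define m' where "m' = m - single i 1 + single j 1"
      have "m - single i 1 + single i 1 = m" using ij by (intro diff_single_add) simp
      then have "total_deg (m - single i 1) + 1 = total_deg m"
        by (metis total_deg_add total_deg_single)
      then have td: "total_deg m' = total_deg m" by (simp add: m'_def total_deg_add)
      have lm: "lookup m' l = (if l = i then lookup m i - 1 else if l = j then lookup m j + 1 else lookup m l)" for l
        using ij(3) by (auto simp: m'_def lookup_add lookup_minus lookup_single when_def)
      have "single (v j) 1 + \<Gamma> m' = (\<Sum>l<length fs. single (v l) ((if l = j then 1 else 0) + (total_deg m - lookup m' l)))"
      proof -
        have "(single (v j) 1 :: nat \<Rightarrow>\<^sub>0 nat) = (\<Sum>l<length fs. single (v l) (if l = j then 1 else 0))"
          using ij(2) by (subst sum.remove[of _ j]) auto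
        then show ?thesis by (simp add: \<Gamma>_def td single_add sum.distrib)
      qed
      also have "\<dots> = (\<Sum>l<length fs. single (v l) ((if l = i then 1 else 0) + (total_deg m - lookup m l)))"
      proof (intro sum.cong refl arg_cong[of _ _ "single _"])
        fix l
        show "(if l = j then 1 else 0) + (total_deg m - lookup m' l) = (if l = i then 1 else 0) + (total_deg m - lookup m l)"
          using ij(3,4) le[of m l] le[of m' l] td by (auto simp: lm)
      qed
      also have "\<dots> = single (v i) 1 + \<Gamma> m"
      proof -
        have "(single (v i) 1 :: nat \<Rightarrow>\<^sub>0 nat) = (\<Sum>l<length fs. single (v l) (if l = i then 1 else 0))"
          using ij(1) by (subst sum.remove[of _ i]) auto
        then show ?thesis by (simp add: \<Gamma>_def single_add sum.distrib)
      qed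
      finally show ?thesis by (simp only: m'_def)
    qed
  qed (use fs Fp_subset in \<open>auto simp: es_def\<close>)
qed

end

section \<open>Dimension of the localizations\<close>

text \<open>Gaussian elimination: an equation with a nonzero coefficient at \<open>u0\<close> is
  used to eliminate this unknown from the others, which removes one equation and one
  unknown.\<close>

lemma underdetermined_system:
  fixes A :: "'e \<Rightarrow> 'u \<Rightarrow> 'f::field"
  assumes "finite E" "finite U" "card E < card U"
  shows "\<exists>x. (\<exists>u\<in>U. x u \<noteq> 0) \<and> (\<forall>e\<in>E. (\<Sum>u\<in>U. A e u * x u) = 0)"
  using assms
proof (induction E arbitrary: U A rule: finite_induct)
  case empty
  then have "U \<noteq> {}" by auto
  then show ?case by (intro exI[of _ "\<lambda>_. 1"]) auto
next
  case (insert e E)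
  show ?case
  proof (cases "\<forall>u\<in>U. A e u = 0")
    case True
    have "card E < card U" using insert by simp
    from insert.IH[OF insert.prems(1) this, of A] show ?thesis using True by auto
  next
    case False
    then obtain u0 where u0: "u0 \<in> U" "A e u0 \<noteq> 0" by blast
    have fU: "finite (U - {u0})" and cU: "card E < card (U - {u0})"
      using insert u0 by auto
    obtain x where x: "\<exists>u\<in>U - {u0}. x u \<noteq> 0"
      and sol: "\<And>e'. e' \<in> E \<Longrightarrow> (\<Sum>u\<in>U - {u0}. (A e' u - A e' u0 / A e u0 * A e u) * x u) = 0"
      using insert.IH[OF fU cU, of "\<lambda>e' u. A e' u - A e' u0 / A e u0 * A e u"] by blast
    \<comment> \<open>The value at \<open>u0\<close> is the one that solves the pivot equation
      \<open>e\<close>.\<close>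
    define y where "y = x(u0 := - (\<Sum>u\<in>U - {u0}. A e u * x u) / A e u0)"
    have y: "(\<Sum>u\<in>U. A e' u * y u) = (\<Sum>u\<in>U - {u0}. A e' u * x u) - A e' u0 / A e u0 * (\<Sum>u\<in>U - {u0}. A e u * x u)" for e'
    proof -
      have "(\<Sum>u\<in>U. A e' u * y u) = A e' u0 * y u0 + (\<Sum>u\<in>U - {u0}. A e' u * y u)"
        by (rule sum.remove[OF insert.prems(1) u0(1)])
      also have "(\<Sum>u\<in>U - {u0}. A e' u * y u) = (\<Sum>u\<in>U - {u0}. A e' u * x u)"
        by (intro sum.cong) (auto simp: y_def)
      finally show ?thesis by (simp add: y_def)
    qed
    have "(\<Sum>u\<in>U. A e' u * y u) = 0" if "e' \<in> insert e E" for e'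
    proof (cases "e' = e")
      case True
      then show ?thesis unfolding y using u0(2) by simp
    next
      case False
      then show ?thesis unfolding y using sol[of e'] that
        by (simp add: left_diff_distrib sum_subtractf sum_distrib_left mult.assoc)
    qed
    moreover have "\<exists>u\<in>U. y u \<noteq> 0" using x by (auto simp: y_def)
    ultimately show ?thesis by blast
  qed
qed

section \<open>Counting monomials, algebraic independence, and lengths of chains\<close>

definition exponent_box :: "nat \<Rightarrow> nat \<Rightarrow> (nat \<Rightarrow>\<^sub>0 nat) set" where
  "exponent_box n B = {m. keys m \<subseteq> {..<n} \<and> (\<forall>l. lookup m l \<le> B)}"

text \<open>Bounding every exponent separately, rather than the degree, makes the number of
  monomials a plain power; boxes still add under multiplication.\<close>

lemma exponent_box_card: "finite (exponent_box n B)" "card (exponent_box n B) = (B + 1) ^ n"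
proof -
  let ?r = "\<lambda>m. restrict (lookup m) {..<n}"
  have "bij_betw ?r (exponent_box n B) (PiE {..<n} (\<lambda>_. {..B}))"
  proof (rule bij_betwI')
    fix m m' assume m: "m \<in> exponent_box n B" "m' \<in> exponent_box n B"
    show "(?r m = ?r m') = (m = m')"
    proof
      assume eq: "?r m = ?r m'"
      show "m = m'"
      proof (rule poly_mapping_eqI)
        fix l show "lookup m l = lookup m' l"
        proof (cases "l < n")
          case True
          then show ?thesis using fun_cong[OF eq, of l] by simp
        next
          case False
          then have "l \<notin> keys m" "l \<notin> keys m'" using m by (auto simp: exponent_box_def)
          then show ?thesis by (simp add: in_keys_iff)
        qed
      qed
    qed simp
  next
    show "?r m \<in> (PiE {..<n} (\<lambda>_. {..B}))" if "m \<in> exponent_box n B" for m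
      using that by (auto simp: exponent_box_def)
  next
    fix g :: "nat \<Rightarrow> nat" assume g: "g \<in> (PiE {..<n} (\<lambda>_. {..B}))"
    define m :: "nat \<Rightarrow>\<^sub>0 nat" where "m = (\<Sum>l<n. single l (g l))"
    have lm: "lookup m l = (if l < n then g l else 0)" for l
      by (auto simp: m_def lookup_sum lookup_single when_def sum.delta)
    have "m \<in> exponent_box n B"
      using g by (auto simp: exponent_box_def in_keys_iff lm PiE_iff split: if_splits)
    moreover have "g = ?r m"
      using g by (auto simp: fun_eq_iff lm PiE_iff extensional_def restrict_def)
    ultimately show "\<exists>m\<in>exponent_box n B. g = ?r m" by blast
  qed
  note bij = this
  have "finite (PiE {..<n} (\<lambda>_. {..B}))" by (intro finite_PiE) auto
  then show "finite (exponent_box n B)" using bij_betw_finite[OF bij] by simp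
  show "card (exponent_box n B) = (B + 1) ^ n"
    using bij_betw_same_card[OF bij] by (simp add: card_PiE)
qed

lemma keys_mult_box:
  assumes "keys f \<subseteq> exponent_box n B" "keys g \<subseteq> exponent_box n B'"
  shows "keys (f * g) \<subseteq> exponent_box n (B + B')"
proof
  fix m assume "m \<in> keys (f * g)"
  then obtain a b where m: "m = a + b" "a \<in> keys f" "b \<in> keys g" using keys_mult[of f g] by auto
  then have "a \<in> exponent_box n B" "b \<in> exponent_box n B'" using assms by auto
  then show "m \<in> exponent_box n (B + B')"
    by (auto simp: m(1) exponent_box_def keys_add_nat lookup_add intro: add_mono)
qed

lemma keys_power_box:
  fixes f :: "'a::comm_ring_1 mpoly"
  assumes "keys f \<subseteq> exponent_box n B"
  shows "keys (f ^ k) \<subseteq> exponent_box n (k * B)"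
  using keys_mult_box[OF assms] by (induction k) (auto simp: exponent_box_def)

lemma keys_prod_box:
  fixes f :: "nat \<Rightarrow> 'a::comm_ring_1 mpoly"
  assumes "\<And>i. i \<in> Z \<Longrightarrow> keys (f i) \<subseteq> exponent_box n B"
  shows "keys (prod f Z) \<subseteq> exponent_box n (card Z * B)"
  using assms
proof (induction Z rule: infinite_finite_induct)
  case (insert i Z)
  then show ?case using keys_mult_box[of "f i" n B "prod f Z" "card Z * B"] by auto
qed (auto simp: exponent_box_def)

lemma exponent_box_mono: "B \<le> B' \<Longrightarrow> exponent_box n B \<subseteq> exponent_box n B'"
  by (auto simp: exponent_box_def intro: order_trans)

lemma polys_in_box:
  fixes f :: "'a::comm_ring_1 mpoly"
  assumes "f \<in> polys n"
  shows "\<exists>B. keys f \<subseteq> exponent_box n B"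
proof -
  let ?B = "\<Sum>m\<in>keys f. total_deg m"
  have "lookup m l \<le> ?B" if "m \<in> keys f" for m l
  proof -
    have "lookup m l \<le> total_deg m"
      using member_le_sum[of l "keys m" "lookup m"] by (cases "l \<in> keys m") (auto simp: total_deg_def in_keys_iff)
    also have "\<dots> \<le> ?B" using that by (intro member_le_sum) auto
    finally show ?thesis .
  qed
  then show ?thesis using mpolysD[OF assms] by (auto simp: exponent_box_def subset_eq)
qed

lemma lookup_mconst_mult: "lookup (mconst c * f) e = c * lookup f e"
proof (cases "c = 0")
  case False
  then have "mconst c * f = (\<Sum>b\<in>keys f. single b (c * lookup f b))"
    unfolding mpoly_mult_expand[of "mconst c"] by (simp add: mconst_def)
  then have "lookup (mconst c * f) e = (\<Sum>b\<in>keys f. if b = e then c * lookup f e else 0)"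
    by (simp only: lookup_sum) (intro sum.cong refl, simp add: lookup_single when_def)
  then show ?thesis by (cases "e \<in> keys f") (simp_all add: in_keys_iff)
qed (simp add: mconst_def)

text \<open>Algebraic independence over the ground field of the classes of the first
  \<open>d\<close> entries of \<open>y\<close> in the quotient by \<open>P\<close>.\<close>

definition alg_indep_mod :: "'a::comm_ring_1 mpoly set \<Rightarrow> nat \<Rightarrow> (nat \<Rightarrow> 'a mpoly) \<Rightarrow> bool" where
  "alg_indep_mod P d y \<longleftrightarrow> (\<forall>Q\<in>polys d. msubst y Q \<in> P \<longrightarrow> Q = 0)"

text \<open>There are more monomials of bounded exponents in \<open>n + 1\<close> variables than the dimension of
  the space that contains their values.\<close>

lemma alg_indep_le:
  fixes y :: "nat \<Rightarrow> 'k::field mpoly"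
  assumes y: "\<And>i. i < d \<Longrightarrow> y i \<in> polys n" and ind: "alg_indep_mod {0} d y"
  shows "d \<le> n"
proof (rule ccontr)
  assume "\<not> d \<le> n"
  then have dn: "Suc n \<le> d" by simp
  have "\<forall>i\<in>{..<d}. \<exists>B. keys (y i) \<subseteq> exponent_box n B" using y polys_in_box by blast
  from bchoice[OF this] obtain b where b: "\<And>i. i < d \<Longrightarrow> keys (y i) \<subseteq> exponent_box n (b i)" by blast
  define D where "D = (\<Sum>i<d. b i)"
  have D: "keys (y i) \<subseteq> exponent_box n D" if "i < d" for i
    using b[OF that] exponent_box_mono[of "b i" D n] member_le_sum[of i "{..<d}" b] that
    by (auto simp: D_def)
  \<comment> \<open>With this \<open>N\<close>, the inequality
    \<open>d * (N * D) + 1 \<le> (N + 1) * (d * D + 1)\<close> bounds the number of target monomials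
    by \<open>(N + 1) ^ n * N\<close>. This is less than \<open>(N + 1) ^ Suc n\<close>, hence less
    than the number of source monomials, since \<open>d > n\<close>.\<close>
  define N where "N = (d * D + 1) ^ n"
  have mon: "keys (monom_eval y m) \<subseteq> exponent_box n (d * (N * D))" if m: "m \<in> exponent_box d N" for m
  proof -
    have "monom_eval y m = (\<Prod>i<d. y i ^ lookup m i)"
      using m by (intro monom_eval_superset) (auto simp: exponent_box_def)
    moreover have "keys (y i ^ lookup m i) \<subseteq> exponent_box n (N * D)" if "i < d" for i
      using keys_power_box[OF D[OF that], of "lookup m i"] m exponent_box_mono[of "lookup m i * D" "N * D" n]
      by (auto simp: exponent_box_def)
    ultimately show ?thesis using keys_prod_box[of "{..<d}" "\<lambda>i. y i ^ lookup m i" n "N * D"] by simp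
  qed
  let ?U = "exponent_box d N" and ?E = "exponent_box n (d * (N * D))"
  have "card ?E < card ?U"
  proof -
    have "d * (N * D) + 1 \<le> (N + 1) * (d * D + 1)" by (simp add: algebra_simps)
    then have "card ?E \<le> ((N + 1) * (d * D + 1)) ^ n"
      unfolding exponent_box_card by (rule power_mono) simp
    also have "\<dots> = (N + 1) ^ n * N" unfolding power_mult_distrib by (simp only: N_def)
    also have "\<dots> < (N + 1) ^ Suc n" by simp
    also have "\<dots> \<le> (N + 1) ^ d" using dn by (intro power_increasing) auto
    finally show ?thesis by (simp add: exponent_box_card)
  qed
  \<comment> \<open>The unknowns are the coefficients of a polynomial relation, and there is one
    equation for each monomial that its value could contain.\<close>
  from underdetermined_system[OF exponent_box_card(1) exponent_box_card(1) this,
      of "\<lambda>e m. lookup (monom_eval y m) e"]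
  obtain x where x: "\<exists>u\<in>?U. x u \<noteq> 0"
    and sol: "\<And>e. e \<in> ?E \<Longrightarrow> (\<Sum>m\<in>?U. lookup (monom_eval y m) e * x m) = 0" by blast
  define Q where "Q = (\<Sum>m\<in>?U. single m (x m))"
  have lQ: "lookup Q m = x m" if "m \<in> ?U" for m
    using that exponent_box_card(1) by (simp add: Q_def lookup_sum lookup_single when_def sum.delta)
  have "Q \<in> polys d"
    unfolding Q_def by (intro is_subring_sum is_subring_polys single_in_mpolys) (auto simp: exponent_box_def)
  moreover have "msubst y Q = 0"
  proof (rule poly_mapping_eqI)
    fix e
    have "msubst y Q = (\<Sum>m\<in>?U. mconst (x m) * monom_eval y m)"
      unfolding Q_def ring_hom_on_sum[OF ring_hom_msubst UNIV_I] unfolding msubst_def ev_single[OF ring_hom_mconst] ..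
    then have "lookup (msubst y Q) e = (\<Sum>m\<in>?U. lookup (monom_eval y m) e * x m)"
      by (simp add: lookup_sum lookup_mconst_mult mult.commute)
    also have "\<dots> = 0"
    proof (cases "e \<in> ?E")
      case False
      then have "lookup (monom_eval y m) e = 0" if "m \<in> ?U" for m
        using mon[OF that] by (auto simp: in_keys_iff)
      then show ?thesis by simp
    qed (rule sol)
    finally show "lookup (msubst y Q) e = lookup 0 e" by simp
  qed
  ultimately have "Q = 0" using ind by (auto simp: alg_indep_mod_def)
  then show False using x lQ by auto
qed

text \<open>Split a relation as \<open>Q = A + mvar d * B\<close> with \<open>A\<close> free of the
  last variable. Modulo \<open>P'\<close> the second summand vanishes, so \<open>A = 0\<close> by
  independence there. Then \<open>f\<close> times the value of \<open>B\<close> lies in the prime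
  \<open>P\<close>, which does not contain \<open>f\<close>, so \<open>B\<close> is a relation of
  lower degree in the last variable.\<close>

lemma alg_indep_step:
  fixes y :: "nat \<Rightarrow> 'k::field mpoly"
  assumes P: "is_prime (polys n) P" and P': "is_ideal (polys n) P'" "P \<subseteq> P'" and f: "f \<in> P'" "f \<notin> P"
    and y: "\<And>i. i < d \<Longrightarrow> y i \<in> polys n" and ind: "alg_indep_mod P' d y"
  shows "alg_indep_mod P (Suc d) (y(d := f))"
proof -
  let ?y = "y(d := f)"
  note hom = ring_hom_onD[OF ring_hom_msubst, simplified]
  have fR: "f \<in> polys n" using f P'(1) is_idealD(1) by blast
  have yR: "?y i \<in> polys n" if "i < Suc d" for i using that y fR by auto
  have "Q = 0" if "Q \<in> polys (Suc d)" "\<forall>m\<in>keys Q. lookup m d < N" "msubst ?y Q \<in> P" for N Q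
    using that
  proof (induction N arbitrary: Q)
    case 0
    then have "keys Q = {}" by auto
    then show ?case by simp
  next
    case (Suc N)
    define A where "A = (\<Sum>m\<in>{m\<in>keys Q. lookup m d = 0}. single m (lookup Q m))"
    define B where "B = (\<Sum>m\<in>{m\<in>keys Q. lookup m d \<noteq> 0}. single (m - single d 1) (lookup Q m))"
    have "mvar d * B = (\<Sum>m\<in>{m\<in>keys Q. lookup m d \<noteq> 0}. single m (lookup Q m))"
      unfolding B_def sum_distrib_left
    proof (intro sum.cong refl)
      fix m assume "m \<in> {m\<in>keys Q. lookup m d \<noteq> 0}"
      then have "single d 1 + (m - single d 1) = m"
        using diff_single_add[of m d] by (simp add: add.commute)
      then show "mvar d * single (m - single d 1) (lookup Q m) = single m (lookup Q m)"
        by (simp add: mvar_def mult_single del: One_nat_def)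
    qed
    moreover have "Q = (\<Sum>m\<in>{m\<in>keys Q. lookup m d = 0} \<union> {m\<in>keys Q. lookup m d \<noteq> 0}. single m (lookup Q m))"
      by (subst mpoly_expand, intro sum.cong) auto
    ultimately have Q: "Q = A + mvar d * B"
      by (subst (asm) sum.union_disjoint) (auto simp: A_def)
    have keysQ: "keys m \<subseteq> {..<Suc d}" if "m \<in> keys Q" for m using mpolysD[OF Suc.prems(1) that] .
    have A: "A \<in> polys d"
      unfolding A_def
    proof (intro is_subring_sum is_subring_polys single_in_mpolys is_subring_UNIV UNIV_I)
      fix m assume "m \<in> {m\<in>keys Q. lookup m d = 0}"
      then show "keys m \<subseteq> {..<d}" using keysQ[of m] by (auto simp: in_keys_iff subset_eq less_Suc_eq)
    qed
    have B: "B \<in> polys (Suc d)"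
      unfolding B_def
      by (intro is_subring_sum is_subring_polys single_in_mpolys is_subring_UNIV UNIV_I
          order_trans[OF keys_diff_nat keysQ]) auto
    have BN: "\<forall>m\<in>keys B. lookup m d < N"
    proof
      fix m assume "m \<in> keys B"
      then obtain k where k: "k \<in> keys Q" "lookup k d \<noteq> 0" "m = k - single d 1"
        using keys_sum[of "\<lambda>m. single (m - single d 1) (lookup Q m)" "{m\<in>keys Q. lookup m d \<noteq> 0}"]
        by (auto simp: B_def split: if_splits)
      then show "lookup m d < N" using Suc.prems(2) by (auto simp: lookup_minus)
    qed
    have sB: "msubst ?y B \<in> polys n" by (rule ev_in[OF is_subring_polys B, of ?y n mconst, folded msubst_def]) (use yR in auto)
    have sA: "msubst ?y A = msubst y A" using A by (rule msubst_cong) auto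
    have sQ: "msubst ?y Q = msubst y A + f * msubst ?y B" by (simp add: Q hom sA)
    then have "msubst y A = msubst ?y Q - f * msubst ?y B" by simp
    moreover have "msubst ?y Q \<in> P'" using Suc.prems(3) P'(2) by blast
    moreover have "f * msubst ?y B \<in> P'" by (rule is_idealD(5)[OF P'(1) sB f(1)])
    ultimately have "msubst y A \<in> P'" using is_ideal_diff[OF is_subring_polys P'(1)] by simp
    then have "A = 0" using ind A by (auto simp: alg_indep_mod_def)
    then have "f * msubst ?y B = msubst ?y Q" unfolding sQ by (simp only: hom(2) add_0)
    then have "f * msubst ?y B \<in> P" using Suc.prems(3) by (simp only:)
    then have "msubst ?y B \<in> P" using is_primeD(3)[OF P fR sB] f(2) by blast
    then have "B = 0" by (rule Suc.IH[OF B BN])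
    then show ?case using \<open>A = 0\<close> Q by simp
  qed
  moreover have "\<exists>N. \<forall>m\<in>keys Q. lookup m d < N" for Q :: "'k mpoly"
    using finite_nat_set_iff_bounded[of "(\<lambda>m. lookup m d) ` keys Q"] by auto
  ultimately show ?thesis unfolding alg_indep_mod_def by blast
qed

text \<open>The coordinates outside \<open>E\<close> are independent modulo \<open>p\<close>, and
  each strict step down a chain adds one independent element. At the bottom there are at most
  \<open>n\<close>, so the chain has at most \<open>card E\<close> steps.\<close>

lemma krull_dim_linear_prime_le:
  fixes G :: "'k::field mpoly set"
  assumes G: "finite G" "\<And>f. f \<in> G \<Longrightarrow> linear_form n f"
  defines "p \<equiv> span_ideal (polys n) G"
  shows "krull_dim (ring_on (localize (polys n) p (polys n))) \<le> enat (card G)"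
proof -
  have prime_p: "is_prime (polys n) p" unfolding p_def by (rule span_linear_forms_prime[OF G])
  interpret localization "polys n" p by unfold_locales (use prime_p in auto)
  obtain \<sigma> \<tau> E where st: "linear_auto n \<sigma> \<tau>" and E: "E \<subseteq> {..<n}" "card E \<le> card G"
    and span: "span_ideal (polys n) (msubst \<tau> ` G) = span_ideal (polys n) (mvar ` E)"
    using linear_auto_span[OF G] by blast
  have GR: "G \<subseteq> polys n" using G linear_formD by blast
  have fE: "finite E" using E(1) finite_subset by blast
  obtain ls where ls: "distinct ls" "set ls = {..<n} - E" using finite_distinct_list[of "{..<n} - E"] by auto
  have lenls: "length ls = n - card E"
    using distinct_card[OF ls(1)] ls(2) E(1) fE by (simp add: card_Diff_subset)
  have cE: "card E \<le> n" using card_mono[OF _ E(1)] by simp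
  define y where "y = (\<lambda>i. msubst \<sigma> (mvar (ls ! i)))"
  have yR: "y i \<in> polys n" if "i < n - card E" for i
    unfolding y_def using that lenls ls(2) nth_mem[of i ls]
    by (intro linear_autoD(5)[OF st] mvar_in_polys) auto
  have ind: "alg_indep_mod p (n - card E) y"
    unfolding alg_indep_mod_def
  proof (intro ballI impI)
    fix Q assume Q: "Q \<in> polys (n - card E)" "msubst y Q \<in> p"
    have "msubst \<tau> (msubst y Q) \<in> span_ideal (polys n) (msubst \<tau> ` G)"
      using Q(2) GR linear_autoD(6)[OF st] unfolding p_def
      by - (rule ring_hom_span_ideal[where A = "polys n", OF ring_hom_on_subset[OF ring_hom_msubst]], auto)
    have "msubst (\<lambda>i. mvar (ls ! i)) Q \<in> span_ideal (polys n) (mvar ` E)"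
    proof -
      have "msubst \<tau> (y i) = mvar (ls ! i)" for i unfolding y_def by (rule linear_autoD(4)[OF st])
      then show ?thesis using \<open>msubst \<tau> (msubst y Q) \<in> _\<close> span by (simp add: msubst_msubst)
    qed
    moreover have "msubst (\<lambda>i. mvar (ls ! i)) Q \<in> polys n"
      unfolding msubst_def using Q(1)
    proof (rule ev_in[OF is_subring_polys])
      fix i assume "i < n - card E"
      then show "mvar (ls ! i) \<in> polys n" using lenls ls(2) nth_mem[of i ls] by (intro mvar_in_polys) auto
    qed simp
    ultimately have "msubst (kill E) (msubst (\<lambda>i. mvar (ls ! i)) Q) = 0"
      using msubst_kill_eq_0_iff[OF E(1)] by blast
    moreover have "msubst (kill E) (msubst (\<lambda>i. mvar (ls ! i)) Q) = msubst (\<lambda>i. mvar (ls ! i)) Q"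
      unfolding msubst_msubst using Q(1)
    proof (rule msubst_cong)
      fix i assume "i < n - card E"
      then have "ls ! i \<notin> E" using lenls ls(2) nth_mem[of i ls] by auto
      then show "msubst (kill E) (mvar (ls ! i)) = mvar (ls ! i)" by (simp add: kill_def)
    qed
    ultimately have z: "msubst (\<lambda>i. mvar (ls ! i)) Q = 0" by simp
    \<comment> \<open>A left inverse of the renaming of variables by \<open>ls\<close>, showing that
      the renaming loses no information.\<close>
    define idx where "idx = (\<lambda>l. mvar (inv_into {..<length ls} ((!) ls) l) :: 'k mpoly)"
    have "msubst idx (msubst (\<lambda>i. mvar (ls ! i)) Q) = msubst mvar Q"
      unfolding msubst_msubst using Q(1)
    proof (rule msubst_cong)
      fix i assume "i < n - card E"
      then have "inv_into {..<length ls} ((!) ls) (ls ! i) = i"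
        using lenls by (intro inv_into_f_f inj_on_nth ls(1)) auto
      then show "msubst idx (mvar (ls ! i)) = mvar i" by (simp add: idx_def)
    qed
    then show "Q = 0" using z by (simp add: msubst_id ring_hom_onD(2)[OF ring_hom_msubst])
  qed
  have "krull_dim (ring_on S) \<le> enat (card E)"
  proof (rule krull_dim_le)
    fix r and P :: "nat \<Rightarrow> 'k mpoly set"
    assume P: "\<And>i. i \<le> r \<Longrightarrow> is_prime (polys n) (P i) \<and> P i \<subseteq> p" and ss: "\<And>i. i < r \<Longrightarrow> P i \<subset> P (Suc i)"
    \<comment> \<open>The induction descends the chain from its top \<open>P r\<close>; after
      \<open>k\<close> steps \<open>k\<close> elements have been gained.\<close>
    have "\<exists>y. (\<forall>i<n - card E + k. y i \<in> polys n) \<and> alg_indep_mod (P (r - k)) (n - card E + k) y" if "k \<le> r" for k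
      using that
    proof (induction k)
      case 0
      have "alg_indep_mod (P r) (n - card E) y" using ind P[of r] by (auto simp: alg_indep_mod_def)
      then show ?case using yR by auto
    next
      case (Suc k)
      then obtain y where y: "\<forall>i<n - card E + k. y i \<in> polys n" "alg_indep_mod (P (r - k)) (n - card E + k) y" by auto
      have e: "Suc (r - Suc k) = r - k" using Suc.prems by simp
      have sub: "P (r - Suc k) \<subset> P (r - k)" using ss[of "r - Suc k"] Suc.prems by (simp only: e)
      then obtain f where f: "f \<in> P (r - k)" "f \<notin> P (r - Suc k)" by auto
      have I: "is_ideal (polys n) (P (r - k))" using P[of "r - k"] is_primeD(1) by auto
      have "alg_indep_mod (P (r - Suc k)) (Suc (n - card E + k)) (y(n - card E + k := f))"
        using sub f y P[of "r - Suc k"] by (intro alg_indep_step[OF _ I]) auto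
      moreover have "\<forall>i<Suc (n - card E + k). (y(n - card E + k := f)) i \<in> polys n"
        using y(1) is_idealD(1)[OF I f(1)] by auto
      ultimately show ?case unfolding add_Suc_right by blast
    qed
    from this[of r] obtain y where y: "\<forall>i<n - card E + r. y i \<in> polys n" "alg_indep_mod (P 0) (n - card E + r) y"
      by auto
    have "0 \<in> P 0" using P[of 0] is_primeD(1) is_idealD(2) by blast
    then have "alg_indep_mod {0} (n - card E + r) y" using y(2) by (auto simp: alg_indep_mod_def)
    then have "n - card E + r \<le> n" using y(1) by (intro alg_indep_le) auto
    then show "r \<le> card E" using cE by simp
  qed
  then show ?thesis using E(2) by (meson enat_ord_simps(1) order_trans)
qed

section \<open>Dimension and number of generators at primes of the first kind\<close>

context star_prime
begin

text \<open>The ideals generated by the initial segments of an enumeration of \<open>B\<close> are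
  prime because they are generated by linear forms, and they increase strictly by
  independence.\<close>

lemma krull_dim_ge_card:
  assumes B: "B \<subseteq> Fp" "lin_indep n B"
  shows "enat (card B) \<le> krull_dim (ring_on S)"
proof -
  have fB: "finite B" using B(1) Fp_subset(3) finite_subset by blast
  then obtain bs where bs: "distinct bs" "set bs = B" using finite_distinct_list by blast
  have "enat (length bs) \<le> krull_dim (ring_on S)"
  proof (rule krull_dim_ge[of _ "\<lambda>i. span_ideal R (set (take i bs))"])
    fix i assume "i \<le> length bs"
    have sub: "set (take i bs) \<subseteq> Fp" using set_take_subset[of i bs] bs(2) B(1) by blast
    then show "is_prime R (span_ideal R (set (take i bs))) \<and> span_ideal R (set (take i bs)) \<subseteq> p"
      using Fp_subset prime_span span_ideal_least[OF is_primeD(1)[OF prime_p]] by (meson order_trans)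
  next
    fix i assume i: "i < length bs"
    have "bs ! i \<notin> set (take i bs)"
      using i bs(1) by (auto simp: in_set_conv_nth nth_eq_iff_index_eq)
    then have "bs ! i \<notin> span_ideal R (set (take i bs))"
      using i bs(2) set_take_subset[of i bs] by (intro lin_indep_not_in_span[OF B(2)]) auto
    moreover have "bs ! i \<in> span_ideal R (set (take (Suc i) bs))"
      using i by (intro subsetD[OF span_ideal_superset]) (auto simp: take_Suc_conv_app_nth)
    moreover have "span_ideal R (set (take i bs)) \<subseteq> span_ideal R (set (take (Suc i) bs))"
      by (intro span_ideal_mono set_take_subset_set_take) simp
    ultimately show "span_ideal R (set (take i bs)) \<subset> span_ideal R (set (take (Suc i) bs))" by blast
  qed
  then show ?thesis using bs distinct_card by metis
qed

lemma min_gens_le_loc_gens: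
  assumes "c \<le> Suc (card Fp)"
  shows "min_gens (ring_on S) (localize R p (star_ideal n c F)) \<le> enat (card loc_gens)"
proof -
  have fin: "finite loc_gens"
    using Fp_subset(3) by (auto simp: loc_gens_def intro: finite_subset[of _ "Pow Fp"])
  have "min_gens (ring_on S) (localize R p (star_ideal n c F)) \<le> enat (card (emb ` loc_gens))"
    unfolding min_gens_def genideal_ring_on[OF is_subring_S]
    using fin localize_star[OF assms] loc_gens_R emb_in_localize by (intro INF_lower) auto
  also have "\<dots> \<le> enat (card loc_gens)" using card_image_le[OF fin] by simp
  finally show ?thesis .
qed

lemma min_gens_le_dim:
  assumes "c \<le> card Fp" "c = 1 \<or> card Fp = c \<or> c = 2 \<and> lin_indep n Fp"
  shows "min_gens (ring_on S) (localize R p (star_ideal n c F)) \<le> krull_dim (ring_on S)"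
proof -
  have "enat (card loc_gens) \<le> krull_dim (ring_on S)"
    using assms(2)
  proof (elim disjE)
    assume c: "c = 1"
    then obtain f where "f \<in> Fp" using assms(1) by fastforce
    then show ?thesis
      using krull_dim_ge_card[of "{f}"] indep[of "{f}"] Fp_subset(1) loc_gens_1[OF c] by auto
  next
    assume t: "card Fp = c"
    then show ?thesis using krull_dim_ge_card[of Fp] indep[of Fp] Fp_subset(1) loc_gens_ci by auto
  next
    assume c: "c = 2 \<and> lin_indep n Fp"
    have "enat (card loc_gens) \<le> enat (card Fp)"
      using loc_gens_2 c card_image_le[OF Fp_subset(3)] by simp
    then show ?thesis using krull_dim_ge_card[of Fp] c order_trans by blast
  qed
  then show ?thesis using min_gens_le_loc_gens assms(1) order_trans le_SucI by blast
qed

lemma linear_type_good: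
  assumes "c = 1 \<or> card Fp \<le> c \<or> c = 2 \<and> lin_indep n Fp"
  shows "linear_type S (localize R p (star_ideal n c F))"
  using assms linear_type_small linear_type_1 linear_type_ci linear_type_2
  by (metis card.empty not_numeral_le_zero nat_less_le leI)

end

section \<open>Functionals on the localized ideal\<close>

lemma ring_hom_on_comp_ev:
  assumes h: "ring_hom_on A h" and f: "f \<in> mpolys S n" and \<sigma>: "\<And>i. i < n \<Longrightarrow> \<sigma> i \<in> A"
    and \<kappa>: "\<And>c. c \<in> S \<Longrightarrow> \<kappa> c \<in> A"
  shows "h (ev \<kappa> \<sigma> f) = ev (\<lambda>c. h (\<kappa> c)) (\<lambda>i. h (\<sigma> i)) f"
proof -
  note A = ring_hom_onD(1)[OF h]
  have m: "monom_eval \<sigma> m \<in> A \<and> h (monom_eval \<sigma> m) = monom_eval (\<lambda>i. h (\<sigma> i)) m" if "m \<in> keys f" for m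
  proof -
    have "\<sigma> i \<in> A" if "i \<in> keys m" for i using mpolysD[OF f \<open>m \<in> keys f\<close>] that \<sigma> by auto
    then show ?thesis
      unfolding monom_eval_def
      by (auto simp: ring_hom_on_prod[OF h] ring_hom_on_power[OF h] is_subring_power[OF A]
          intro!: is_subring_prod[OF A])
  qed
  have c: "\<kappa> (lookup f m) \<in> A" if "m \<in> keys f" for m using that f \<kappa> by (auto simp: mpolys_def)
  have "h (ev \<kappa> \<sigma> f) = (\<Sum>m\<in>keys f. h (\<kappa> (lookup f m) * monom_eval \<sigma> m))"
    unfolding ev_def using m c by (intro ring_hom_on_sum[OF h]) (auto intro: is_subringD(4)[OF A])
  also have "\<dots> = (\<Sum>m\<in>keys f. h (\<kappa> (lookup f m)) * monom_eval (\<lambda>i. h (\<sigma> i)) m)"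
    using m c by (intro sum.cong refl) (auto simp: ring_hom_onD(5)[OF h])
  finally show ?thesis by (simp add: ev_def)
qed

lemma ev_linear_combination:
  fixes b :: "nat \<Rightarrow> 'a::comm_ring_1"
  assumes \<kappa>: "ring_hom_on S \<kappa>" and b: "\<And>i. i < t \<Longrightarrow> b i \<in> S"
  shows "ev \<kappa> \<sigma> (\<Sum>i<t. mconst (b i) * mvar i) = (\<Sum>i<t. \<kappa> (b i) * \<sigma> i)"
proof -
  note S = ring_hom_onD(1)[OF \<kappa>]
  have c: "mconst (b i) \<in> coeffs_in S" "mvar i \<in> coeffs_in S" if "i < t" for i
    using b[OF that] is_subringD(1)[OF S] by (auto simp: mconst_def mvar_def intro: single_in_coeffs_in[OF S])
  have "ev \<kappa> \<sigma> (\<Sum>i<t. mconst (b i) * mvar i) = (\<Sum>i<t. ev \<kappa> \<sigma> (mconst (b i) * mvar i))"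
    using c by (intro ev_sum[OF \<kappa>] coeffs_in_mult[OF S]) auto
  also have "\<dots> = (\<Sum>i<t. \<kappa> (b i) * \<sigma> i)"
    using c by (intro sum.cong refl) (simp add: ev_mult[OF \<kappa>] ev_mconst[OF \<kappa>] ev_mvar[OF \<kappa>])
  finally show ?thesis .
qed

text \<open>An \<open>S\<close>-linear map on the ideal, its target being a module through
  \<open>\<pi>\<close>.\<close>

definition semilinear :: "'a::comm_ring_1 set \<Rightarrow> ('a \<Rightarrow> 'd::comm_ring_1) \<Rightarrow> 'a set \<Rightarrow> ('a \<Rightarrow> 'd) \<Rightarrow> bool" where
  "semilinear S \<pi> I \<phi> \<longleftrightarrow> (\<forall>x\<in>I. \<forall>y\<in>I. \<phi> (x + y) = \<phi> x + \<phi> y) \<and> (\<forall>r\<in>S. \<forall>x\<in>I. \<phi> (r * x) = \<pi> r * \<phi> x)"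

lemma semilinear_combination:
  assumes \<phi>: "semilinear S \<pi> I \<phi>" and S: "is_subring S" and \<pi>: "ring_hom_on S \<pi>" and I: "is_ideal S I"
    and ag: "\<And>i. i \<in> Z \<Longrightarrow> a i \<in> S" "\<And>i. i \<in> Z \<Longrightarrow> g i \<in> I"
  shows "\<phi> (\<Sum>i\<in>Z. a i * g i) = (\<Sum>i\<in>Z. \<pi> (a i) * \<phi> (g i))"
proof -
  have z: "\<phi> 0 = 0"
    using \<phi> is_idealD(2)[OF I] by (force simp: semilinear_def)
  show ?thesis using ag
  proof (induction Z rule: infinite_finite_induct)
    case (insert i Z)
    have "(\<Sum>i\<in>Z. a i * g i) \<in> I" using insert by (intro is_ideal_sum[OF I] is_idealD(4)[OF I]) auto
    moreover have "a i * g i \<in> I" using insert by (intro is_idealD(4)[OF I]) auto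
    ultimately show ?case using insert \<phi> by (simp add: semilinear_def)
  qed (auto simp: z)
qed

text \<open>The kernel is generated by linear relations, and functionals respect those.\<close>

lemma linear_type_relation:
  fixes S :: "'a::comm_ring_1 set" and e :: "nat \<Rightarrow> 'a" and \<phi> :: "'a \<Rightarrow> 'd::comm_ring_1"
  assumes S: "is_subring S" and lt: "linear_type S I"
    and \<pi>: "ring_hom_on S \<pi>" and \<phi>: "semilinear S \<pi> I \<phi>"
    and e: "\<And>j. j < t \<Longrightarrow> e j \<in> I"
    and Q: "Q \<in> mpolys S t" "ev (\<lambda>c. [:c:]) (\<lambda>j. monom (e j) 1) Q = 0"
  shows "ev \<pi> (\<lambda>j. \<phi> (e j)) Q = 0"
proof -
  obtain gs L where gs: "set gs \<subseteq> S" and I: "I = span_ideal S (set gs)"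
    and L: "L \<subseteq> rees_kernel S gs" "\<And>f. f \<in> L \<Longrightarrow> homogeneous 1 f"
    and K: "rees_kernel S gs = span_ideal (mpolys S (length gs)) L"
    using lt unfolding linear_type_def genideal_ring_on[OF S] genideal_ring_on[OF is_subring_mpolys[OF S]]
    by blast
  define \<mu> where "\<mu> = length gs"
  note X = is_subring_mpolys[OF S, of \<mu>]
  have II: "is_ideal S I" unfolding I by (rule span_ideal_is_ideal[OF S gs])
  have gI: "gs ! i \<in> I" if "i < \<mu>" for i
    using that span_ideal_superset[of "set gs" S] by (auto simp: I \<mu>_def)
  have "set gs = (!) gs ` {..<\<mu>}" by (auto simp: set_conv_nth \<mu>_def)
  then have I': "I = {\<Sum>i<\<mu>. a i * gs ! i | a. \<forall>i\<in>{..<\<mu>}. a i \<in> S}"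
    using span_ideal_finite[OF S, of "{..<\<mu>}" "(!) gs"] gs by (auto simp: I \<mu>_def)
  have "\<forall>j\<in>{..<t}. \<exists>a. e j = (\<Sum>i<\<mu>. a i * gs ! i) \<and> (\<forall>i\<in>{..<\<mu>}. a i \<in> S)"
    using e unfolding I' by blast
  from bchoice[OF this] obtain a where a: "\<And>j. j < t \<Longrightarrow> e j = (\<Sum>i<\<mu>. a j i * gs ! i)"
    "\<And>j i. j < t \<Longrightarrow> i < \<mu> \<Longrightarrow> a j i \<in> S" by auto
  \<comment> \<open>The linear form \<open>l j\<close> in the unknown generators is a lift of
    \<open>e j\<close>. Substituting the lifts into \<open>Q\<close> produces the element
    \<open>q\<close> of the Rees kernel.\<close>
  define l where "l j = (\<Sum>i<\<mu>. mconst (a j i) * mvar i)" for j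
  have lX: "l j \<in> mpolys S \<mu>" if "j < t" for j
    unfolding l_def using a(2)[OF that]
    by (intro is_subring_sum[OF X] is_subringD(4)[OF X] mconst_in_mpolys mvar_in_mpolys S) auto
  define q where "q = ev mconst l Q"
  have qX: "q \<in> mpolys S \<mu>" unfolding q_def
    by (rule ev_in[OF X Q(1) lX]) (auto intro: mconst_in_mpolys S)
  note homP = ring_hom_ev[OF ring_hom_const_poly]
  let ?\<rho> = "ev (\<lambda>c. [:c:]) (\<lambda>i. monom (gs ! i) 1)"
  note lin = ev_linear_combination[where t = \<mu>]
  have monom_sum: "(\<Sum>i<\<mu>. [:b i:] * monom (gs ! i) 1) = monom (\<Sum>i<\<mu>. b i * gs ! i) 1" for b
    by (rule poly_eqI) (auto simp: coeff_sum smult_monom intro!: sum.neutral)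
  have \<rho>l: "?\<rho> (l j) = monom (e j) 1" if "j < t" for j
  proof -
    have "?\<rho> (l j) = (\<Sum>i<\<mu>. [:a j i:] * monom (gs ! i) 1)"
      unfolding l_def
      by (rule lin[OF ring_hom_on_subset[OF ring_hom_const_poly S subset_UNIV]]) (rule a(2)[OF that])
    then show ?thesis unfolding monom_sum using a(1)[OF that] by simp
  qed
  have "?\<rho> q = ev (\<lambda>c. ?\<rho> (mconst c)) (\<lambda>j. ?\<rho> (l j)) Q"
    unfolding q_def by (rule ring_hom_comp_ev[OF homP])
  also have "\<dots> = ev (\<lambda>c. [:c:]) (\<lambda>j. monom (e j) 1) Q"
    unfolding ev_mconst[OF ring_hom_const_poly] using Q(1) \<rho>l by (rule ev_cong)
  finally have "q \<in> rees_kernel S gs"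
    using qX Q(2) by (simp add: rees_kernel_eq rees_map_eq_ev[of q S] \<mu>_def)
  \<comment> \<open>Evaluating at the functional values of the generators sends the linear form of
    any combination to the functional of that combination. So it kills linear relations, hence the
    ideal they generate, and it sends \<open>q\<close> to the asserted value.\<close>
  moreover define \<theta> where "\<theta> = ev \<pi> (\<lambda>i. \<phi> (gs ! i))"
  have \<theta>: "ring_hom_on (mpolys S \<mu>) \<theta>" unfolding \<theta>_def by (rule ring_hom_on_ev[OF \<pi>])
  have comb: "(\<Sum>i<\<mu>. \<pi> (b i) * \<phi> (gs ! i)) = \<phi> (\<Sum>i<\<mu>. b i * gs ! i)" if "\<And>i. i < \<mu> \<Longrightarrow> b i \<in> S" for b
    using that gI by (intro semilinear_combination[OF \<phi> S \<pi> II, symmetric]) auto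
  have "span_ideal (mpolys S \<mu>) L \<subseteq> {f \<in> mpolys S \<mu>. \<theta> f = 0}"
  proof (rule span_ideal_least)
    show "is_ideal (mpolys S \<mu>) {f \<in> mpolys S \<mu>. \<theta> f = 0}"
      using is_subringD[OF X] ring_hom_onD[OF \<theta>] by (auto simp: is_ideal_def)
    show "L \<subseteq> {f \<in> mpolys S \<mu>. \<theta> f = 0}"
    proof
      fix f assume f: "f \<in> L"
      then have fX: "f \<in> mpolys S \<mu>" and \<rho>f: "?\<rho> f = 0"
        using L(1) by (auto simp: rees_kernel_eq rees_map_eq_ev[of _ S] \<mu>_def)
      define b where "b i = lookup f (single i 1)" for i
      have bS: "b i \<in> S" for i
        using mpolys_subset_coeffs_in[OF S, of \<mu>] fX by (auto simp: b_def coeffs_in_def)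
      have "linear_form \<mu> f"
        using L(2)[OF f] fX by (auto simp: linear_form_def mpolys_def)
      then have fb: "f = (\<Sum>i<\<mu>. mconst (b i) * mvar i)" unfolding b_def by (rule linear_form_expand)
      have "?\<rho> f = (\<Sum>i<\<mu>. [:b i:] * monom (gs ! i) 1)"
        unfolding fb by (rule lin[OF ring_hom_on_subset[OF ring_hom_const_poly S subset_UNIV] bS])
      then have "0 = monom (\<Sum>i<\<mu>. b i * gs ! i) 1"
        unfolding monom_sum \<rho>f .
      then have z: "(\<Sum>i<\<mu>. b i * gs ! i) = 0" by (metis monom_eq_0_iff)
      have "\<phi> 0 = 0" using comb[of "\<lambda>_. 0"] is_subringD(2)[OF S] ring_hom_onD(2)[OF \<pi>] by simp
      then have "\<theta> f = 0"
        unfolding \<theta>_def fb using lin[OF \<pi>, of b] comb[of b] bS z by simp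
      then show "f \<in> {f \<in> mpolys S \<mu>. \<theta> f = 0}" using fX by simp
    qed
  qed
  ultimately have "\<theta> q = 0" using K by (auto simp: \<mu>_def)
  moreover have "\<theta> q = ev (\<lambda>c. \<theta> (mconst c)) (\<lambda>j. \<theta> (l j)) Q"
    unfolding q_def by (rule ring_hom_on_comp_ev[OF \<theta> Q(1) lX]) (auto intro: mconst_in_mpolys S)
  moreover have "\<dots> = ev \<pi> (\<lambda>j. \<phi> (e j)) Q"
  proof -
    have "\<theta> (l j) = \<phi> (e j)" if "j < t" for j
    proof -
      have "\<theta> (l j) = (\<Sum>i<\<mu>. \<pi> (a j i) * \<phi> (gs ! i))"
        unfolding \<theta>_def l_def by (rule lin[OF \<pi> a(2)[OF that]])
      then show ?thesis using comb[of "a j"] a that by simp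
    qed
    moreover have "\<theta> (mconst c) = \<pi> c" for c unfolding \<theta>_def by (rule ev_mconst[OF \<pi>])
    ultimately show ?thesis
      using ev_cong[OF Q(1), of "\<lambda>j. \<theta> (l j)" "\<lambda>j. \<phi> (e j)" \<pi>] by simp
  qed
  ultimately show ?thesis by simp
qed

text \<open>The functionals are dual, up to nonzero factors, to the elements \<open>e h\<close>.
  Through fewer generators than functionals the \<open>e h\<close> would become dependent, and the
  functionals detect every coefficient of such a dependency.\<close>

lemma min_gens_ge:
  fixes S :: "'a::comm_ring_1 set" and \<phi> :: "'h \<Rightarrow> 'a \<Rightarrow> 'd::field"
  assumes S: "is_subring S" and \<pi>: "ring_hom_on S \<pi>" and H: "finite \<H>"
    and \<phi>: "\<And>h. h \<in> \<H> \<Longrightarrow> semilinear S \<pi> I (\<phi> h)"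
    and e: "\<And>h. h \<in> \<H> \<Longrightarrow> e h \<in> I"
    and \<delta>: "\<And>h h'. h \<in> \<H> \<Longrightarrow> h' \<in> \<H> \<Longrightarrow> \<phi> h (e h') = 0 \<longleftrightarrow> h \<noteq> h'"
  shows "enat (card \<H>) \<le> min_gens (ring_on S) I"
  unfolding min_gens_def genideal_ring_on[OF S]
proof (rule INF_greatest)
  fix G assume "G \<in> {G. finite G \<and> G \<subseteq> carrier (ring_on S) \<and> I = span_ideal S G}"
  then have G: "finite G" "G \<subseteq> S" and I: "I = span_ideal S G" by auto
  have II: "is_ideal S I" unfolding I by (rule span_ideal_is_ideal[OF S G(2)])
  have GI: "g \<in> I" if "g \<in> G" for g using that span_ideal_superset[of G S] by (auto simp: I)
  have I': "I = {\<Sum>g\<in>G. a g * g | a. \<forall>g\<in>G. a g \<in> S}"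
    using span_ideal_finite[OF S G(1), of "\<lambda>x. x"] G(2) by (auto simp: I)
  have "\<forall>h\<in>\<H>. \<exists>a. e h = (\<Sum>g\<in>G. a g * g) \<and> (\<forall>g\<in>G. a g \<in> S)"
    using e unfolding I' by blast
  from bchoice[OF this] obtain a where a: "\<And>h. h \<in> \<H> \<Longrightarrow> e h = (\<Sum>g\<in>G. a h g * g)"
    "\<And>h g. h \<in> \<H> \<Longrightarrow> g \<in> G \<Longrightarrow> a h g \<in> S" by auto
  have "card \<H> \<le> card G"
  proof (rule ccontr)
    assume "\<not> ?thesis"
    then have "card G < card \<H>" by simp
    \<comment> \<open>A combination of the \<open>e h\<close>, with coefficients in the field, whose
      image under \<open>\<pi>\<close> cancels at every generator in \<open>G\<close>.\<close>
    from underdetermined_system[OF G(1) H this, of "\<lambda>g h. \<pi> (a h g)"]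
    obtain z where z: "\<exists>h\<in>\<H>. z h \<noteq> 0" "\<And>g. g \<in> G \<Longrightarrow> (\<Sum>h\<in>\<H>. \<pi> (a h g) * z h) = 0" by blast
    have "z h = 0" if h: "h \<in> \<H>" for h
    proof -
      have "(\<Sum>k\<in>\<H>. z k * \<phi> h (e k)) = (\<Sum>k\<in>\<H>. z k * (\<Sum>g\<in>G. \<pi> (a k g) * \<phi> h g))"
      proof (intro sum.cong refl)
        fix k assume k: "k \<in> \<H>"
        show "z k * \<phi> h (e k) = z k * (\<Sum>g\<in>G. \<pi> (a k g) * \<phi> h g)"
          unfolding a(1)[OF k] using a(2)[OF k] GI semilinear_combination[OF \<phi>[OF h] S \<pi> II, of G "a k" "\<lambda>x. x"] by simp
      qed
      also have "\<dots> = (\<Sum>g\<in>G. (\<Sum>k\<in>\<H>. \<pi> (a k g) * z k) * \<phi> h g)"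
        unfolding sum_distrib_left sum_distrib_right by (subst sum.swap) (simp add: ac_simps)
      also have "\<dots> = 0" using z(2) by simp
      finally have "(\<Sum>k\<in>\<H>. z k * \<phi> h (e k)) = 0" .
      moreover have "(\<Sum>k\<in>\<H>. z k * \<phi> h (e k)) = z h * \<phi> h (e h) + (\<Sum>k\<in>\<H> - {h}. z k * \<phi> h (e k))"
        by (rule sum.remove[OF H h])
      moreover have "(\<Sum>k\<in>\<H> - {h}. z k * \<phi> h (e k)) = 0" using \<delta>[OF h] by (intro sum.neutral) auto
      ultimately show ?thesis using \<delta>[OF h h] by simp
    qed
    then show False using z(1) by blast
  qed
  then show "enat (card \<H>) \<le> enat (card G)" by simp
qed

section \<open>Localizations of star configurations not of linear type\<close>

text \<open>Pascal's rule propagates the strict inequality from the boundary case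
  \<open>k + 2 = t\<close>, where symmetry turns the coefficient into the number of pairs. It is
  applied with \<open>k = c - 1\<close>.\<close>

lemma choose_gt:
  assumes "2 \<le> k" "k + 2 \<le> t"
  shows "t < t choose k"
  using assms
proof (induction t arbitrary: k)
  case (Suc t)
  show ?case
  proof (cases "k + 2 = Suc t")
    case True
    have "Suc t choose k = Suc t choose (Suc t - k)"
      using Suc.prems by (intro binomial_symmetric) simp
    moreover have "Suc t - k = 2" using True by simp
    ultimately have choose: "Suc t choose k = Suc t choose 2" by (simp only:)
    have "t \<ge> 3" using True Suc.prems by simp
    then obtain j where "t = j + 3" using le_add_diff_inverse2 by metis
    then have "Suc (Suc t) * 2 \<le> Suc t * t" by (simp add: algebra_simps)
    then have "Suc t < Suc t * t div 2" using div_le_mono[of "Suc (Suc t) * 2" "Suc t * t" 2] by simp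
    then show ?thesis unfolding choose by (simp add: choose_two mult.commute)
  next
    case False
    then have "t < t choose k" using Suc by simp
    obtain j where j: "k = Suc j" using Suc.prems by (cases k) auto
    have "Suc t choose k = (t choose j) + (t choose k)" by (simp add: j)
    moreover have "0 < t choose j" using Suc.prems j by simp
    ultimately show ?thesis using \<open>t < t choose k\<close> by linarith
  qed
qed simp

text \<open>The coefficient map is left open because the quadric is evaluated twice: at the
  generators in the Rees algebra, where it vanishes, and at the values of a functional, where it
  does not.\<close>

lemma ev_quadric:
  assumes \<kappa>: "ring_hom_on S \<kappa>"
  shows "mvar 0 * mvar 1 - mvar 2 * mvar 3 \<in> mpolys S 4"
    and "ev \<kappa> \<sigma> (mvar 0 * mvar 1 - mvar 2 * mvar 3) = \<sigma> 0 * \<sigma> 1 - \<sigma> 2 * \<sigma> 3"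
proof -
  note S = ring_hom_onD(1)[OF \<kappa>]
  note T = is_subringD[OF is_subring_mpolys[OF S]]
  note hom = ring_hom_onD[OF ring_hom_on_ev[OF \<kappa>, of 4]]
  have v: "mvar j \<in> mpolys S 4" if "j < 4" for j using that by (intro mvar_in_mpolys S)
  have p: "mvar i * mvar j \<in> mpolys S 4" if "i < 4" "j < 4" for i j using that by (intro T v)
  show "mvar 0 * mvar 1 - mvar 2 * mvar 3 \<in> mpolys S 4" by (intro T(3) p) auto
  have "ev \<kappa> \<sigma> (mvar i * mvar j) = \<sigma> i * \<sigma> j" if "i < 4" "j < 4" for i j
    unfolding hom(5)[OF v[OF that(1)] v[OF that(2)]] by (simp add: ev_mvar[OF \<kappa>])
  moreover have "ev \<kappa> \<sigma> (mvar 0 * mvar 1 - mvar 2 * mvar 3) = ev \<kappa> \<sigma> (mvar 0 * mvar 1) - ev \<kappa> \<sigma> (mvar 2 * mvar 3)"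
    by (intro hom(7) p) auto
  ultimately show "ev \<kappa> \<sigma> (mvar 0 * mvar 1 - mvar 2 * mvar 3) = \<sigma> 0 * \<sigma> 1 - \<sigma> 2 * \<sigma> 3" by simp
qed

lemma ev_circuit:
  assumes \<kappa>: "ring_hom_on S \<kappa>" and b: "\<And>i. i \<in> B \<Longrightarrow> b i \<in> S"
    and sub: "A \<subseteq> {..<t}" "\<And>i. i \<in> B \<Longrightarrow> C i \<subseteq> {..<t}"
  shows "(\<Prod>j\<in>A. mvar j) - (\<Sum>i\<in>B. mconst (b i) * (\<Prod>j\<in>C i. mvar j)) \<in> mpolys S t" (is "?P - ?Q \<in> _")
    and "ev \<kappa> \<sigma> ((\<Prod>j\<in>A. mvar j) - (\<Sum>i\<in>B. mconst (b i) * (\<Prod>j\<in>C i. mvar j))) =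
      (\<Prod>j\<in>A. \<sigma> j) - (\<Sum>i\<in>B. \<kappa> (b i) * (\<Prod>j\<in>C i. \<sigma> j))"
proof -
  note S = ring_hom_onD(1)[OF \<kappa>]
  note X = is_subring_mpolys[OF S, of t]
  note h = ring_hom_on_ev[OF \<kappa>, of t]
  have prods: "(\<Prod>j\<in>Z. mvar j) \<in> mpolys S t" "ev \<kappa> \<sigma> (\<Prod>j\<in>Z. mvar j) = (\<Prod>j\<in>Z. \<sigma> j)"
    if "Z \<subseteq> {..<t}" for Z
  proof -
    have v: "mvar j \<in> mpolys S t" if "j \<in> Z" for j
      using that \<open>Z \<subseteq> {..<t}\<close> by (intro mvar_in_mpolys S) auto
    show "(\<Prod>j\<in>Z. mvar j) \<in> mpolys S t" by (rule is_subring_prod[OF X v])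
    show "ev \<kappa> \<sigma> (\<Prod>j\<in>Z. mvar j) = (\<Prod>j\<in>Z. \<sigma> j)"
      using ring_hom_on_prod[OF h v, of Z "\<lambda>j. j"] by (simp add: ev_mvar[OF \<kappa>])
  qed
  have t: "mconst (b i) * (\<Prod>j\<in>C i. mvar j) \<in> mpolys S t"
    "ev \<kappa> \<sigma> (mconst (b i) * (\<Prod>j\<in>C i. mvar j)) = \<kappa> (b i) * (\<Prod>j\<in>C i. \<sigma> j)" if "i \<in> B" for i
  proof -
    have c: "mconst (b i) \<in> mpolys S t" by (rule mconst_in_mpolys[OF S b[OF that]])
    show "mconst (b i) * (\<Prod>j\<in>C i. mvar j) \<in> mpolys S t"
      by (rule is_subringD(4)[OF X c prods(1)[OF sub(2)[OF that]]])
    show "ev \<kappa> \<sigma> (mconst (b i) * (\<Prod>j\<in>C i. mvar j)) = \<kappa> (b i) * (\<Prod>j\<in>C i. \<sigma> j)"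
      unfolding ring_hom_onD(5)[OF h c prods(1)[OF sub(2)[OF that]]] prods(2)[OF sub(2)[OF that]] ev_mconst[OF \<kappa>] ..
  qed
  have Q: "?Q \<in> mpolys S t" by (rule is_subring_sum[OF X t(1)])
  show "?P - ?Q \<in> mpolys S t" by (rule is_subringD(3)[OF X prods(1)[OF sub(1)] Q])
  have "ev \<kappa> \<sigma> ?Q = (\<Sum>i\<in>B. ev \<kappa> \<sigma> (mconst (b i) * (\<Prod>j\<in>C i. mvar j)))"
    by (rule ring_hom_on_sum[OF h t(1)])
  also have "\<dots> = (\<Sum>i\<in>B. \<kappa> (b i) * (\<Prod>j\<in>C i. \<sigma> j))" by (rule sum.cong[OF refl t(2)])
  finally have "ev \<kappa> \<sigma> ?Q = (\<Sum>i\<in>B. \<kappa> (b i) * (\<Prod>j\<in>C i. \<sigma> j))" .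
  moreover have "ev \<kappa> \<sigma> (?P - ?Q) = ev \<kappa> \<sigma> ?P - ev \<kappa> \<sigma> ?Q"
    by (rule ring_hom_onD(7)[OF h prods(1)[OF sub(1)] Q])
  ultimately show "ev \<kappa> \<sigma> (?P - ?Q) = (\<Prod>j\<in>A. \<sigma> j) - (\<Sum>i\<in>B. \<kappa> (b i) * (\<Prod>j\<in>C i. \<sigma> j))"
    using prods(2)[OF sub(1)] by simp
qed

lemma prod_monom_1: "(\<Prod>j\<in>Z. monom (e j) 1) = monom (\<Prod>j\<in>Z. e j) (card Z)"
  by (induction Z rule: infinite_finite_induct) (auto simp: mult_monom)

locale star_linear_prime = star_prime n c F p for n c :: nat and F :: "'k::field mpoly set" and p +
  assumes p_span: "p = span_ideal (polys n) Fp" and c_le: "c \<le> card Fp"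
begin

section \<open>Leading forms and functionals at a prime generated by members of the
  configuration\<close>

definition omits :: "'k mpoly set set" where
  "omits = {H. H \<subseteq> Fp \<and> Suc (card H) = c}"

abbreviation I :: "'k mpoly set" where "I \<equiv> star_ideal n c F"

lemma finite_omits: "finite omits"
  using Fp_subset(3) by (auto simp: omits_def intro: finite_subset[of _ "Pow Fp"])

lemma card_omits: "card omits = card Fp choose (c - 1)"
proof -
  have "omits = {H. H \<subseteq> Fp \<and> card H = c - 1}" using F(4) by (auto simp: omits_def)
  then show ?thesis using n_subsets[OF Fp_subset(3)] by simp
qed

lemma card_compl: "H \<in> omits \<Longrightarrow> card (Fp - H) = card Fp - (c - 1)"
  using F(4) finite_subset[OF _ Fp_subset(3), of H] by (auto simp: omits_def card_Diff_subset)

lemma emb_omit_in: "H \<in> omits \<Longrightarrow> emb (\<Prod>(Fp - H)) \<in> localize R p I"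
  using localize_star c_le span_ideal_superset[of "emb ` loc_gens" S]
  by (auto simp: omits_def loc_gens_def)

lemma prod_omit:
  assumes "H \<in> omits"
  shows "\<Prod>(F - H) = \<Prod>(F - Fp) * \<Prod>(Fp - H)"
proof -
  have "\<Prod>(F - H) = \<Prod>((F - H) - (Fp - H)) * \<Prod>(Fp - H)"
    using F(1) Fp_subset(1) by (intro prod.subset_diff) auto
  also have "(F - H) - (Fp - H) = F - Fp" using assms by (auto simp: omits_def)
  finally show ?thesis .
qed

text \<open>The functional belonging to \<open>H\<close> sends an element of the ideal to its leading form along
  \<open>p\<close>, reduced modulo \<open>H\<close>.\<close>

lemma leading_form_functional:
  assumes \<pi>: "\<And>i. i < n \<Longrightarrow> linear_form n (\<pi> i)" "\<And>f. f \<in> R \<Longrightarrow> msubst \<pi> f = 0 \<longleftrightarrow> f \<in> p" and H: "H \<in> omits"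
  obtains \<phi> where "semilinear R (msubst \<pi>) I \<phi>" "\<And>H'. H' \<in> omits \<Longrightarrow> \<phi> (\<Prod>(F - H')) = 0 \<longleftrightarrow> H' \<noteq> H"
proof -
  have HF: "H \<subseteq> Fp" "card H < c" using H by (auto simp: omits_def)
  have HFF: "H \<subseteq> F" using HF(1) Fp_subset(1) by auto
  \<comment> \<open>\<open>\<rho>\<close> is the reduction modulo the forms in \<open>H\<close>, as
    \<open>\<pi>\<close> is the reduction modulo \<open>p\<close>.\<close>
  obtain \<rho> where \<rho>: "\<And>f. f \<in> R \<Longrightarrow> msubst \<rho> f = 0 \<longleftrightarrow> f \<in> span_ideal R H"
    using linear_projection[of H n] HFF finite_sub[OF HFF] F(2) by blast
  define d where "d = card Fp - (c - 1)"
  \<comment> \<open>Every variable is sent to its projection along \<open>p\<close> plus an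
    infinitesimal times its reduction modulo \<open>H\<close>. The constant term of the image is
    reduction modulo \<open>p\<close>, and forms in \<open>p\<close> have only the infinitesimal
    part, so the order of the image bounds the order along \<open>p\<close>.\<close>
  define \<Psi> where "\<Psi> = ev (\<lambda>c. [:mconst c:]) (\<lambda>l. [:\<pi> l, \<rho> l:])"
  have hom\<kappa>: "ring_hom_on UNIV (\<lambda>c. [:mconst c:] :: 'k mpoly poly)"
    by (rule ring_hom_comp[OF ring_hom_const_poly ring_hom_mconst])
  have hom: "ring_hom_on UNIV \<Psi>" unfolding \<Psi>_def by (rule ring_hom_ev[OF hom\<kappa>])
  note \<Psi> = ring_hom_onD[OF hom, simplified]
  have hom0: "ring_hom_on UNIV (\<lambda>q :: 'k mpoly poly. poly.coeff q 0)"
    by (auto simp: ring_hom_on_def coeff_mult_0)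
  have \<Psi>0: "poly.coeff (\<Psi> f) 0 = msubst \<pi> f" for f
    unfolding \<Psi>_def ring_hom_comp_ev[OF hom0] msubst_def by simp
  have \<Psi>_lin: "\<Psi> f = [:msubst \<pi> f, msubst \<rho> f:]" if "linear_form n f" for f
  proof -
    have "(\<Sum>i\<in>Z. [:b i, g i:]) = [:\<Sum>i\<in>Z. b i, \<Sum>i\<in>Z. g i:]" for Z :: "nat set" and b g :: "nat \<Rightarrow> 'k mpoly"
      by (induction Z rule: infinite_finite_induct) auto
    then show ?thesis
      unfolding \<Psi>_def ev_linear_form[OF hom\<kappa> that] msubst_linear_form[OF that]
      by (simp add: mult.commute)
  qed
  have \<Psi>_Fp: "\<Psi> f = monom (msubst \<rho> f) 1" if "f \<in> Fp" for f
  proof -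
    have "msubst \<pi> f = 0" using \<pi>(2)[of f] that Fp_subset by auto
    then show ?thesis using \<Psi>_lin[of f] that Fp_subset F(2) by (auto simp: monom_Suc monom_0)
  qed
  have \<Psi>_prod: "\<Psi> (\<Prod>Z) = monom (\<Prod>f\<in>Z. msubst \<rho> f) (card Z)" if "Z \<subseteq> Fp" for Z
  proof -
    have "finite Z" using that Fp_subset(3) finite_subset by blast
    then show ?thesis using that
      by (induction Z rule: finite_induct) (auto simp: \<Psi> \<Psi>_Fp mult_monom)
  qed
  \<comment> \<open>Every generator retains at least \<open>d\<close> factors in \<open>p\<close>,
    since at most \<open>c - 1\<close> forms of \<open>Fp\<close> are omitted; so all of the ideal
    has order at least \<open>d\<close>.\<close>
  have dvd: "monom 1 d dvd \<Psi> f" if "f \<in> I" for f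
  proof -
    have "is_ideal R {f \<in> R. monom 1 d dvd \<Psi> f}"
      using is_subringD[OF is_subring_polys] by (auto simp: is_ideal_def \<Psi>)
    moreover have "star_gens c \<subseteq> {f \<in> R. monom 1 d dvd \<Psi> f}"
    proof
      fix f assume f: "f \<in> star_gens c"
      then obtain K where K: "K \<subseteq> F" "Suc (card K) = c" "f = \<Prod>(F - K)" by (auto simp: star_gens_def)
      have "\<Prod>(F - K) = \<Prod>((F - K) - (Fp - K)) * \<Prod>(Fp - K)"
        using F(1) Fp_subset(1) by (intro prod.subset_diff) auto
      then have "\<Psi> f = \<Psi> (\<Prod>((F - K) - (Fp - K))) * monom (\<Prod>f\<in>Fp - K. msubst \<rho> f) (card (Fp - K))"
        using K(3) \<Psi>_prod[of "Fp - K"] by (simp add: \<Psi>)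
      moreover have "d \<le> card (Fp - K)"
        using diff_card_le_card_Diff[OF finite_sub[OF K(1)], of Fp] K(2) by (simp add: d_def)
      then have "monom 1 d dvd monom (\<Prod>f\<in>Fp - K. msubst \<rho> f) (card (Fp - K))"
        by (intro dvdI[of _ _ "monom (\<Prod>f\<in>Fp - K. msubst \<rho> f) (card (Fp - K) - d)"]) (simp add: mult_monom)
      ultimately show "f \<in> {f \<in> R. monom 1 d dvd \<Psi> f}" using f star_gens_R by auto
    qed
    ultimately have "span_ideal R (star_gens c) \<subseteq> {f \<in> R. monom 1 d dvd \<Psi> f}" by (rule span_ideal_least)
    then show ?thesis using that star_ideal_eq by auto
  qed
  define \<phi> where "\<phi> f = poly.coeff (\<Psi> f) d" for f
  \<comment> \<open>Since the image of \<open>x\<close> starts in order \<open>d\<close>, only the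
    constant term of the image of \<open>r\<close> contributes, and that is reduction modulo
    \<open>p\<close>.\<close>
  have "\<phi> (r * x) = msubst \<pi> r * \<phi> x" if x: "x \<in> I" for r x
  proof -
    obtain q where q: "\<Psi> x = monom 1 d * q" using dvd[OF x] by (auto elim: dvdE)
    have "\<Psi> (r * x) = monom 1 d * (\<Psi> r * q)" by (simp add: \<Psi> q ac_simps)
    then have "\<phi> (r * x) = poly.coeff (\<Psi> r * q) 0" by (simp add: \<phi>_def coeff_monom_mult)
    also have "\<dots> = msubst \<pi> r * poly.coeff q 0" by (simp add: coeff_mult_0 \<Psi>0)
    also have "poly.coeff q 0 = \<phi> x" by (simp add: \<phi>_def q coeff_monom_mult)
    finally show ?thesis .
  qed
  then have "semilinear R (msubst \<pi>) I \<phi>" by (auto simp: semilinear_def \<phi>_def \<Psi>)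
  moreover have "\<phi> (\<Prod>(F - H')) = 0 \<longleftrightarrow> H' \<noteq> H" if H': "H' \<in> omits" for H'
  proof -
    have u: "\<Prod>(F - Fp) \<in> R - p" by (rule unit_prod) (auto simp: Fp_def)
    have "\<Psi> (\<Prod>(F - H')) = monom (\<Prod>f\<in>Fp - H'. msubst \<rho> f) d * \<Psi> (\<Prod>(F - Fp))"
      unfolding prod_omit[OF H'] using \<Psi>_prod[of "Fp - H'"] card_compl[OF H'] by (simp add: \<Psi> d_def)
    then have "\<phi> (\<Prod>(F - H')) = (\<Prod>f\<in>Fp - H'. msubst \<rho> f) * msubst \<pi> (\<Prod>(F - Fp))"
      by (simp add: \<phi>_def coeff_monom_mult \<Psi>0)
    then have "\<phi> (\<Prod>(F - H')) = 0 \<longleftrightarrow> (\<Prod>f\<in>Fp - H'. msubst \<rho> f) = 0"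
      using \<pi>(2) u by auto
    \<comment> \<open>The leading form vanishes exactly if one of the remaining forms is in the
      ideal of \<open>H\<close>: by independence this fails for \<open>H' = H\<close>, whereas any
      other \<open>H'\<close> misses an element of \<open>H\<close>.\<close>
    also have "\<dots> \<longleftrightarrow> (\<exists>f\<in>Fp - H'. f \<in> span_ideal R H)"
      using \<rho> Fp_subset by (auto simp: prod_zero_iff)
    also have "\<dots> \<longleftrightarrow> H' \<noteq> H"
    proof
      assume "\<exists>f\<in>Fp - H'. f \<in> span_ideal R H"
      then show "H' \<noteq> H" using not_in_span[OF HFF] Fp_subset(1) HF(2) by force
    next
      assume ne: "H' \<noteq> H"
      have "\<not> H \<subseteq> H'"
        using ne H H' card_subset_eq[of H' H] finite_subset[OF _ Fp_subset(3), of H'] by (auto simp: omits_def)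
      then obtain f where "f \<in> H" "f \<notin> H'" by auto
      then show "\<exists>f\<in>Fp - H'. f \<in> span_ideal R H"
        using HF(1) span_ideal_superset[of H R] by auto
    qed
    finally show ?thesis .
  qed
  ultimately show thesis by (rule that)
qed

text \<open>All functionals share the homomorphism \<open>\<pi>\<close>, so that they can be added
  and compared. The unit \<open>\<Prod>(F - Fp)\<close> passes from the global generators to the
  local ones.\<close>

lemma localized_functionals:
  obtains \<pi> :: "'k mpoly fract \<Rightarrow> 'k mpoly fract" and \<phi>
  where "ring_hom_on S \<pi>" "\<And>H. H \<in> omits \<Longrightarrow> semilinear S \<pi> (localize R p I) (\<phi> H)"
    "\<And>H H'. H \<in> omits \<Longrightarrow> H' \<in> omits \<Longrightarrow> \<phi> H (emb (\<Prod>(Fp - H'))) = 0 \<longleftrightarrow> H \<noteq> H'"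
proof -
  obtain \<rho> where \<rho>: "\<And>i. i < n \<Longrightarrow> linear_form n (\<rho> i)" "\<And>f. f \<in> R \<Longrightarrow> msubst \<rho> f = 0 \<longleftrightarrow> f \<in> p"
    using linear_projection[of Fp n, folded p_span] Fp_subset F(2) by blast
  note hom = ring_hom_onD[OF ring_hom_msubst, simplified]
  have nz: "msubst \<rho> b \<noteq> 0" if "b \<in> R - p" for b using \<rho>(2) that by auto
  obtain \<pi> where \<pi>: "\<And>a b. a \<in> R \<Longrightarrow> b \<in> R - p \<Longrightarrow> \<pi> (Fract a b) = Fract (msubst \<rho> a) (msubst \<rho> b)"
    using localize_extend[OF is_ideal_self[OF is_subring_polys], of "msubst \<rho>" "msubst \<rho>"] nz by (auto simp: hom)
  have "\<forall>H\<in>omits. \<exists>\<psi>. semilinear R (msubst \<rho>) I \<psi> \<and> (\<forall>H'\<in>omits. \<psi> (\<Prod>(F - H')) = 0 \<longleftrightarrow> H' \<noteq> H)"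
    using leading_form_functional[OF \<rho>] by metis
  from bchoice[OF this] obtain \<psi> where \<psi>: "\<And>H. H \<in> omits \<Longrightarrow> semilinear R (msubst \<rho>) I (\<psi> H)"
    "\<And>H H'. H \<in> omits \<Longrightarrow> H' \<in> omits \<Longrightarrow> \<psi> H (\<Prod>(F - H')) = 0 \<longleftrightarrow> H' \<noteq> H" by blast
  have "\<forall>H\<in>omits. \<exists>\<Phi>. \<forall>a b. a \<in> I \<longrightarrow> b \<in> R - p \<longrightarrow> \<Phi> (Fract a b) = Fract (\<psi> H a) (msubst \<rho> b)"
  proof
    fix H assume H: "H \<in> omits"
    have "\<psi> H (r * x) = msubst \<rho> r * \<psi> H x" if "r \<in> R" "x \<in> I" for r x
      using \<psi>(1)[OF H] that by (auto simp: semilinear_def)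
    from localize_extend[OF star_ideal_is_ideal nz this]
    obtain \<Phi> where "\<And>a b. a \<in> I \<Longrightarrow> b \<in> R - p \<Longrightarrow> \<Phi> (Fract a b) = Fract (\<psi> H a) (msubst \<rho> b)" by blast
    then show "\<exists>\<Phi>. \<forall>a b. a \<in> I \<longrightarrow> b \<in> R - p \<longrightarrow> \<Phi> (Fract a b) = Fract (\<psi> H a) (msubst \<rho> b)" by blast
  qed
  from bchoice[OF this] obtain \<phi> where \<phi>: "\<And>H a b. H \<in> omits \<Longrightarrow> a \<in> I \<Longrightarrow> b \<in> R - p \<Longrightarrow>
      \<phi> H (Fract a b) = Fract (\<psi> H a) (msubst \<rho> b)" by blast
  note R = is_subringD[OF is_subring_polys]
  note II = is_idealD[OF star_ideal_is_ideal]
  show thesis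
  proof (rule that)
    show "ring_hom_on S \<pi>"
      unfolding ring_hom_on_def
    proof (intro conjI ballI is_subring_S)
      show "\<pi> 1 = 1" using \<pi>[OF R(1) one_denom] by (simp add: One_fract_def hom)
      fix x y assume "x \<in> S" "y \<in> S"
      then obtain a b a' b' where x: "x = Fract a b" "a \<in> R" "b \<in> R - p"
        and y: "y = Fract a' b'" "a' \<in> R" "b' \<in> R - p" by (metis localizeE)
      have "x + y = Fract (a * b' + a' * b) (b * b')" "x * y = Fract (a * a') (b * b')"
        using x y denom_nonzero by auto
      moreover have "a * b' + a' * b \<in> R" "a * a' \<in> R" using x y by (auto intro!: R)
      moreover have "msubst \<rho> b \<noteq> 0" "msubst \<rho> b' \<noteq> 0" using nz x(3) y(3) by auto
      ultimately show "\<pi> (x + y) = \<pi> x + \<pi> y" "\<pi> (x * y) = \<pi> x * \<pi> y"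
        using \<pi>[OF x(2,3)] \<pi>[OF y(2,3)] \<pi>[OF _ denom_mult[OF x(3) y(3)]]
        by (simp_all add: x(1) y(1) hom)
    qed
    fix H assume H: "H \<in> omits"
    show "semilinear S \<pi> (localize R p I) (\<phi> H)"
      unfolding semilinear_def
    proof (intro conjI ballI)
      fix x y assume "x \<in> localize R p I" "y \<in> localize R p I"
      then obtain a b a' b' where x: "x = Fract a b" "a \<in> I" "b \<in> R - p"
        and y: "y = Fract a' b'" "a' \<in> I" "b' \<in> R - p" by (metis localizeE)
      have xy: "x + y = Fract (b' * a + b * a') (b * b')"
        using x y denom_nonzero by (auto simp: mult.commute)
      have in_I: "b' * a \<in> I" "b * a' \<in> I" using x y by (auto intro: II(4))
      have "\<psi> H (b' * a + b * a') = msubst \<rho> b' * \<psi> H a + msubst \<rho> b * \<psi> H a'"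
        using \<psi>(1)[OF H] in_I x y by (simp add: semilinear_def)
      then have "\<phi> H (x + y) = Fract (msubst \<rho> b' * \<psi> H a + msubst \<rho> b * \<psi> H a') (msubst \<rho> b * msubst \<rho> b')"
        unfolding xy \<phi>[OF H II(3)[OF in_I] denom_mult[OF x(3) y(3)]] by (simp add: hom)
      then show "\<phi> H (x + y) = \<phi> H x + \<phi> H y"
        unfolding x(1) y(1) \<phi>[OF H x(2,3)] \<phi>[OF H y(2,3)]
        using nz[OF x(3)] nz[OF y(3)] by (simp add: mult.commute)
    next
      fix r x assume "r \<in> S" "x \<in> localize R p I"
      then obtain a b a' b' where x: "x = Fract a b" "a \<in> I" "b \<in> R - p"
        and r: "r = Fract a' b'" "a' \<in> R" "b' \<in> R - p" by (metis localizeE)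
      have "r * x = Fract (a' * a) (b' * b)" using x r by simp
      then show "\<phi> H (r * x) = \<pi> r * \<phi> H x"
        using x r \<psi>(1)[OF H] denom_mult[OF r(3) x(3)] II(4)[OF r(2) x(2)]
        by (simp add: \<phi>[OF H] \<pi> hom semilinear_def)
    qed
    fix H' assume H': "H' \<in> omits"
    have u: "\<Prod>(F - Fp) \<in> R - p" by (rule unit_prod) (auto simp: Fp_def)
    have "\<Prod>(F - H') \<in> star_gens c" using H' Fp_subset(1) by (auto simp: omits_def star_gens_def)
    then have "\<Prod>(F - H') \<in> I" using star_ideal_eq span_ideal_superset by blast
    moreover have "emb (\<Prod>(Fp - H')) = Fract (\<Prod>(F - H')) (\<Prod>(F - Fp))"
      unfolding prod_omit[OF H'] using denom_nonzero[OF u] by (simp add: eq_fract)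
    ultimately have "\<phi> H (emb (\<Prod>(Fp - H'))) = Fract (\<psi> H (\<Prod>(F - H'))) (msubst \<rho> (\<Prod>(F - Fp)))"
      using \<phi>[OF H _ u] by simp
    then show "\<phi> H (emb (\<Prod>(Fp - H'))) = 0 \<longleftrightarrow> H \<noteq> H'"
      using \<psi>(2)[OF H H'] nz[OF u] by (auto simp: Zero_fract_def eq_fract)
  qed
qed

text \<open>For \<open>c \<ge> 3\<close> the binomial coefficient exceeds the number of forms, which
  bounds the dimension. For \<open>c = 2\<close> there are as many generators as forms, but by
  dependence one form is redundant in generating the prime, so the dimension is smaller.\<close>

lemma krull_dim_lt:
  assumes bad: "c < card Fp" "3 \<le> c \<or> c = 2 \<and> \<not> lin_indep n Fp"
  shows "krull_dim (ring_on S) < enat (card omits)"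
  using bad(2)
proof
  assume c: "3 \<le> c"
  have "krull_dim (ring_on S) \<le> enat (card Fp)"
    using krull_dim_linear_prime_le[OF Fp_subset(3), of n, folded p_span] Fp_subset(1) F(2) by blast
  also have "enat (card Fp) < enat (card omits)"
    unfolding card_omits using c bad(1) by (simp add: choose_gt)
  finally show ?thesis .
next
  assume c: "c = 2 \<and> \<not> lin_indep n Fp"
  then obtain f where f: "f \<in> Fp" "f \<in> span_ideal R (Fp - {f})" by (auto simp: lin_indep_def)
  have "span_ideal R Fp = span_ideal R (Fp - {f})"
    using f Fp_subset(2) span_ideal_superset[of "Fp - {f}" R] span_ideal_superset[of Fp R]
    by (intro span_ideal_eqI) auto
  then have pf: "p = span_ideal R (Fp - {f})" by (rule trans[OF p_span])
  have "krull_dim (ring_on S) \<le> enat (card (Fp - {f}))"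
    using krull_dim_linear_prime_le[of "Fp - {f}" n, folded pf] Fp_subset(1,3) F(2) by blast
  also have "enat (card (Fp - {f})) < enat (card omits)"
    unfolding card_omits using c card_Diff1_less[OF Fp_subset(3) f(1)] by simp
  finally show ?thesis .
qed

lemma not_min_gens_le:
  assumes bad: "c < card Fp" "3 \<le> c \<or> c = 2 \<and> \<not> lin_indep n Fp"
  shows "\<not> min_gens (ring_on S) (localize R p I) \<le> krull_dim (ring_on S)"
proof -
  obtain \<pi> :: "'k mpoly fract \<Rightarrow> 'k mpoly fract" and \<phi> where \<pi>: "ring_hom_on S \<pi>"
    "\<And>H. H \<in> omits \<Longrightarrow> semilinear S \<pi> (localize R p I) (\<phi> H)"
    "\<And>H H'. H \<in> omits \<Longrightarrow> H' \<in> omits \<Longrightarrow> \<phi> H (emb (\<Prod>(Fp - H'))) = 0 \<longleftrightarrow> H \<noteq> H'"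
    by (rule localized_functionals) (blast intro: that)
  have "enat (card omits) \<le> min_gens (ring_on S) (localize R p I)"
    by (rule min_gens_ge[OF is_subring_S \<pi>(1) finite_omits \<pi>(2) emb_omit_in \<pi>(3)])
  then show ?thesis using krull_dim_lt[OF bad] by auto
qed

text \<open>The sum of the functionals belonging to the members of \<open>\<G>\<close>; at each
  generator at most one summand is nonzero.\<close>

lemma separating_functional:
  assumes G: "\<G> \<subseteq> omits"
  obtains \<pi> :: "'k mpoly fract \<Rightarrow> 'k mpoly fract" and \<phi> where "ring_hom_on S \<pi>"
    "semilinear S \<pi> (localize R p I) \<phi>" "\<And>H. H \<in> omits \<Longrightarrow> \<phi> (emb (\<Prod>(Fp - H))) = 0 \<longleftrightarrow> H \<notin> \<G>"
proof -
  obtain \<pi> :: "'k mpoly fract \<Rightarrow> 'k mpoly fract" and \<phi> where \<pi>: "ring_hom_on S \<pi>"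
    "\<And>H. H \<in> omits \<Longrightarrow> semilinear S \<pi> (localize R p I) (\<phi> H)"
    "\<And>H H'. H \<in> omits \<Longrightarrow> H' \<in> omits \<Longrightarrow> \<phi> H (emb (\<Prod>(Fp - H'))) = 0 \<longleftrightarrow> H \<noteq> H'"
    by (rule localized_functionals) (blast intro: that)
  define \<Phi> where "\<Phi> x = (\<Sum>H\<in>\<G>. \<phi> H x)" for x
  have fG: "finite \<G>" using G finite_omits finite_subset by blast
  have sl: "\<phi> H (x + y) = \<phi> H x + \<phi> H y" "\<phi> H (r * x) = \<pi> r * \<phi> H x"
    if "H \<in> \<G>" "x \<in> localize R p I" "y \<in> localize R p I" "r \<in> S" for H x y r
    using \<pi>(2)[of H] that G by (auto simp: semilinear_def)
  have "semilinear S \<pi> (localize R p I) \<Phi>"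
    unfolding semilinear_def
  proof (intro conjI ballI)
    fix x y assume "x \<in> localize R p I" "y \<in> localize R p I"
    then have "\<Phi> (x + y) = (\<Sum>H\<in>\<G>. \<phi> H x + \<phi> H y)"
      unfolding \<Phi>_def using is_subringD(1)[OF is_subring_S] by (intro sum.cong refl sl(1))
    then show "\<Phi> (x + y) = \<Phi> x + \<Phi> y" by (simp add: \<Phi>_def sum.distrib)
  next
    fix r x assume "r \<in> S" "x \<in> localize R p I"
    then have "\<Phi> (r * x) = (\<Sum>H\<in>\<G>. \<pi> r * \<phi> H x)"
      unfolding \<Phi>_def by (intro sum.cong refl sl(2))
    then show "\<Phi> (r * x) = \<pi> r * \<Phi> x" by (simp add: \<Phi>_def sum_distrib_left)
  qed
  moreover have "\<Phi> (emb (\<Prod>(Fp - H))) = 0 \<longleftrightarrow> H \<notin> \<G>" if H: "H \<in> omits" for H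
  proof (cases "H \<in> \<G>")
    case True
    have "(\<Sum>K\<in>\<G> - {H}. \<phi> K (emb (\<Prod>(Fp - H)))) = 0"
      using \<pi>(3)[OF _ H] G by (intro sum.neutral) auto
    then show ?thesis
      unfolding \<Phi>_def using sum.remove[OF fG True, of "\<lambda>K. \<phi> K (emb (\<Prod>(Fp - H)))"] \<pi>(3)[OF H H] True by simp
  next
    case False
    then have "\<Phi> (emb (\<Prod>(Fp - H))) = 0"
      unfolding \<Phi>_def using \<pi>(3)[OF _ H] G by (intro sum.neutral) auto
    with False show ?thesis by simp
  qed
  ultimately show thesis using \<pi>(1) by (intro that)
qed

section \<open>Nonlinear relations among the generators\<close>

lemma prod_remove2:
  assumes "finite Z" "u \<in> Z" "v \<in> Z" "u \<noteq> v"
  shows "\<Prod>Z = u * v * \<Prod>(Z - {u, v})"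
proof -
  have "Z - {u} - {v} = Z - {u, v}" by auto
  then show ?thesis
    using prod.remove[OF assms(1,2), of "\<lambda>x. x"] prod.remove[of "Z - {u}" v "\<lambda>x. x"] assms
    by (simp add: mult.assoc)
qed

text \<open>Fix \<open>c - 3\<close> forms \<open>A\<close> to be omitted always, and four others,
  available since \<open>c < card Fp\<close>. Each pair of the four completes \<open>A\<close> to an
  omitted set. For either splitting of the four into two pairs the two generators have the same
  product, which gives the quadric. A functional that is nonzero exactly on the generators of one
  splitting violates it.\<close>

lemma not_linear_type_ge3:
  assumes t: "c < card Fp" and c: "3 \<le> c"
  shows "\<not> linear_type S (localize R p I)"
proof
  assume lt: "linear_type S (localize R p I)"
  have "c - 3 \<le> card Fp" using t by simp
  then obtain A where A: "A \<subseteq> Fp" "card A = c - 3"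
    by (rule obtain_subset_with_card_n) (rule that)
  have fA: "finite A" using A(1) Fp_subset(3) finite_subset by blast
  obtain zs where zs: "distinct zs" "set zs = Fp - A"
    using finite_distinct_list[of "Fp - A"] Fp_subset(3) by auto
  have "4 \<le> length zs"
    using A t c fA distinct_card[OF zs(1)] zs(2) by (simp add: card_Diff_subset)
  then obtain a b x y zs' where "zs = a # b # x # y # zs'"
    by (auto simp: Suc_le_length_iff numeral_eq_Suc)
  then have abxy: "a \<in> Fp - A" "b \<in> Fp - A" "x \<in> Fp - A" "y \<in> Fp - A" "distinct [a, b, x, y]"
    using zs by auto
  define H where "H u v = insert u (insert v A)" for u v
  have H: "H u v \<in> omits" if "u \<in> Fp - A" "v \<in> Fp - A" "u \<noteq> v" for u v
    using that A fA c by (auto simp: H_def omits_def)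
  define Hs where "Hs = [H a b, H x y, H a x, H b y]"
  have Hs: "Hs ! j \<in> omits" if "j < 4" for j
    using that abxy H by (auto simp: Hs_def less_Suc_eq numeral_eq_Suc)
  define e where "e j = emb (\<Prod>(Fp - Hs ! j))" for j
  define q where "q = \<Prod>(Fp - (A \<union> {a, b, x, y}))"
  have pr: "\<Prod>(Fp - H u v) = w * z * q"
    if "{u, v, w, z} = {a, b, x, y}" "distinct [u, v, w, z]" for u v w z
  proof -
    have "w \<in> Fp - H u v" "z \<in> Fp - H u v" "w \<noteq> z" using that abxy by (auto simp: H_def)
    moreover have "Fp - H u v - {w, z} = Fp - (A \<union> {a, b, x, y})"
      unfolding that(1)[symmetric] by (auto simp: H_def)
    ultimately show ?thesis using prod_remove2[of "Fp - H u v" w z] Fp_subset(3) by (simp add: q_def)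
  qed
  have "\<Prod>(Fp - H a b) = x * y * q" "\<Prod>(Fp - H x y) = a * b * q"
    "\<Prod>(Fp - H a x) = b * y * q" "\<Prod>(Fp - H b y) = a * x * q"
    using abxy(5) by (intro pr; auto)+
  then have rel: "e 0 * e 1 = e 2 * e 3"
    by (simp add: e_def Hs_def numeral_eq_Suc ac_simps)
  have "H a b \<noteq> H x y" "H a x \<noteq> H a b" "H a x \<noteq> H x y" "H b y \<noteq> H a b" "H b y \<noteq> H x y"
    using abxy by (auto simp: H_def)
  then have neq: "Hs ! 2 \<notin> {Hs ! 0, Hs ! 1}" "Hs ! 3 \<notin> {Hs ! 0, Hs ! 1}" by (auto simp: Hs_def numeral_eq_Suc)
  obtain \<pi> :: "'k mpoly fract \<Rightarrow> 'k mpoly fract" and \<phi> where \<pi>: "ring_hom_on S \<pi>"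
    and \<phi>: "semilinear S \<pi> (localize R p I) \<phi>"
      "\<And>H. H \<in> omits \<Longrightarrow> \<phi> (emb (\<Prod>(Fp - H))) = 0 \<longleftrightarrow> H \<notin> {Hs ! 0, Hs ! 1}"
    using separating_functional[of "{Hs ! 0, Hs ! 1}"] Hs[of 0] Hs[of 1] by auto
  let ?Q = "mvar 0 * mvar 1 - mvar 2 * mvar 3 :: 'k mpoly fract mpoly"
  have "ev \<pi> (\<lambda>j. \<phi> (e j)) ?Q = 0"
  proof (rule linear_type_relation[OF is_subring_S lt \<pi> \<phi>(1)])
    show "e j \<in> localize R p I" if "j < 4" for j unfolding e_def by (rule emb_omit_in[OF Hs[OF that]])
    show "?Q \<in> mpolys S 4" by (rule ev_quadric(1)[OF \<pi>])
    have "ev (\<lambda>c. [:c:]) (\<lambda>j. monom (e j) 1) ?Q = monom (e 0) 1 * monom (e 1) 1 - monom (e 2) 1 * monom (e 3) 1"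
      by (rule ev_quadric(2)[OF ring_hom_const_poly])
    then show "ev (\<lambda>c. [:c:]) (\<lambda>j. monom (e j) 1) ?Q = 0" using rel by (simp add: mult_monom)
  qed
  then have "\<phi> (e 0) * \<phi> (e 1) - \<phi> (e 2) * \<phi> (e 3) = 0" unfolding ev_quadric(2)[OF \<pi>] .
  moreover have "\<phi> (e 2) = 0" unfolding e_def using \<phi>(2)[OF Hs[of 2]] neq by simp
  moreover have "\<phi> (e 0) \<noteq> 0" "\<phi> (e 1) \<noteq> 0"
    unfolding e_def using \<phi>(2)[OF Hs[of 0]] \<phi>(2)[OF Hs[of 1]] by auto
  ultimately show False by simp
qed

text \<open>Write \<open>f\<close> as a combination of the other forms and multiply by the product
  of all generators. Each form times its own generator is \<open>P\<close>, so \<open>P\<close>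
  cancels and leaves a relation of degree \<open>t - 1\<close>. Its left side avoids the generator
  of index \<open>0\<close>, while each term on the right contains it; a functional vanishing at
  that generator alone therefore violates the relation.\<close>

lemma not_linear_type_dependent:
  assumes c: "c = 2" and dep: "\<not> lin_indep n Fp"
  shows "\<not> linear_type S (localize R p I)"
proof
  assume lt: "linear_type S (localize R p I)"
  obtain f where f: "f \<in> Fp" "f \<in> span_ideal R (Fp - {f})" using dep by (auto simp: lin_indep_def)
  obtain fs where fs: "distinct fs" "set fs = Fp - {f}" using finite_distinct_list[of "Fp - {f}"] Fp_subset(3) by auto
  \<comment> \<open>The dependent form \<open>f\<close> gets index \<open>0\<close>, so the forms
    expressing it are those with index in \<open>{1..<t}\<close>.\<close>
  define g where "g = (!) (f # fs)"
  define t where "t = length (f # fs)"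
  have d: "distinct (f # fs)" "set (f # fs) = Fp" using fs f(1) by auto
  have gF: "g j \<in> Fp" if "j < t" for j using that d(2) nth_mem[of j "f # fs"] by (auto simp: g_def t_def)
  have g_inj: "g i = g j \<longleftrightarrow> i = j" if "i < t" "j < t" for i j
    using that nth_eq_iff_index_eq[OF d(1)] by (simp add: g_def t_def)
  have g0: "g 0 = f" by (simp add: g_def)
  have t0: "0 < t" by (simp add: t_def)
  have img: "Fp - {f} = g ` {1..<t}"
  proof -
    have "set fs = (\<lambda>j. fs ! j) ` {..<length fs}" by (auto simp: set_conv_nth)
    also have "\<dots> = (\<lambda>j. g (Suc j)) ` {..<length fs}" by (simp add: g_def)
    also have "\<dots> = g ` Suc ` {..<length fs}" by (simp add: image_image)
    also have "Suc ` {..<length fs} = {1..<t}"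
      by (simp add: t_def lessThan_atLeast0 image_Suc_atLeastLessThan)
    finally show ?thesis using fs(2) by simp
  qed
  have "f \<in> {\<Sum>j\<in>{1..<t}. a j * g j | a. \<forall>j\<in>{1..<t}. a j \<in> R}"
    using f(2) gF Fp_subset(2) unfolding img
    by (subst span_ideal_finite[OF is_subring_polys, symmetric]) auto
  then obtain a where a: "f = (\<Sum>j\<in>{1..<t}. a j * g j)" "\<And>j. j \<in> {1..<t} \<Longrightarrow> a j \<in> R"
    by blast
  have om: "{g j} \<in> omits" if "j < t" for j unfolding omits_def using gF[OF that] c by simp
  define e where "e j = emb (\<Prod>(Fp - {g j}))" for j
  define P where "P = emb (\<Prod>Fp)"
  have P: "P \<noteq> 0" using nonzero Fp_subset by (auto simp: P_def)
  have ge: "emb (g j) * e j = P" if "j < t" for j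
    using prod.remove[OF Fp_subset(3) gF[OF that], of "\<lambda>x. x"] by (simp add: e_def P_def)
  have aS: "emb (a j) \<in> S" if "j \<in> {1..<t}" for j using a(2)[OF that] by (rule emb_in_localize)
  have ea: "emb f = (\<Sum>j\<in>{1..<t}. emb (a j) * emb (g j))"
    by (subst a(1)) (simp add: ring_hom_on_sum[OF ring_hom_emb])
  \<comment> \<open>A form absorbs its own generator from the full product and becomes
    \<open>P\<close>.\<close>
  have split: "emb (g i) * (\<Prod>j<t. e j) = P * (\<Prod>j\<in>{..<t} - {i}. e j)" if "i < t" for i
    using prod.remove[of "{..<t}" i e] that ge[OF that] by (simp add: mult.assoc[symmetric])
  have "P * (\<Prod>j\<in>{1..<t}. e j) = emb f * (\<Prod>j<t. e j)"
  proof -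
    have "{..<t} - {0} = {1..<t}" by auto
    then show ?thesis using split[OF t0] g0 by simp
  qed
  also have "\<dots> = (\<Sum>i\<in>{1..<t}. emb (a i) * (emb (g i) * (\<Prod>j<t. e j)))"
    unfolding ea sum_distrib_right by (simp only: mult.assoc)
  also have "\<dots> = (\<Sum>i\<in>{1..<t}. emb (a i) * (P * (\<Prod>j\<in>{..<t} - {i}. e j)))"
    by (intro sum.cong refl) (simp only: split atLeastLessThan_iff)
  also have "\<dots> = P * (\<Sum>i\<in>{1..<t}. emb (a i) * (\<Prod>j\<in>{..<t} - {i}. e j))"
    unfolding sum_distrib_left by (simp only: mult.left_commute)
  finally have rel: "(\<Prod>j\<in>{1..<t}. e j) = (\<Sum>i\<in>{1..<t}. emb (a i) * (\<Prod>j\<in>{..<t} - {i}. e j))"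
    using P by (simp only: mult_cancel_left simp_thms)
  obtain \<pi> :: "'k mpoly fract \<Rightarrow> 'k mpoly fract" and \<phi> where \<pi>: "ring_hom_on S \<pi>"
    and \<phi>: "semilinear S \<pi> (localize R p I) \<phi>"
      "\<And>H. H \<in> omits \<Longrightarrow> \<phi> (emb (\<Prod>(Fp - H))) = 0 \<longleftrightarrow> H \<notin> (\<lambda>j. {g j}) ` {1..<t}"
    by (rule separating_functional[of "(\<lambda>j. {g j}) ` {1..<t}"]) (use om in \<open>auto intro: that\<close>)
  let ?Q = "(\<Prod>j\<in>{1..<t}. mvar j) - (\<Sum>i\<in>{1..<t}. mconst (emb (a i)) * (\<Prod>j\<in>{..<t} - {i}. mvar j))"
  have Q: "?Q \<in> mpolys S t"
    by (rule ev_circuit(1)[OF \<pi>]) (auto intro: aS)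
  have evQ: "ev \<kappa> \<sigma> ?Q = (\<Prod>j\<in>{1..<t}. \<sigma> j) - (\<Sum>i\<in>{1..<t}. \<kappa> (emb (a i)) * (\<Prod>j\<in>{..<t} - {i}. \<sigma> j))"
    if "ring_hom_on S \<kappa>" for \<kappa> :: "'k mpoly fract \<Rightarrow> 'k mpoly fract" and \<sigma>
    using that by (rule ev_circuit(2)[where t = t]) (auto intro: aS)
  have "ev \<pi> (\<lambda>j. \<phi> (e j)) ?Q = 0"
  proof (rule linear_type_relation[OF is_subring_S lt \<pi> \<phi>(1) _ Q])
    show "e j \<in> localize R p I" if "j < t" for j unfolding e_def by (rule emb_omit_in[OF om[OF that]])
    have "ev (\<lambda>c. [:c:]) (\<lambda>j. monom (e j) 1) ?Q = (\<Prod>j\<in>{1..<t}. monom (e j) 1) -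
        (\<Sum>i\<in>{1..<t}. [:emb (a i):] * (\<Prod>j\<in>{..<t} - {i}. monom (e j) 1))"
      by (rule ev_circuit(2)[OF ring_hom_const_poly, where t = t]) auto
    also have "(\<Sum>i\<in>{1..<t}. [:emb (a i):] * (\<Prod>j\<in>{..<t} - {i}. monom (e j) 1)) =
        (\<Sum>i\<in>{1..<t}. monom (emb (a i) * (\<Prod>j\<in>{..<t} - {i}. e j)) (t - 1))"
      unfolding prod_monom_1 by (intro sum.cong refl) (simp add: smult_monom)
    also have "\<dots> = monom (\<Prod>j\<in>{1..<t}. e j) (t - 1)"
      \<comment> \<open>All terms live in the same degree \<open>t - 1\<close> of the Rees algebra,
        so the relation in the fraction field suffices there.\<close>
      unfolding rel by (rule poly_eqI) (simp add: coeff_sum)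
    finally show "ev (\<lambda>c. [:c:]) (\<lambda>j. monom (e j) 1) ?Q = 0"
      unfolding prod_monom_1 by simp
  qed
  then have z: "(\<Prod>j\<in>{1..<t}. \<phi> (e j)) = (\<Sum>i\<in>{1..<t}. \<pi> (emb (a i)) * (\<Prod>j\<in>{..<t} - {i}. \<phi> (e j)))"
    unfolding evQ[OF \<pi>] by simp
  have "{g 0} \<notin> (\<lambda>j. {g j}) ` {1..<t}"
  proof
    assume "{g 0} \<in> (\<lambda>j. {g j}) ` {1..<t}"
    then obtain j where "j \<in> {1..<t}" "g 0 = g j" by auto
    then show False using g_inj[OF t0, of j] by simp
  qed
  then have "\<phi> (e 0) = 0" unfolding e_def using \<phi>(2)[OF om[OF t0]] by simp
  then have "(\<Prod>j\<in>{..<t} - {i}. \<phi> (e j)) = 0" if "i \<in> {1..<t}" for i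
    using that t0 by (intro prod_zero) (auto intro!: bexI[of _ 0])
  then have "(\<Prod>j\<in>{1..<t}. \<phi> (e j)) = 0" unfolding z by (intro sum.neutral) simp
  then obtain j where j: "j \<in> {1..<t}" "\<phi> (e j) = 0" by (auto simp: prod_zero_iff)
  then show False unfolding e_def using \<phi>(2)[OF om[of j]] by auto
qed

end

section \<open>The equivalence\<close>

text \<open>A chain ending in \<open>p\<close> can be prolonged by \<open>q\<close>, unless
  \<open>p = q\<close>.\<close>

lemma height_mono:
  assumes "primeideal q A" "p \<subseteq> q"
  shows "height A p \<le> height A q"
  unfolding height_def
proof (rule SUP_least)
  fix ps assume "ps \<in> {ps \<in> prime_chains A. last ps = p}"
  then have ps: "ps \<noteq> []" "\<And>r. r \<in> set ps \<Longrightarrow> primeideal r A" "sorted_wrt (\<subset>) ps" "last ps = p"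
    by (auto simp: prime_chains_def)
  show "enat (length ps - 1) \<le> (SUP ps\<in>{ps \<in> prime_chains A. last ps = q}. enat (length ps - 1))"
  proof (cases "p = q")
    case True
    then show ?thesis using \<open>ps \<in> _\<close> by (intro SUP_upper) auto
  next
    case False
    have "r \<subset> q" if "r \<in> set ps" for r
    proof -
      have s: "sorted_wrt (\<subset>) (butlast ps @ [p])" using ps by (metis append_butlast_last_id)
      have "r \<in> set (butlast ps) \<or> r = p"
        using that ps by (metis append_butlast_last_id in_set_conv_decomp insert_iff rotate1.simps(2) set_ConsD set_rotate1)
      then show ?thesis using s assms(2) False by (auto simp: sorted_wrt_append)
    qed
    then have "ps @ [q] \<in> {ps \<in> prime_chains A. last ps = q}"
      using ps assms(1) by (auto simp: prime_chains_def sorted_wrt_append)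
    then have "enat (length (ps @ [q]) - 1) \<le> (SUP ps\<in>{ps \<in> prime_chains A. last ps = q}. enat (length ps - 1))"
      by (rule SUP_upper)
    moreover have "enat (length ps - 1) \<le> enat (length (ps @ [q]) - 1)" by simp
    ultimately show ?thesis by (rule order_trans[rotated])
  qed
qed

context linear_star
begin

text \<open>The primes of the first kind. Those containing fewer than \<open>c\<close> forms are
  among them: there the localized ideal is the whole ring.\<close>

definition good :: "'k mpoly set \<Rightarrow> bool" where
  "good p \<longleftrightarrow> c = 1 \<or> card (F \<inter> p) \<le> c \<or> c = 2 \<and> lin_indep n (F \<inter> p)"

lemma good_linear_type:
  assumes "is_prime R p" "good p"
  shows "linear_type (localize R p R) (localize R p (star_ideal n c F))"
proof -
  interpret star_prime n c F p by unfold_locales (rule assms(1))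
  show ?thesis using linear_type_good assms(2) by (simp add: good_def Fp_def)
qed

lemma good_min_gens:
  assumes "is_prime R p" "good p" "star_ideal n c F \<subseteq> p"
  shows "min_gens (ring_on (localize R p R)) (localize R p (star_ideal n c F)) \<le>
    krull_dim (ring_on (localize R p R))"
proof -
  interpret star_prime n c F p by unfold_locales (rule assms(1))
  have "c \<le> card Fp" using localize_star_small(2) assms(3) by force
  then show ?thesis using min_gens_le_dim assms(2) by (auto simp: good_def Fp_def)
qed

text \<open>The ideal \<open>q\<close> generated by the forms in \<open>p\<close> is prime and
  contains exactly the same forms as \<open>p\<close>, so it is again of the second kind, and now
  generated by forms. More than \<open>c\<close> of them lie in \<open>q\<close>, so each generator
  of the star ideal has a factor there.\<close>

lemma bad_prime:
  assumes p: "is_prime R p" and bad: "\<not> good p"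
  obtains q where "is_prime R q" "q \<subseteq> p" "star_ideal n c F \<subseteq> q"
    "\<not> linear_type (localize R q R) (localize R q (star_ideal n c F))"
    "\<not> min_gens (ring_on (localize R q R)) (localize R q (star_ideal n c F)) \<le> krull_dim (ring_on (localize R q R))"
proof -
  define q where "q = span_ideal R (F \<inter> p)"
  have qp: "q \<subseteq> p" unfolding q_def by (rule span_ideal_least[OF is_primeD(1)[OF p]]) simp
  have Fq: "F \<inter> q = F \<inter> p" using qp span_ideal_superset[of "F \<inter> p" R] by (auto simp: q_def)
  have q: "is_prime R q" unfolding q_def by (rule prime_span) simp
  interpret star_prime n c F q by unfold_locales (rule q)
  have Fp: "Fp = F \<inter> p" using Fq by (simp add: Fp_def)
  have b: "c < card Fp" "3 \<le> c \<or> c = 2 \<and> \<not> lin_indep n Fp"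
    using bad F(4) by (auto simp: good_def Fp)
  interpret star_linear_prime n c F q by unfold_locales (use b(1) Fp in \<open>auto simp: q_def\<close>)
  have "star_ideal n c F \<subseteq> q"
    unfolding star_ideal_eq
  proof (intro span_ideal_least is_primeD(1)[OF q] subsetI)
    fix g assume "g \<in> star_gens c"
    then obtain H where H: "H \<subseteq> F" "Suc (card H) = c" "g = \<Prod>(F - H)" by (auto simp: star_gens_def)
    have "\<not> Fp \<subseteq> H" using card_mono[OF finite_sub[OF H(1)], of Fp] H(2) b(1) by auto
    then obtain f where f: "f \<in> q" "f \<in> F - H" by (auto simp: Fp_def)
    have "f * \<Prod>(F - H - {f}) \<in> q"
      using f(1) prod_in_R[of "F - H - {f}"] by (intro is_idealD(5)[OF is_primeD(1)[OF q]]) auto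
    then show "g \<in> q" using prod.remove[OF _ f(2), of "\<lambda>x. x"] F(1) H(3) by simp
  qed
  moreover have "\<not> linear_type S (localize R q (star_ideal n c F))"
    using b not_linear_type_ge3 not_linear_type_dependent by blast
  ultimately show thesis using that q qp not_min_gens_le[OF b] by blast
qed

end

theorem proposition4p4:
  fixes F :: "'k::field mpoly set" and n c s :: nat
  assumes "linear_star_configuration n c F" and "s > 0"
  defines "R \<equiv> mpolys (UNIV :: 'k set) n"
  shows "(\<forall>p. primeideal p (ring_on R) \<and> height (ring_on R) p \<le> enat (s - 1) \<longrightarrow>
            linear_type (localize R p R) (localize R p (star_ideal n c F))) \<longleftrightarrow>
         G_cond R s (star_ideal n c F)"
proof -
  interpret linear_star n c F by unfold_locales (rule assms(1))
  note prime_iff = primeideal_ring_on_iff[OF is_subring_polys]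
  let ?ok = "\<forall>p. is_prime R p \<and> height (ring_on R) p \<le> enat (s - 1) \<longrightarrow> good p"
  \<comment> \<open>A prime of the second kind within the height bound yields one that violates both
    conditions at once. It contains the star ideal, as the second condition demands, and lies inside
    \<open>p\<close>, so it obeys the same bound.\<close>
  have bad: thesis if p: "is_prime R p" "height (ring_on R) p \<le> enat (s - 1)" "\<not> good p"
    and q: "\<And>q. is_prime R q \<Longrightarrow> height (ring_on R) q \<le> enat (s - 1) \<Longrightarrow> star_ideal n c F \<subseteq> q \<Longrightarrow>
      \<not> linear_type (localize R q R) (localize R q (star_ideal n c F)) \<Longrightarrow>
      \<not> min_gens (ring_on (localize R q R)) (localize R q (star_ideal n c F)) \<le> krull_dim (ring_on (localize R q R)) \<Longrightarrow>
      thesis" for p thesis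
  proof -
    obtain q' where q': "is_prime R q'" "q' \<subseteq> p" "star_ideal n c F \<subseteq> q'"
      "\<not> linear_type (localize R q' R) (localize R q' (star_ideal n c F))"
      "\<not> min_gens (ring_on (localize R q' R)) (localize R q' (star_ideal n c F)) \<le> krull_dim (ring_on (localize R q' R))"
      using bad_prime p(1,3) unfolding R_def by blast
    have "primeideal p (ring_on R)" using p(1) by (simp add: R_def prime_iff)
    then have "height (ring_on R) q' \<le> enat (s - 1)"
      by (rule order_trans[OF height_mono[OF _ q'(2)] p(2)])
    then show thesis by (rule q[OF q'(1) _ q'(3-5)])
  qed
  have "(\<forall>p. primeideal p (ring_on R) \<and> height (ring_on R) p \<le> enat (s - 1) \<longrightarrow>
      linear_type (localize R p R) (localize R p (star_ideal n c F))) \<longleftrightarrow> ?ok"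
  proof
    assume l: "\<forall>p. primeideal p (ring_on R) \<and> height (ring_on R) p \<le> enat (s - 1) \<longrightarrow>
      linear_type (localize R p R) (localize R p (star_ideal n c F))"
    show ?ok
    proof (intro allI impI, rule ccontr)
      fix p assume p: "is_prime R p \<and> height (ring_on R) p \<le> enat (s - 1)" "\<not> good p"
      show False by (rule bad[of p]) (use l p in \<open>auto simp: R_def prime_iff\<close>)
    qed
  qed (use good_linear_type in \<open>auto simp: R_def prime_iff\<close>)
  moreover have "G_cond R s (star_ideal n c F) \<longleftrightarrow> ?ok"
  proof
    assume g: "G_cond R s (star_ideal n c F)"
    show ?ok
    proof (intro allI impI, rule ccontr)
      fix p assume p: "is_prime R p \<and> height (ring_on R) p \<le> enat (s - 1)" "\<not> good p"
      show False by (rule bad[of p]) (use g p in \<open>auto simp: G_cond_def R_def prime_iff\<close>)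
    qed
  qed (use good_min_gens in \<open>auto simp: G_cond_def R_def prime_iff\<close>)
  ultimately show ?thesis by simp
qed

end
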